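(* Let $k\ge 1$ be an integer and let $G$ be an $(X,Y,a,b)$-graph with $a\ge 6k$ and $b\ge 6k$. Let $\lambda_2$ be the second largest eigenvalue of the adjacency matrix of $G$. If $$\lambda_2\le \sqrt{ab} -\frac{3k+\max\{a,b\}}{\sqrt{\left\lceil\frac{a-1}{2}\right\rceil\left\lceil\frac{b-1}{2}\right\rceil}},$$ then $G$ has at least $k$ pairwise edge-disjoint spanning subgraphs each of which is rigid in $\mathbb{R}^2$.
   Context: All graphs are finite and simple. An $(X,Y,a,b)$-graph is a bipartite graph with bipartition $(X,Y)$ ($X,Y$ nonempty, $a,b$ positive integers) in which every vertex of $X$ has degree $a$ and every vertex of $Y$ has degree $b$ (so $a|X|=b|Y|$); it is not assumed connected. The eigenvalues of the adjacency matrix of $G$ on $n$ vertices are ordered $\lambda_1\ge\lambda_2\ge\cdots\ge\lambda_n$, counted with multiplicity. Rigidity in $\mathbb{R}^2$: a framework $(H,p)$ in $\mathbb{R}^2$ is a graph $H$ with a map $p:V(H)\to\mathbb{R}^2$. Frameworks $(H,p)$ and $(H,q)$ are equivalent (resp. congruent) if $\|p(u)-p(v)\|=\|q(u)-q(v)\|$ for all $uv\in E(H)$ (resp. for all $u,v\in V(H)$), where $\|\cdot\|$ is the Euclidean norm. $(H,p)$ is generic if the coordinates of its points are algebraically independent over $\mathbb{Q}$. $(H,p)$ is rigid if there is $\varepsilon>0$ such that every framework $(H,q)$ equivalent to $(H,p)$ with $\|p(u)-q(u)\|<\varepsilon$ for all $u\in V(H)$ is congruent to $(H,p)$. The graph $H$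 is rigid in $\mathbb{R}^2$ if some (equivalently, every) generic framework of $H$ in $\mathbb{R}^2$ is rigid. By the known Geiringer–Laman characterization, $H$ is rigid in $\mathbb{R}^2$ if and only if it contains a spanning Laman subgraph, where a Laman graph is a graph $L$ with $|E(L)|=2|V(L)|-3$ such that every vertex subset $U$ with $|U|\ge 2$ induces at most $2|U|-3$ edges of $L$. *)

theory Defs
  imports
    "HOL-Analysis.Analysis"
    "HOL-Library.Poly_Mapping"
    "HOL-Library.Disjoint_Sets"
    "Jordan_Normal_Form.Char_Poly"
begin

section \<open>Finite simple graphs\<close>

text \<open>A graph is given by a vertex set and a set of two-element subsets of it, so that
  edge-disjointness and spanning subgraphs are disjointness and inclusion of edge sets.\<close>

definition simple_graph :: "'a set \<Rightarrow> 'a set set \<Rightarrow> bool" where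
  "simple_graph V E \<longleftrightarrow> finite V \<and> (\<forall>e\<in>E. e \<subseteq> V \<and> card e = 2)"

definition degree_in :: "'a set set \<Rightarrow> 'a \<Rightarrow> nat" where
  "degree_in E v = card {e \<in> E. v \<in> e}"

definition biregular_graph :: "'a set \<Rightarrow> 'a set \<Rightarrow> nat \<Rightarrow> nat \<Rightarrow> 'a set set \<Rightarrow> bool" where
  "biregular_graph X Y a b E \<longleftrightarrow>
     simple_graph (X \<union> Y) E \<and> X \<noteq> {} \<and> Y \<noteq> {} \<and> X \<inter> Y = {} \<and> 0 < a \<and> 0 < b \<and>
     (\<forall>e\<in>E. \<exists>x\<in>X. \<exists>y\<in>Y. e = {x, y}) \<and>
     (\<forall>x\<in>X. degree_in E x = a) \<and> (\<forall>y\<in>Y. degree_in E y = b)"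

definition spanning_subgraph :: "'a set set \<Rightarrow> 'a set \<Rightarrow> 'a set set \<Rightarrow> bool" where
  "spanning_subgraph F V E \<longleftrightarrow> simple_graph V F \<and> F \<subseteq> E"


section \<open>Adjacency eigenvalues\<close>

definition adjacency_matrix :: "'a list \<Rightarrow> 'a set set \<Rightarrow> real mat" where
  "adjacency_matrix vs E =
     mat (length vs) (length vs) (\<lambda>(i, j). if {vs ! i, vs ! j} \<in> E then 1 else 0)"

text \<open>Matrices are indexed by natural numbers, so some enumeration of the vertices is chosen.
  Another choice conjugates the adjacency matrix by a permutation matrix and leaves the
  characteristic polynomial unchanged.\<close>

definition vertex_enum :: "'a set \<Rightarrow> 'a list" where
  "vertex_enum V = (SOME vs. distinct vs \<and> set vs = V)"

text \<open>All eigenvalues of the (real symmetric) adjacency matrix are real, so its real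
  characteristic polynomial has exactly \<open>card V\<close> roots counted with multiplicity; \<open>proots\<close> is the
  multiset of these.  They are listed in non-increasing order, and \<open>graph_eigenvalue\<close> counts
  from 1, so that \<open>graph_eigenvalue V E 1\<close> is the largest.\<close>

definition graph_eigenvalues :: "'a set \<Rightarrow> 'a set set \<Rightarrow> real list" where
  "graph_eigenvalues V E =
     rev (sorted_list_of_multiset (proots (char_poly (adjacency_matrix (vertex_enum V) E))))"

definition graph_eigenvalue :: "'a set \<Rightarrow> 'a set set \<Rightarrow> nat \<Rightarrow> real" where
  "graph_eigenvalue V E i = graph_eigenvalues V E ! (i - 1)"


section \<open>Algebraic independence over the rationals\<close>

text \<open>Multivariate polynomials with rational coefficients in variables of type \<open>'i\<close> are finitely
  supported maps from monomials \<open>'i \<Rightarrow>\<^sub>0 nat\<close> to coefficients.\<close>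

definition eval_rat_mpoly :: "(('i \<Rightarrow>\<^sub>0 nat) \<Rightarrow>\<^sub>0 rat) \<Rightarrow> ('i \<Rightarrow> real) \<Rightarrow> real" where
  "eval_rat_mpoly P x =
     (\<Sum>m\<in>Poly_Mapping.keys P. of_rat (Poly_Mapping.lookup P m) *
        (\<Prod>i\<in>Poly_Mapping.keys m. x i ^ Poly_Mapping.lookup m i))"

definition alg_independent_rat :: "'i set \<Rightarrow> ('i \<Rightarrow> real) \<Rightarrow> bool" where
  "alg_independent_rat I x \<longleftrightarrow>
     (\<forall>P :: ('i \<Rightarrow>\<^sub>0 nat) \<Rightarrow>\<^sub>0 rat.
        P \<noteq> 0 \<and> (\<forall>m\<in>Poly_Mapping.keys P. Poly_Mapping.keys m \<subseteq> I) \<longrightarrow> eval_rat_mpoly P x \<noteq> 0)"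


section \<open>Rigidity in the plane\<close>

text \<open>A framework is a graph together with a placement \<open>p\<close> of its vertices; only the values of
  \<open>p\<close> on the vertex set matter.\<close>

definition equivalent_frameworks ::
    "'a set set \<Rightarrow> ('a \<Rightarrow> real ^ 2) \<Rightarrow> ('a \<Rightarrow> real ^ 2) \<Rightarrow> bool" where
  "equivalent_frameworks E p q \<longleftrightarrow>
     (\<forall>u v. {u, v} \<in> E \<longrightarrow> norm (p u - p v) = norm (q u - q v))"

definition congruent_frameworks ::
    "'a set \<Rightarrow> ('a \<Rightarrow> real ^ 2) \<Rightarrow> ('a \<Rightarrow> real ^ 2) \<Rightarrow> bool" where
  "congruent_frameworks V p q \<longleftrightarrow>
     (\<forall>u\<in>V. \<forall>v\<in>V. norm (p u - p v) = norm (q u - q v))"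

definition generic_framework :: "'a set \<Rightarrow> ('a \<Rightarrow> real ^ 2) \<Rightarrow> bool" where
  "generic_framework V p \<longleftrightarrow>
     alg_independent_rat (V \<times> (UNIV :: 2 set)) (\<lambda>(v, i). vec_nth (p v) i)"

definition rigid_framework :: "'a set \<Rightarrow> 'a set set \<Rightarrow> ('a \<Rightarrow> real ^ 2) \<Rightarrow> bool" where
  "rigid_framework V E p \<longleftrightarrow>
     (\<exists>\<epsilon>>0. \<forall>q. equivalent_frameworks E p q \<and> (\<forall>u\<in>V. norm (p u - q u) < \<epsilon>)
        \<longrightarrow> congruent_frameworks V p q)"

definition rigid_graph :: "'a set \<Rightarrow> 'a set set \<Rightarrow> bool" where
  "rigid_graph V E \<longleftrightarrow> (\<exists>p. generic_framework V p \<and> rigid_framework V E p)"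

end

theory Submission
  imports Defs
begin

text \<open>By matroid union and the rank formula of the Laman count, \<open>k\<close> edge-disjoint Laman graphs span \<open>G\<close>
  unless some family \<open>H\<close> of vertex sets covers all but fewer than
  \<open>k * (2 * card V - 3) - k * (\<Sum>X\<in>H. 2 * card X - 3)\<close> edges.  A charging argument excludes such
  a family if deleting at most two vertices \<open>B\<close> leaves every cut with at least
  \<open>6 * k - 2 * k * card B\<close> edges.  This in turn follows from the spectral gap: the bipartite degrees
  force both sides of a smaller cut to contain about half of a neighbourhood in each colour class,
  and the Rayleigh quotient of the degree-weighted cut vector then makes the cut too large.
  That Laman graphs are rigid is shown by Henneberg induction for some placement, transferred to
  generic placements by a Gram determinant, and passed from infinitesimal to local rigidity by the
  observation that the difference of two equivalent placements is an infinitesimal motion of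
  their midpoint.\<close>

text \<open>The numerator \<open>3 * k + max a b\<close> pays for the separator: distributing at
  most two vertices \<open>B\<close> over the sides turns a cut of fewer than
  \<open>6 * k - 2 * k * card B\<close> edges into one of fewer than \<open>2 * k + max a b\<close>,
  since \<open>max a b\<close> is at least \<open>4 * k\<close>. The denominator measures the sides:
  with p, q the two ceilings under the root, each side has at least q vertices in \<open>X\<close>
  and p in \<open>Y\<close>, so its degree sum is at least a q + b p, hence at least 2 sqrt(ab)
  sqrt(pq), and the Rayleigh quotient forces (sqrt(ab) minus the second eigenvalue) times sqrt(pq)
  cut edges. The \<open>6 * k\<close> is twice the 3 of the Laman count: a doubled cover term
  \<open>4 * card X - 6\<close> lacks 6 of the 4 that each vertex of \<open>X\<close> asks for.
  Henneberg moves give special placements (a new vertex at a midpoint), while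
  \<open>rigid_graph\<close> asks for a generic one; so independence is expressed by one function
  that is polynomial in the coordinates, for which a single good placement suffices. Eigenvalues
  count with multiplicity, so two orthogonal eigenfunctions with the same eigenvalue must be shown
  to give a double root of the characteristic polynomial.\<close>

no_notation Matrix.vec_index (infixl "$" 100)
no_notation Matrix.scalar_prod (infix "\<bullet>" 70)
no_notation fps_nth (infixl "$" 75)

section \<open>Sparse edge sets\<close>

definition edges_within :: "'a set set \<Rightarrow> 'a set \<Rightarrow> 'a set set" where
  "edges_within I U = {e \<in> I. e \<subseteq> U}"

text \<open>The Laman count without its condition on the total number of edges, that is,
  independence in the generic rigidity matroid of the plane. Adding 3 on the left avoids truncated
  subtraction.\<close>

definition sparse_on :: "'a set \<Rightarrow> 'a set set \<Rightarrow> bool" where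
  "sparse_on V I \<longleftrightarrow> simple_graph V I \<and>
     (\<forall>U\<subseteq>V. 2 \<le> card U \<longrightarrow> card (edges_within I U) + 3 \<le> 2 * card U)"

definition tight_on :: "'a set \<Rightarrow> 'a set set \<Rightarrow> 'a set \<Rightarrow> bool" where
  "tight_on V I U \<longleftrightarrow> U \<subseteq> V \<and> 2 \<le> card U \<and> card (edges_within I U) + 3 = 2 * card U"

definition sparse_rank :: "'a set \<Rightarrow> 'a set set \<Rightarrow> nat" where
  "sparse_rank V F = Max (card ` {I. I \<subseteq> F \<and> sparse_on V I})"

lemma simple_graph_finite_edges: "simple_graph V E \<Longrightarrow> finite E"
  unfolding simple_graph_def by (meson PowI finite_Pow_iff finite_subset subsetI)

lemma simple_graph_mono: "simple_graph V E \<Longrightarrow> F \<subseteq> E \<Longrightarrow> simple_graph V F"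
  unfolding simple_graph_def by blast

lemma simple_graph_edgeE:
  assumes "simple_graph V E" "e \<in> E"
  obtains u v where "e = {u, v}" "u \<noteq> v" "u \<in> V" "v \<in> V"
proof -
  have "e \<subseteq> V" "card e = 2" using assms unfolding simple_graph_def by auto
  then show ?thesis using that by (metis card_2_iff insert_subset)
qed

lemma finite_edges_within: "finite I \<Longrightarrow> finite (edges_within I U)"
  by (simp add: edges_within_def)

lemma card_edges_within_supermodular:
  assumes "finite I"
  shows "card (edges_within I A) + card (edges_within I B)
    \<le> card (edges_within I (A \<union> B)) + card (edges_within I (A \<inter> B))"
proof -
  have "card (edges_within I A) + card (edges_within I B)
      = card (edges_within I A \<union> edges_within I B) + card (edges_within I A \<inter> edges_within I B)"
    by (rule card_Un_Int) (rule finite_edges_within[OF assms])+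
  moreover have "edges_within I A \<inter> edges_within I B = edges_within I (A \<inter> B)"
    by (auto simp: edges_within_def)
  moreover have "card (edges_within I A \<union> edges_within I B) \<le> card (edges_within I (A \<union> B))"
    by (intro card_mono finite_edges_within assms) (auto simp: edges_within_def)
  ultimately show ?thesis by simp
qed

lemma sparse_onD: "sparse_on V I \<Longrightarrow> U \<subseteq> V \<Longrightarrow> 2 \<le> card U \<Longrightarrow>
    card (edges_within I U) + 3 \<le> 2 * card U"
  unfolding sparse_on_def by blast

lemma sparse_on_simple: "sparse_on V I \<Longrightarrow> simple_graph V I"
  unfolding sparse_on_def by blast

lemma sparse_on_finite: "sparse_on V I \<Longrightarrow> finite I"
  using sparse_on_simple simple_graph_finite_edges by blast

lemma sparse_on_finite_verts: "sparse_on V I \<Longrightarrow> finite V"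
  unfolding sparse_on_def simple_graph_def by blast

lemma sparse_on_subset: "sparse_on V I \<Longrightarrow> J \<subseteq> I \<Longrightarrow> sparse_on V J"
proof -
  assume I: "sparse_on V I" and "J \<subseteq> I"
  have "card (edges_within J U) \<le> card (edges_within I U)" for U
    using \<open>J \<subseteq> I\<close> by (intro card_mono finite_edges_within sparse_on_finite[OF I])
      (auto simp: edges_within_def)
  then show ?thesis
    using I \<open>J \<subseteq> I\<close> simple_graph_mono unfolding sparse_on_def by (meson add_le_mono1 order_trans)
qed

lemma sparse_on_empty: "finite V \<Longrightarrow> sparse_on V {}"
  by (auto simp: sparse_on_def simple_graph_def edges_within_def)

lemma sparse_on_card_le:
  assumes "sparse_on V I" "2 \<le> card V"
  shows "card I + 3 \<le> 2 * card V"
proof -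
  have "edges_within I V = I"
    using sparse_on_simple[OF assms(1)] by (auto simp: edges_within_def simple_graph_def)
  then show ?thesis using sparse_onD[OF assms(1) subset_refl assms(2)] by simp
qed

section \<open>Tight sets and the rank formula\<close>

text \<open>Uncrossing: the edge count is supermodular and \<open>2 * card U - 3\<close> is modular.
  The intersection needs two vertices for the sparsity bound to apply to it.\<close>

lemma tight_on_Un:
  assumes I: "sparse_on V I" and A: "tight_on V I A" and B: "tight_on V I B"
    and "2 \<le> card (A \<inter> B)"
  shows "tight_on V I (A \<union> B)"
proof -
  have sub: "A \<subseteq> V" "B \<subseteq> V" using A B by (auto simp: tight_on_def)
  then have fin: "finite A" "finite B"
    using sparse_on_finite_verts[OF I] finite_subset by auto
  have c: "card A + card B = card (A \<union> B) + card (A \<inter> B)"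
    by (rule card_Un_Int[OF fin])
  have u2: "2 \<le> card (A \<union> B)"
    using assms(4) card_mono[of "A \<union> B" "A \<inter> B"] fin by fastforce
  have 1: "card (edges_within I (A \<union> B)) + 3 \<le> 2 * card (A \<union> B)"
    by (rule sparse_onD[OF I _ u2]) (use sub in blast)
  have 2: "card (edges_within I (A \<inter> B)) + 3 \<le> 2 * card (A \<inter> B)"
    by (rule sparse_onD[OF I _ assms(4)]) (use sub in blast)
  have 3: "card (edges_within I A) + card (edges_within I B)
    \<le> card (edges_within I (A \<union> B)) + card (edges_within I (A \<inter> B))"
    by (rule card_edges_within_supermodular[OF sparse_on_finite[OF I]])
  show ?thesis
    using 1 2 3 c A B sub u2 unfolding tight_on_def by auto
qed

lemma tight_on_edge:
  assumes I: "sparse_on V I" and "e \<in> I"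
  shows "tight_on V I e"
proof -
  have e: "e \<subseteq> V" "card e = 2"
    using sparse_on_simple[OF I] assms(2) by (auto simp: simple_graph_def)
  have "e \<in> edges_within I e" using assms by (auto simp: edges_within_def)
  then have "card (edges_within I e) \<ge> 1"
    using finite_edges_within[OF sparse_on_finite[OF I]]
    by (metis One_nat_def Suc_leI card_gt_0_iff empty_iff)
  moreover have "card (edges_within I e) + 3 \<le> 2 * card e"
    by (rule sparse_onD[OF I]) (use e in auto)
  ultimately show ?thesis using e unfolding tight_on_def by auto
qed

text \<open>An insertion can only fail at a vertex set that contains the new pair and whose count is
  already exhausted. A pair that is an edge of \<open>I\<close> is itself such a set.\<close>

lemma blocked_pair_tight:
  assumes I: "sparse_on V I" and e: "e \<subseteq> V" "card e = 2"
    and ns: "e \<in> I \<or> \<not> sparse_on V (insert e I)"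
  shows "\<exists>U. tight_on V I U \<and> e \<subseteq> U"
proof (cases "e \<in> I")
  case True
  then show ?thesis using tight_on_edge[OF I] by blast
next
  case False
  have "simple_graph V (insert e I)"
    using sparse_on_simple[OF I] e by (auto simp: simple_graph_def)
  then obtain U where U: "U \<subseteq> V" "2 \<le> card U"
    "\<not> card (edges_within (insert e I) U) + 3 \<le> 2 * card U"
    using ns False unfolding sparse_on_def by blast
  have le: "card (edges_within I U) + 3 \<le> 2 * card U" using sparse_onD[OF I] U by blast
  have "e \<subseteq> U"
  proof (rule ccontr)
    assume "\<not> e \<subseteq> U"
    then have "edges_within (insert e I) U = edges_within I U" by (auto simp: edges_within_def)
    with U le show False by simp
  qed
  then have "edges_within (insert e I) U = insert e (edges_within I U)"
    by (auto simp: edges_within_def)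
  then have "card (edges_within (insert e I) U) \<le> card (edges_within I U) + 1"
    by (simp add: card_insert_le_m1 card_insert_if finite_edges_within sparse_on_finite[OF I])
  then have "tight_on V I U" using U le unfolding tight_on_def by linarith
  with \<open>e \<subseteq> U\<close> show ?thesis by blast
qed

text \<open>Maximal tight sets pairwise share at most one vertex, so they partition the edges.\<close>

lemma tight_cover:
  assumes I: "sparse_on V I"
  obtains H where "finite H" "\<And>X. X \<in> H \<Longrightarrow> X \<subseteq> V \<and> 2 \<le> card X"
    "card I = (\<Sum>X\<in>H. 2 * card X - 3)"
    "\<And>U. tight_on V I U \<Longrightarrow> \<exists>X\<in>H. U \<subseteq> X"
proof -
  define H where "H = {U. tight_on V I U \<and> (\<forall>W. tight_on V I W \<and> U \<subseteq> W \<longrightarrow> W = U)}"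
  have finV: "finite V" by (rule sparse_on_finite_verts[OF I])
  have HV: "H \<subseteq> Pow V" by (auto simp: H_def tight_on_def)
  have finH: "finite H" using HV finV by (meson finite_Pow_iff finite_subset)
  have max: "\<exists>X\<in>H. U \<subseteq> X" if "tight_on V I U" for U
  proof -
    let ?S = "{W. tight_on V I W}"
    have "finite ?S"
      by (rule finite_subset[of _ "Pow V"]) (use finV in \<open>auto simp: tight_on_def\<close>)
    from finite_has_maximal2[OF this, of U] that obtain X where
      "X \<in> ?S" "U \<subseteq> X" "\<forall>W\<in>?S. X \<subseteq> W \<longrightarrow> X = W"
      by (metis mem_Collect_eq)
    then show ?thesis unfolding H_def by (intro bexI[of _ X]) auto
  qed
  have disj: "edges_within I X \<inter> edges_within I Y = {}" if "X \<in> H" "Y \<in> H" "X \<noteq> Y" for X Y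
  proof (rule ccontr)
    assume "edges_within I X \<inter> edges_within I Y \<noteq> {}"
    then obtain e where e: "e \<in> I" "e \<subseteq> X \<inter> Y" by (auto simp: edges_within_def)
    have "card e = 2" using e sparse_on_simple[OF I] by (auto simp: simple_graph_def)
    moreover have "finite (X \<inter> Y)" using that(1) HV finV finite_subset by blast
    ultimately have "2 \<le> card (X \<inter> Y)" using card_mono e(2) by metis
    then have "tight_on V I (X \<union> Y)"
      using tight_on_Un[OF I] that unfolding H_def by blast
    then show False using that unfolding H_def by blast
  qed
  have "I = (\<Union>X\<in>H. edges_within I X)"
    using max[OF tight_on_edge[OF I]] by (auto simp: edges_within_def)
  then have "card I = card (\<Union>X\<in>H. edges_within I X)"
    by (rule arg_cong)
  also have "\<dots> = (\<Sum>X\<in>H. card (edges_within I X))"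
    using finite_edges_within[OF sparse_on_finite[OF I]] disj
    by (intro card_UN_disjoint[OF finH]) auto
  also have "\<dots> = (\<Sum>X\<in>H. 2 * card X - 3)"
  proof (rule sum.cong[OF refl])
    fix X assume "X \<in> H"
    then have "card (edges_within I X) + 3 = 2 * card X" by (auto simp: H_def tight_on_def)
    then show "card (edges_within I X) = 2 * card X - 3" by linarith
  qed
  finally have "card I = (\<Sum>X\<in>H. 2 * card X - 3)" .
  then show ?thesis using that[OF finH _ _ max] by (auto simp: H_def tight_on_def)
qed

text \<open>The easy half of the rank formula: each set of the cover holds at most its Laman count
  of edges of \<open>J\<close>.\<close>

lemma card_le_cover:
  assumes J: "sparse_on V J" and H: "finite H" "\<And>X. X \<in> H \<Longrightarrow> X \<subseteq> V \<and> 2 \<le> card X"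
    and cov: "\<And>e. e \<in> J \<Longrightarrow> \<exists>X\<in>H. e \<subseteq> X"
  shows "card J \<le> (\<Sum>X\<in>H. 2 * card X - 3)"
proof -
  have "J \<subseteq> (\<Union>X\<in>H. edges_within J X)" using cov by (auto simp: edges_within_def)
  then have "card J \<le> card (\<Union>X\<in>H. edges_within J X)"
    by (intro card_mono) (auto simp: H finite_edges_within sparse_on_finite[OF J])
  also have "\<dots> \<le> (\<Sum>X\<in>H. card (edges_within J X))" by (rule card_UN_le[OF H(1)])
  also have "\<dots> \<le> (\<Sum>X\<in>H. 2 * card X - 3)"
    using sparse_onD[OF J] H(2) by (intro sum_mono) (meson add_le_imp_le_diff)
  finally show ?thesis .
qed

section \<open>The sparsity matroid and its rank function\<close>

text \<open>If every edge of \<open>J\<close> were blocked, all of them would lie in maximal tight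
  sets of \<open>I\<close>. The same sum counts \<open>I\<close> exactly and bounds
  \<open>card J\<close> from above.\<close>

lemma sparse_on_augment:
  assumes I: "sparse_on V I" and J: "sparse_on V J" and "card I < card J"
  shows "\<exists>e\<in>J - I. sparse_on V (insert e I)"
proof (rule ccontr)
  assume "\<not> ?thesis"
  then have blocked: "e \<in> I \<or> \<not> sparse_on V (insert e I)" if "e \<in> J" for e using that by blast
  obtain H where H: "finite H" "\<And>X. X \<in> H \<Longrightarrow> X \<subseteq> V \<and> 2 \<le> card X"
    "card I = (\<Sum>X\<in>H. 2 * card X - 3)" "\<And>U. tight_on V I U \<Longrightarrow> \<exists>X\<in>H. U \<subseteq> X"
    using tight_cover[OF I] by metis
  have "\<exists>X\<in>H. e \<subseteq> X" if "e \<in> J" for e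
  proof -
    have "e \<subseteq> V" "card e = 2"
      using sparse_on_simple[OF J] that by (auto simp: simple_graph_def)
    then show ?thesis using blocked_pair_tight[OF I _ _ blocked[OF that]] H(4) by (meson order_trans)
  qed
  from card_le_cover[OF J H(1,2) this] H(3) assms(3) show False by simp
qed

lemma finite_sparse_subsets:
  assumes "finite V"
  shows "finite {I. I \<subseteq> F \<and> sparse_on V I}"
  by (rule finite_subset[of _ "Pow (Pow V)"])
    (use assms in \<open>auto simp: sparse_on_def simple_graph_def\<close>)

lemma sparse_rank_ge:
  assumes "sparse_on V I" "I \<subseteq> F"
  shows "card I \<le> sparse_rank V F"
  unfolding sparse_rank_def
  using assms finite_sparse_subsets[OF sparse_on_finite_verts[OF assms(1)]] by (intro Max_ge) auto

lemma sparse_rank_attained: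
  assumes "finite V"
  obtains I where "sparse_on V I" "I \<subseteq> F" "card I = sparse_rank V F"
proof -
  have "sparse_rank V F \<in> card ` {I. I \<subseteq> F \<and> sparse_on V I}"
    unfolding sparse_rank_def using assms sparse_on_empty
    by (intro Max_in finite_imageI finite_sparse_subsets) blast+
  then show ?thesis using that by auto
qed

lemma sparse_rank_extend:
  assumes "sparse_on V I" "I \<subseteq> F"
  obtains J where "sparse_on V J" "I \<subseteq> J" "J \<subseteq> F" "card J = sparse_rank V F"
proof -
  have finV: "finite V" by (rule sparse_on_finite_verts[OF assms(1)])
  let ?S = "{J. J \<subseteq> F \<and> sparse_on V J}"
  have "I \<in> ?S" using assms by simp
  from finite_has_maximal2[OF finite_sparse_subsets[OF finV] this] obtain J where
    JS: "J \<in> ?S" "I \<subseteq> J" and max': "\<forall>K\<in>?S. J \<subseteq> K \<longrightarrow> J = K"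
    by metis
  have J: "sparse_on V J" "I \<subseteq> J" "J \<subseteq> F" using JS by auto
  have max: "J = K" if "sparse_on V K" "K \<subseteq> F" "J \<subseteq> K" for K
    using max' that by blast
  obtain K where K: "sparse_on V K" "K \<subseteq> F" "card K = sparse_rank V F"
    using sparse_rank_attained[OF finV] .
  have "\<not> card J < card K"
  proof
    assume "card J < card K"
    then obtain e where "e \<in> K - J" "sparse_on V (insert e J)"
      using sparse_on_augment[OF J(1) K(1)] by blast
    then show False using max[of "insert e J"] J K(2) by blast
  qed
  then show ?thesis using that J K(3) sparse_rank_ge[OF J(1,3)] by auto
qed

lemma sparse_rank_mono:
  assumes "finite V" "F \<subseteq> G"
  shows "sparse_rank V F \<le> sparse_rank V G"
  using sparse_rank_attained[OF assms(1), of F] sparse_rank_ge assms(2) by (metis order_trans)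

lemma sparse_rank_le:
  assumes "2 \<le> card V"
  shows "sparse_rank V F + 3 \<le> 2 * card V"
proof -
  have "finite V" using assms by (metis card.infinite not_numeral_le_zero)
  then show ?thesis
    using sparse_rank_attained[of V F] sparse_on_card_le[OF _ assms] by metis
qed

text \<open>A basis of the intersection is extended to one of \<open>A\<close> and then to one of
  the union. What the second extension adds lies in \<open>B\<close>, for otherwise it would enlarge
  the basis of \<open>A\<close>; together with the first basis it is a sparse subset of
  \<open>B\<close>.\<close>

lemma sparse_rank_submodular:
  assumes "finite V"
  shows "sparse_rank V (A \<union> B) + sparse_rank V (A \<inter> B) \<le> sparse_rank V A + sparse_rank V B"
proof -
  obtain B0 where B0: "sparse_on V B0" "B0 \<subseteq> A \<inter> B" "card B0 = sparse_rank V (A \<inter> B)"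
    using sparse_rank_attained[OF assms] .
  obtain B1 where B1: "sparse_on V B1" "B0 \<subseteq> B1" "B1 \<subseteq> A" "card B1 = sparse_rank V A"
    using sparse_rank_extend[OF B0(1), of A] B0(2) by blast
  obtain B2 where B2: "sparse_on V B2" "B1 \<subseteq> B2" "B2 \<subseteq> A \<union> B"
    "card B2 = sparse_rank V (A \<union> B)"
    using sparse_rank_extend[OF B1(1), of "A \<union> B"] B1(3) by blast
  have fin: "finite B0" "finite B1" "finite B2"
    using sparse_on_finite B0(1) B1(1) B2(1) by auto
  have "B2 - B1 \<subseteq> B"
  proof
    fix e assume e: "e \<in> B2 - B1"
    show "e \<in> B"
    proof (rule ccontr)
      assume "e \<notin> B"
      then have "e \<in> A" using e B2 by blast
      have "sparse_on V (insert e B1)" by (rule sparse_on_subset[OF B2(1)]) (use e B2 in blast)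
      from sparse_rank_ge[OF this, of A] \<open>e \<in> A\<close> B1 e fin show False by simp
    qed
  qed
  then have sub: "(B2 - B1) \<union> B0 \<subseteq> B" using B0 by blast
  have "sparse_on V ((B2 - B1) \<union> B0)"
    by (rule sparse_on_subset[OF B2(1)]) (use B1 B2 in blast)
  from sparse_rank_ge[OF this sub]
  have "card ((B2 - B1) \<union> B0) \<le> sparse_rank V B" .
  moreover have "card ((B2 - B1) \<union> B0) = card B2 - card B1 + card B0"
  proof -
    have "(B2 - B1) \<inter> B0 = {}" using B1 by blast
    then have "card ((B2 - B1) \<union> B0) = card (B2 - B1) + card B0"
      using fin by (simp add: card_Un_disjoint)
    then show ?thesis using card_Diff_subset[OF fin(2) B2(2)] by simp
  qed
  moreover have "card B1 \<le> card B2" using card_mono[OF fin(3) B2(2)] .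
  ultimately show ?thesis using B0 B1 B2 by linarith
qed

text \<open>The hard half of the rank formula: an edge of \<open>F\<close> outside a maximum sparse
  subset is blocked by a tight set, so the maximal tight sets cover all of \<open>F\<close>, not
  only that subset.\<close>

lemma sparse_rank_cover:
  assumes F: "simple_graph V F"
  obtains H where "finite H" "\<And>X. X \<in> H \<Longrightarrow> X \<subseteq> V \<and> 2 \<le> card X"
    "sparse_rank V F = (\<Sum>X\<in>H. 2 * card X - 3)" "\<And>e. e \<in> F \<Longrightarrow> \<exists>X\<in>H. e \<subseteq> X"
proof -
  have finV: "finite V" using F by (simp add: simple_graph_def)
  obtain I where I: "sparse_on V I" "I \<subseteq> F" "card I = sparse_rank V F"
    using sparse_rank_attained[OF finV] .
  obtain H where H: "finite H" "\<And>X. X \<in> H \<Longrightarrow> X \<subseteq> V \<and> 2 \<le> card X"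
    "card I = (\<Sum>X\<in>H. 2 * card X - 3)" "\<And>U. tight_on V I U \<Longrightarrow> \<exists>X\<in>H. U \<subseteq> X"
    using tight_cover[OF I(1)] by metis
  have "\<exists>X\<in>H. e \<subseteq> X" if e: "e \<in> F" for e
  proof -
    have 2: "e \<subseteq> V" "card e = 2" using F e by (auto simp: simple_graph_def)
    have "e \<in> I \<or> \<not> sparse_on V (insert e I)"
    proof (rule ccontr)
      assume *: "\<not> ?thesis"
      then have "card (insert e I) \<le> sparse_rank V F" using sparse_rank_ge[of V "insert e I" F] I e by blast
      then show False using * I sparse_on_finite[OF I(1)] by simp
    qed
    then show ?thesis using blocked_pair_tight[OF I(1) 2] H(4) by (meson order_trans)
  qed
  then show ?thesis using that[OF H(1,2)] H(3) I(3) by metis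
qed

section \<open>Packing sparse sets\<close>

text \<open>Rado's theorem in the polymatroid form.  As in Welsh's proof, a set with two elements can
  always lose one of them: two violated conditions would contradict submodularity.\<close>

lemma rado_transversal:
  fixes \<mu> :: "'s set \<Rightarrow> nat" and A :: "'e \<Rightarrow> 's set"
  assumes mono: "\<And>S T. S \<subseteq> T \<Longrightarrow> \<mu> S \<le> \<mu> T"
    and submod: "\<And>S T. \<mu> (S \<union> T) + \<mu> (S \<inter> T) \<le> \<mu> S + \<mu> T"
    and empty: "\<mu> {} = 0"
    and finE: "finite E" and finA: "\<And>e. e \<in> E \<Longrightarrow> finite (A e)"
    and rado: "\<And>J. J \<subseteq> E \<Longrightarrow> card J \<le> \<mu> (\<Union>e\<in>J. A e)"
  shows "\<exists>x. (\<forall>e\<in>E. x e \<in> A e) \<and> (\<forall>J\<subseteq>E. card J \<le> \<mu> (x ` J))"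
  using finA rado
proof (induction "\<Sum>e\<in>E. card (A e)" arbitrary: A rule: less_induct)
  case (less A)
  show ?case
  proof (cases "\<forall>e\<in>E. \<exists>s. A e = {s}")
    case True
    then obtain x where x: "\<forall>e\<in>E. A e = {x e}" by metis
    have "card J \<le> \<mu> (x ` J)" if "J \<subseteq> E" for J
    proof -
      have "(\<Union>e\<in>J. A e) = x ` J" using x that by auto
      then show ?thesis using less.prems(2)[OF that] by simp
    qed
    with x show ?thesis by (intro exI[of _ x]) auto
  next
    case False
    then obtain e0 where e0: "e0 \<in> E" "\<nexists>s. A e0 = {s}" by blast
    have "A e0 \<noteq> {}"
    proof
      assume "A e0 = {}"
      with less.prems(2)[of "{e0}"] e0(1) empty show False by simp
    qed
    then obtain s t where st: "s \<in> A e0" "t \<in> A e0" "s \<noteq> t" using e0(2) by blast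
    define B where "B r = A(e0 := A e0 - {r})" for r
    have smaller: "(\<Sum>e\<in>E. card (B r e)) < (\<Sum>e\<in>E. card (A e))" if "r \<in> A e0" for r
    proof (rule sum_strict_mono_ex1[OF finE])
      show "\<forall>e\<in>E. card (B r e) \<le> card (A e)"
        using less.prems(1) by (auto simp: B_def intro: card_mono)
      show "\<exists>e\<in>E. card (B r e) < card (A e)"
        using e0(1) card_Diff1_less[OF less.prems(1)[OF e0(1)] that] unfolding B_def
        by (intro bexI[of _ e0]) simp_all
    qed
    have step: ?thesis if r: "r \<in> A e0" and h: "\<forall>J\<subseteq>E. card J \<le> \<mu> (\<Union>e\<in>J. B r e)" for r
    proof -
      have "finite (B r e)" if "e \<in> E" for e using less.prems(1)[OF that] by (auto simp: B_def)
      with less.hyps[OF smaller[OF r]] h obtain x where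
        x: "\<forall>e\<in>E. x e \<in> B r e" "\<forall>J\<subseteq>E. card J \<le> \<mu> (x ` J)" by blast
      have "\<forall>e\<in>E. x e \<in> A e" using x(1) by (auto simp: B_def split: if_splits)
      with x(2) show ?thesis by blast
    qed
    show ?thesis
    proof (rule ccontr)
      assume neg: "\<not> ?thesis"
      obtain J where J: "J \<subseteq> E" "\<mu> (\<Union>e\<in>J. B s e) < card J"
        using step[OF st(1)] neg by (meson not_le)
      obtain K where K: "K \<subseteq> E" "\<mu> (\<Union>e\<in>K. B t e) < card K"
        using step[OF st(2)] neg by (meson not_le)
      have mem: "e0 \<in> L" if "L \<subseteq> E" "\<mu> (\<Union>e\<in>L. B r e) < card L" for L r
      proof (rule ccontr)
        assume "e0 \<notin> L"
        then have "(\<Union>e\<in>L. B r e) = (\<Union>e\<in>L. A e)" by (auto simp: B_def)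
        with less.prems(2)[OF that(1)] that(2) show False by simp
      qed
      have e0J: "e0 \<in> J" and e0K: "e0 \<in> K" using mem J K by blast+
      have finJK: "finite J" "finite K" using J K finE finite_subset by auto
      let ?P = "\<Union>e\<in>J. B s e" and ?Q = "\<Union>e\<in>K. B t e"
      have "card (J \<union> K) \<le> \<mu> (\<Union>e\<in>J \<union> K. A e)" 
        by (rule less.prems(2)) (use J K in blast)
      \<comment> \<open>Nothing is lost at \<open>e0\<close>: it belongs to both index sets, and
        \<open>B s\<close> and \<open>B t\<close> drop different elements there.\<close>
      also have "\<dots> \<le> \<mu> (?P \<union> ?Q)"
      proof (rule mono, rule subsetI)
        fix z assume "z \<in> (\<Union>e\<in>J \<union> K. A e)"
        then obtain e where e: "e \<in> J \<union> K" "z \<in> A e" by blast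
        show "z \<in> ?P \<union> ?Q"
        proof (cases "e = e0")
          case True
          then have "z \<in> B s e0 \<or> z \<in> B t e0" using e st by (auto simp: B_def)
          then show ?thesis using e0J e0K by blast
        next
          case False
          then have "z \<in> B s e" "z \<in> B t e" using e by (auto simp: B_def)
          then show ?thesis using e by blast
        qed
      qed
      finally have 1: "card (J \<union> K) \<le> \<mu> (?P \<union> ?Q)" .
      \<comment> \<open>At \<open>e0\<close> the two families differ from \<open>A\<close>, so it is
        left out. This costs 1, while the two strict violations have a total deficit of at least
        2.\<close>
      have "card (J \<inter> K - {e0}) \<le> \<mu> (\<Union>e\<in>J \<inter> K - {e0}. A e)"
        by (rule less.prems(2)) (use J in blast)
      also have "\<dots> \<le> \<mu> (?P \<inter> ?Q)"
      proof (rule mono, rule subsetI)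
        fix z assume "z \<in> (\<Union>e\<in>J \<inter> K - {e0}. A e)"
        then obtain e where e: "e \<in> J" "e \<in> K" "e \<noteq> e0" "z \<in> A e" by blast
        then have "z \<in> B s e" "z \<in> B t e" by (auto simp: B_def)
        then show "z \<in> ?P \<inter> ?Q" using e by blast
      qed
      finally have "card (J \<inter> K - {e0}) \<le> \<mu> (?P \<inter> ?Q)" .
      moreover have "card (J \<inter> K - {e0}) + 1 = card (J \<inter> K)"
      proof -
        have "finite (J \<inter> K)" "e0 \<in> J \<inter> K" using finJK e0J e0K by auto
        then show ?thesis by (metis Suc_eq_plus1 card_Suc_Diff1)
      qed
      moreover have "card (J \<union> K) + card (J \<inter> K) = card J + card K"
        using card_Un_Int[OF finJK] by simp
      ultimately show False using 1 submod[of ?P ?Q] J(2) K(2) by linarith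
    qed
  qed
qed

text \<open>The defect version of Rado's theorem is obtained by adding \<open>d\<close> free elements that any edge
  may choose.\<close>

lemma sparse_packing:
  assumes G: "simple_graph V E" and V2: "2 \<le> card V"
    and rank: "\<And>F. F \<subseteq> E \<Longrightarrow> k * (2 * card V - 3) \<le> k * sparse_rank V F + card (E - F)"
  shows "\<exists>J :: nat \<Rightarrow> 'a set set. disjoint_family_on J {..<k} \<and>
    (\<forall>i<k. J i \<subseteq> E \<and> sparse_on V (J i) \<and> card (J i) + 3 = 2 * card V)"
proof -
  define m where "m = 2 * card V - 3"
  have finV: "finite V" using G by (simp add: simple_graph_def)
  have finE: "finite E" by (rule simple_graph_finite_edges[OF G])
  have r0: "sparse_rank V {} = 0"
    using sparse_rank_attained[OF finV, of "{}"] by (metis card.empty subset_empty)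
  \<comment> \<open>The empty \<open>F\<close> shows that there are enough edges, so the subtraction
    defining \<open>d\<close> does not truncate.\<close>
  have km: "k * m \<le> card E" using rank[of "{}"] r0 by (simp add: m_def)
  define d where "d = card E - k * m"
  \<comment> \<open>\<open>Inl (e, i)\<close> is the edge \<open>e\<close> placed in the
    \<open>i\<close>-th copy of the matroid, and \<open>Inr j\<close> is a free element. So \<mu> is
    the rank in the sum of \<open>k\<close> sparsity matroids and a free matroid on \<open>d\<close>
    elements.\<close>
  define \<mu> :: "(('a set \<times> nat) + nat) set \<Rightarrow> nat" where
    "\<mu> T = (\<Sum>i<k. sparse_rank V {e. Inl (e, i) \<in> T}) + card {j. j < d \<and> Inr j \<in> T}" for T
  define A :: "'a set \<Rightarrow> (('a set \<times> nat) + nat) set" where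
    "A e = Inl ` ({e} \<times> {..<k}) \<union> Inr ` {..<d}" for e
  have "\<exists>x. (\<forall>e\<in>E. x e \<in> A e) \<and> (\<forall>J\<subseteq>E. card J \<le> \<mu> (x ` J))"
  proof (rule rado_transversal)
    show "\<mu> S \<le> \<mu> T" if "S \<subseteq> T" for S T
      unfolding \<mu>_def
      by (intro add_mono sum_mono sparse_rank_mono[OF finV] card_mono) (use that in auto)
    show "\<mu> (S \<union> T) + \<mu> (S \<inter> T) \<le> \<mu> S + \<mu> T" for S T
    proof -
      let ?F = "\<lambda>T i. {e. Inl (e, i) \<in> T}" and ?D = "\<lambda>T. {j. j < d \<and> Inr j \<in> T}"
      have F: "?F (S \<union> T) i = ?F S i \<union> ?F T i" "?F (S \<inter> T) i = ?F S i \<inter> ?F T i" for i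
        by auto
      have D: "?D (S \<union> T) = ?D S \<union> ?D T" "?D (S \<inter> T) = ?D S \<inter> ?D T" by auto
      have "(\<Sum>i<k. sparse_rank V (?F (S \<union> T) i)) + (\<Sum>i<k. sparse_rank V (?F (S \<inter> T) i))
        \<le> (\<Sum>i<k. sparse_rank V (?F S i)) + (\<Sum>i<k. sparse_rank V (?F T i))"
        unfolding sum.distrib[symmetric] F by (intro sum_mono sparse_rank_submodular finV)
      moreover have "card (?D (S \<union> T)) + card (?D (S \<inter> T)) = card (?D S) + card (?D T)"
        unfolding D by (rule card_Un_Int[symmetric]) auto
      ultimately show ?thesis unfolding \<mu>_def by linarith
    qed
    show "\<mu> {} = 0" by (simp add: \<mu>_def r0)
    show "finite E" by (rule finE)
    show "finite (A e)" for e by (simp add: A_def)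
    show "card J \<le> \<mu> (\<Union>e\<in>J. A e)" if "J \<subseteq> E" for J
    proof (cases "J = {}")
      case False
      have "{e. Inl (e, i) \<in> (\<Union>e\<in>J. A e)} = J" if "i < k" for i
        using that by (auto simp: A_def)
      moreover have "{j. j < d \<and> Inr j \<in> (\<Union>e\<in>J. A e)} = {..<d}"
        using False by (auto simp: A_def)
      ultimately have "\<mu> (\<Union>e\<in>J. A e) = k * sparse_rank V J + d"
        by (simp add: \<mu>_def)
      moreover have "card J + card (E - J) = card E"
        using that finE by (metis card_Diff_subset card_mono finite_subset le_add_diff_inverse)
      moreover have "k * m \<le> k * sparse_rank V J + card (E - J)"
        using rank[OF that] by (simp add: m_def)
      ultimately show ?thesis using km unfolding d_def by linarith
    qed simp
  qed
  \<comment> \<open>Only the case of all edges is kept: the free elements contribute at most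
    \<open>d\<close>, so the \<open>k\<close> copies together have rank at least
    \<open>k * m\<close>.\<close>
  then obtain x where xA: "\<And>e. e \<in> E \<Longrightarrow> x e \<in> A e" and x: "card E \<le> \<mu> (x ` E)" by blast
  define L where "L i = {e \<in> E. x e = Inl (e, i)}" for i
  have Leq: "{e. Inl (e, i) \<in> x ` E} = L i" if "i < k" for i
  proof -
    have "e' = e" if "e' \<in> E" "x e' = Inl (e, i)" for e e'
      using xA[OF that(1)] that(2) by (auto simp: A_def)
    then show ?thesis unfolding L_def image_iff by (intro Collect_cong) metis
  qed
  have le: "sparse_rank V (L i) \<le> m" for i
    using sparse_rank_le[OF V2, of "L i"] by (simp add: m_def)
  have "card E \<le> (\<Sum>i<k. sparse_rank V (L i)) + card {j. j < d \<and> Inr j \<in> x ` E}"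
    using x Leq by (simp add: \<mu>_def)
  also have "card {j. j < d \<and> Inr j \<in> x ` E} \<le> card {..<d}" by (rule card_mono) auto
  finally have tot: "k * m \<le> (\<Sum>i<k. sparse_rank V (L i))" using km unfolding d_def by simp
  have eq: "sparse_rank V (L i) = m" if i: "i < k" for i
  proof (rule ccontr)
    assume "sparse_rank V (L i) \<noteq> m"
    then have "(\<Sum>i<k. sparse_rank V (L i)) < (\<Sum>i<k. m)"
      using le i by (intro sum_strict_mono_ex1) (auto simp: order.strict_iff_order)
    with tot show False by simp
  qed
  have "\<exists>J. sparse_on V J \<and> J \<subseteq> L i \<and> card J = sparse_rank V (L i)" for i
    using sparse_rank_attained[OF finV, of "L i"] by metis
  then obtain J where J: "\<And>i. sparse_on V (J i)" "\<And>i. J i \<subseteq> L i"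
    "\<And>i. card (J i) = sparse_rank V (L i)" by metis
  have "disjoint_family_on J {..<k}"
  proof -
    have "L i \<inter> L j = {}" if "i \<noteq> j" for i j using that by (auto simp: L_def)
    then show ?thesis using J(2) by (meson disjoint_family_on_def disjoint_iff subsetD)
  qed
  moreover have "J i \<subseteq> E \<and> sparse_on V (J i) \<and> card (J i) + 3 = 2 * card V" if "i < k" for i
    using J[of i] eq[OF that] V2 by (auto simp: L_def m_def)
  ultimately show ?thesis by blast
qed

section \<open>Connectivity and the rank bound\<close>

definition edges_between :: "'a set set \<Rightarrow> 'a set \<Rightarrow> 'a set \<Rightarrow> 'a set set" where
  "edges_between E P W = {e \<in> E. e \<inter> P \<noteq> {} \<and> e \<inter> W \<noteq> {}}"

text \<open>The instances \<open>card B = 1, 2\<close> ask for \<open>4k\<close>- and \<open>2k\<close>-edge-connectivity after the deletion of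
  one or two vertices.\<close>

definition mixed_connected :: "nat \<Rightarrow> 'a set \<Rightarrow> 'a set set \<Rightarrow> bool" where
  "mixed_connected k V E \<longleftrightarrow>
     (\<forall>P B W. P \<union> B \<union> W = V \<and> P \<inter> B = {} \<and> P \<inter> W = {} \<and> B \<inter> W = {} \<and>
        P \<noteq> {} \<and> W \<noteq> {} \<and> card B \<le> 2 \<longrightarrow>
        6 * k \<le> 2 * k * card B + card (edges_between E P W))"

lemma mixed_connectedD:
  assumes "mixed_connected k V E" "P \<union> B \<union> W = V" "P \<inter> B = {}" "P \<inter> W = {}" "B \<inter> W = {}"
    "P \<noteq> {}" "W \<noteq> {}" "card B \<le> 2"
  shows "6 * k \<le> 2 * k * card B + card (edges_between E P W)"
  using assms unfolding mixed_connected_def by blast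

lemma sum_degree_in:
  assumes "simple_graph V E"
  shows "(\<Sum>v\<in>V. degree_in E v) = 2 * card E"
proof -
  have fin: "finite V" "finite E"
    using assms simple_graph_finite_edges by (auto simp: simple_graph_def)
  have "(\<Sum>v\<in>V. degree_in E v) = (\<Sum>v\<in>V. \<Sum>e\<in>E. if v \<in> e then 1 else 0)"
    unfolding degree_in_def by (simp add: fin sum.If_cases Int_def)
  also have "\<dots> = (\<Sum>e\<in>E. \<Sum>v\<in>V. if v \<in> e then 1 else 0)" by (rule sum.swap)
  also have "\<dots> = (\<Sum>e\<in>E. 2)"
  proof (rule sum.cong[OF refl])
    fix e assume "e \<in> E"
    then have e: "e \<subseteq> V" "card e = 2" using assms by (auto simp: simple_graph_def)
    then have "{v. v \<in> V \<and> v \<in> e} = e" by blast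
    then show "(\<Sum>v\<in>V. if v \<in> e then 1 else 0) = (2::nat)"
      using e by (simp add: fin sum.If_cases Int_def)
  qed
  finally show ?thesis by simp
qed

text \<open>Charging, after doubling: every vertex must receive 4, namely 4 from its cover set if it
  is private to one (\<open>pr X\<close>), 2 from each set if it is shared (\<open>bd X\<close>).
  The set \<open>X\<close> has only \<open>4 * card X - 6\<close> to give and so lacks
  \<open>6 - 2 * card (bd X)\<close>. Separating \<open>pr X\<close> by \<open>bd X\<close>, mixed
  connectivity supplies \<open>k\<close> times this many uncovered edges at \<open>pr X\<close>. A
  vertex in no cover set needs \<open>4 * k\<close> and has at least \<open>6 * k\<close> uncovered
  edges. Each uncovered edge is charged at most twice, once per end.\<close>

lemma cover_count:
  assumes G: "simple_graph V E" and V2: "2 \<le> card V" and conn: "mixed_connected k V E"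
    and finH: "finite H" and H: "\<And>X. X \<in> H \<Longrightarrow> X \<subseteq> V \<and> 3 \<le> card X"
  shows "k * (2 * card V - 3)
    \<le> k * (\<Sum>X\<in>H. 2 * card X - 3) + card {e \<in> E. \<forall>X\<in>H. \<not> e \<subseteq> X}"
proof (cases "V \<in> H")
  case True
  have "2 * card V - 3 \<le> (\<Sum>X\<in>H. 2 * card X - 3)"
    by (rule member_le_sum[OF True _ finH]) simp
  then have "k * (2 * card V - 3) \<le> k * (\<Sum>X\<in>H. 2 * card X - 3)" by (rule mult_le_mono2)
  then show ?thesis by linarith
next
  case False
  define E' where "E' = {e \<in> E. \<forall>X\<in>H. \<not> e \<subseteq> X}"
  define bd where "bd X = X \<inter> \<Union>(H - {X})" for X
  define pr where "pr X = X - \<Union>(H - {X})" for X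
  define U where "U = V - \<Union>H"
  define c :: "'a set \<Rightarrow> 'a \<Rightarrow> nat" where
    "c X v = (if v \<in> pr X then 4 else if v \<in> bd X then 2 else 0)" for X v
  have finV: "finite V" using G by (simp add: simple_graph_def)
  have E': "simple_graph V E'" by (rule simple_graph_mono[OF G]) (auto simp: E'_def)
  have finE': "finite E'" by (rule simple_graph_finite_edges[OF E'])
  have finX: "finite X" if "X \<in> H" for X using H[OF that] finV finite_subset by blast
  have split: "pr X \<union> bd X = X" "pr X \<inter> bd X = {}" for X by (auto simp: pr_def bd_def)
  have cardX: "card X = card (pr X) + card (bd X)" if "X \<in> H" for X
    using card_Un_disjoint[of "pr X" "bd X"] split finX[OF that]
    by (metis finite_Un)
  have cut_le: "card (edges_between E P W) \<le> (\<Sum>v\<in>P. degree_in E' v)"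
    if "finite P" and "edges_between E P W \<subseteq> E'" for P W
  proof -
    have "edges_between E P W \<subseteq> (\<Union>v\<in>P. {e \<in> E'. v \<in> e})"
      using that(2) by (auto simp: edges_between_def)
    then have "card (edges_between E P W) \<le> card (\<Union>v\<in>P. {e \<in> E'. v \<in> e})"
      by (intro card_mono) (use that(1) finE' in auto)
    also have "\<dots> \<le> (\<Sum>v\<in>P. card {e \<in> E'. v \<in> e})" by (rule card_UN_le[OF that(1)])
    finally show ?thesis by (simp add: degree_in_def)
  qed
  have pr_deg: "6 * k \<le> 2 * k * card (bd X) + (\<Sum>v\<in>pr X. degree_in E' v)"
    if X: "X \<in> H" and ne: "pr X \<noteq> {}" for X
  proof (cases "card (bd X) \<le> 2")
    case True
    have "V - X \<noteq> {}" using H[OF X] False X by (metis Diff_eq_empty_iff subset_antisym)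
    then have "6 * k \<le> 2 * k * card (bd X) + card (edges_between E (pr X) (V - X))"
    proof (intro mixed_connectedD[OF conn])
      show "pr X \<union> bd X \<union> (V - X) = V" using split H[OF X] by blast
      show "pr X \<inter> bd X = {}" "pr X \<inter> (V - X) = {}" "bd X \<inter> (V - X) = {}"
        by (auto simp: pr_def bd_def)
    qed (use ne True in auto)
    \<comment> \<open>No other cover set meets \<open>pr X\<close>, so an edge leaving
      \<open>X\<close> from there lies in no cover set.\<close>
    moreover have "edges_between E (pr X) (V - X) \<subseteq> E'"
    proof
      fix e assume e: "e \<in> edges_between E (pr X) (V - X)"
      then obtain v where v: "v \<in> e" "v \<in> pr X" by (auto simp: edges_between_def)
      have "\<not> e \<subseteq> Y" if "Y \<in> H" for Y
      proof (cases "Y = X")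
        case True
        then show ?thesis using e by (auto simp: edges_between_def)
      next
        case False
        then show ?thesis using v that by (auto simp: pr_def)
      qed
      then show "e \<in> E'" using e by (auto simp: E'_def edges_between_def)
    qed
    moreover have "finite (pr X)" using finX[OF X] by (simp add: pr_def)
    ultimately show ?thesis using cut_le[of "pr X" "V - X"] by linarith
  next
    case False
    then have "6 * k \<le> 2 * k * card (bd X)" by simp
    then show ?thesis by linarith
  qed
  have U_deg: "6 * k \<le> degree_in E' v" if v: "v \<in> U" for v
  proof -
    have "V \<noteq> {v}" using V2 by auto
    then have "6 * k \<le> 2 * k * card ({} :: 'a set) + card (edges_between E {v} (V - {v}))"
      using v by (intro mixed_connectedD[OF conn]) (auto simp: U_def)
    also have "\<dots> = card (edges_between E {v} (V - {v}))" by simp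
    also have "\<dots> \<le> (\<Sum>u\<in>{v}. degree_in E' u)"
      by (rule cut_le) (use v in \<open>auto simp: E'_def U_def edges_between_def\<close>)
    finally show ?thesis by simp
  qed
  have "(\<Sum>X\<in>H. \<Sum>v\<in>pr X. degree_in E' v) + (\<Sum>v\<in>U. degree_in E' v)
      = (\<Sum>v\<in>(\<Union>X\<in>H. pr X). degree_in E' v) + (\<Sum>v\<in>U. degree_in E' v)"
  proof -
    have "(\<Sum>v\<in>(\<Union>X\<in>H. pr X). degree_in E' v) = (\<Sum>X\<in>H. \<Sum>v\<in>pr X. degree_in E' v)"
    proof (rule sum.UNION_disjoint[OF finH])
      show "\<forall>X\<in>H. finite (pr X)" using finX by (simp add: pr_def)
      show "\<forall>X\<in>H. \<forall>Y\<in>H. X \<noteq> Y \<longrightarrow> pr X \<inter> pr Y = {}" by (auto simp: pr_def)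
    qed
    then show ?thesis by simp
  qed
  also have "\<dots> = (\<Sum>v\<in>(\<Union>X\<in>H. pr X) \<union> U. degree_in E' v)"
    by (rule sum.union_disjoint[symmetric]) (use finH finX finV in \<open>auto simp: pr_def U_def\<close>)
  also have "\<dots> \<le> (\<Sum>v\<in>V. degree_in E' v)"
    by (rule sum_mono2[OF finV]) (use H in \<open>auto simp: pr_def U_def\<close>)
  also have "\<dots> = 2 * card E'" by (rule sum_degree_in[OF E'])
  finally have deg_sum:
    "(\<Sum>X\<in>H. \<Sum>v\<in>pr X. degree_in E' v) + (\<Sum>v\<in>U. degree_in E' v) \<le> 2 * card E'" .
  have perX: "k * (\<Sum>v\<in>V. c X v) \<le> 2 * (k * (2 * card X - 3)) + (\<Sum>v\<in>pr X. degree_in E' v)"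
    if X: "X \<in> H" for X
  proof -
    have "(\<Sum>v\<in>V. c X v) = (\<Sum>v\<in>X. c X v)"
      by (rule sum.mono_neutral_right[OF finV]) (use H[OF X] in \<open>auto simp: c_def pr_def bd_def\<close>)
    also have "\<dots> = (\<Sum>v\<in>pr X \<union> bd X. c X v)" using split by simp
    also have "\<dots> = (\<Sum>v\<in>pr X. c X v) + (\<Sum>v\<in>bd X. c X v)"
      using finX[OF X] split by (intro sum.union_disjoint) (auto simp: pr_def bd_def)
    also have "(\<Sum>v\<in>pr X. c X v) = 4 * card (pr X)" by (simp add: c_def)
    also have "(\<Sum>v\<in>bd X. c X v) = (\<Sum>v\<in>bd X. 2)"
      by (rule sum.cong) (auto simp: c_def pr_def bd_def)
    finally have c: "(\<Sum>v\<in>V. c X v) = 4 * card (pr X) + 2 * card (bd X)" by simp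
    have "3 \<le> card X" using H[OF X] by simp
    then have e: "2 * (2 * card X - 3) + 6 = 4 * card (pr X) + 4 * card (bd X)"
      using cardX[OF X] by linarith
    then have ek: "2 * (k * (2 * card X - 3)) + 6 * k = k * (4 * card (pr X)) + 2 * (k * (2 * card (bd X)))"
      by (metis (no_types, lifting) add_mult_distrib2 mult.assoc mult.commute mult.left_commute numeral_Bit0 mult_2)
    show ?thesis
    proof (cases "pr X = {}")
      case True
      \<comment> \<open>Without private vertices there is no cut to use; instead three shared
        vertices already save \<open>2 * 3 = 6\<close>. This is where cover sets of size at least 3
        matter.\<close>
      then have "3 \<le> card (bd X)" using cardX[OF X] \<open>3 \<le> card X\<close> by simp
      then have "6 * k \<le> k * (2 * card (bd X))" by simp
      then have "k * (2 * card (bd X)) \<le> 2 * (k * (2 * card X - 3))"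
        using ek True by linarith
      then show ?thesis using c True by simp
    next
      case False
      from pr_deg[OF X this] ek show ?thesis unfolding c by (simp add: algebra_simps)
    qed
  qed
  have "4 * card V = (\<Sum>v\<in>V. 4)" by simp
  also have "\<dots> \<le> (\<Sum>v\<in>V. (\<Sum>X\<in>H. c X v) + (if v \<in> U then 4 else 0))"
  proof (rule sum_mono)
    fix v assume v: "v \<in> V"
    show "4 \<le> (\<Sum>X\<in>H. c X v) + (if v \<in> U then 4 else 0)"
    proof (cases "v \<in> U")
      case False
      then obtain X where X: "X \<in> H" "v \<in> X" using v by (auto simp: U_def)
      show ?thesis
      proof (cases "v \<in> pr X")
        case True
        have "c X v \<le> (\<Sum>X\<in>H. c X v)" by (rule member_le_sum[OF X(1) _ finH]) simp
        then show ?thesis using True by (simp add: c_def)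
      next
        case False
        then obtain Y where Y: "Y \<in> H" "v \<in> Y" "Y \<noteq> X" using X by (auto simp: pr_def)
        have ge: "2 \<le> c Z v" if "Z = X \<or> Z = Y" for Z
          using that X Y by (auto simp: c_def bd_def pr_def)
        have "(\<Sum>Z\<in>{X, Y}. c Z v) \<le> (\<Sum>Z\<in>H. c Z v)"
          by (rule sum_mono2[OF finH]) (use X Y in auto)
        moreover have "(\<Sum>Z\<in>{X, Y}. c Z v) = c X v + c Y v" using Y(3) by simp
        ultimately show ?thesis using ge[of X] ge[of Y] by simp
      qed
    qed simp
  qed
  also have "\<dots> = (\<Sum>X\<in>H. \<Sum>v\<in>V. c X v) + 4 * card U"
  proof -
    have "V \<inter> {v. v \<in> U} = U" by (auto simp: U_def)
    then have "(\<Sum>v\<in>V. if v \<in> U then 4 else 0) = 4 * card U"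
      by (simp add: finV sum.If_cases)
    then show ?thesis by (simp add: sum.distrib sum.swap[of _ V])
  qed
  finally have 1: "k * (4 * card V) \<le> k * (\<Sum>X\<in>H. \<Sum>v\<in>V. c X v) + k * (4 * card U)"
    by (metis add_mult_distrib2 mult_le_mono2)
  have "k * (\<Sum>X\<in>H. \<Sum>v\<in>V. c X v) = (\<Sum>X\<in>H. k * (\<Sum>v\<in>V. c X v))"
    by (rule sum_distrib_left)
  also have "\<dots> \<le> (\<Sum>X\<in>H. 2 * (k * (2 * card X - 3)) + (\<Sum>v\<in>pr X. degree_in E' v))"
    by (rule sum_mono[OF perX])
  also have "\<dots> = 2 * (k * (\<Sum>X\<in>H. 2 * card X - 3)) + (\<Sum>X\<in>H. \<Sum>v\<in>pr X. degree_in E' v)"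
    by (simp add: sum.distrib sum_distrib_left)
  finally have 2: "k * (\<Sum>X\<in>H. \<Sum>v\<in>V. c X v)
    \<le> 2 * (k * (\<Sum>X\<in>H. 2 * card X - 3)) + (\<Sum>X\<in>H. \<Sum>v\<in>pr X. degree_in E' v)" .
  have "k * (4 * card U) \<le> (\<Sum>v\<in>U. 6 * k)" by simp
  also have "\<dots> \<le> (\<Sum>v\<in>U. degree_in E' v)" by (rule sum_mono[OF U_deg])
  finally have 3: "k * (4 * card U) \<le> (\<Sum>v\<in>U. degree_in E' v)" .
  have "k * (4 * card V) \<le> 2 * (k * (\<Sum>X\<in>H. 2 * card X - 3))
    + ((\<Sum>X\<in>H. \<Sum>v\<in>pr X. degree_in E' v) + (\<Sum>v\<in>U. degree_in E' v))"
    by (rule order_trans[OF 1 order_trans[OF add_mono[OF 2 3]]]) (simp only: add.assoc order_refl)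
  also have "\<dots> \<le> 2 * (k * (\<Sum>X\<in>H. 2 * card X - 3)) + 2 * card E'"
    by (rule add_left_mono[OF deg_sum])
  finally have "k * (4 * card V) \<le> 2 * (k * (\<Sum>X\<in>H. 2 * card X - 3)) + 2 * card E'" .
  moreover have "2 * (k * (2 * card V - 3)) \<le> k * (4 * card V)"
  proof -
    have "2 * (2 * card V - 3) \<le> 4 * card V" by simp
    then have "k * (2 * (2 * card V - 3)) \<le> k * (4 * card V)" by (rule mult_le_mono2)
    then show ?thesis by (simp only: mult.left_commute)
  qed
  ultimately show ?thesis unfolding E'_def by linarith
qed

text \<open>Two-element cover sets cost \<open>k\<close> but cover a single edge, so they may be dropped at the
  price of one uncovered edge each; all remaining sets have at least three vertices.\<close>

lemma mixed_connected_rank: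
  assumes G: "simple_graph V E" and V2: "2 \<le> card V" and conn: "mixed_connected k V E"
    and k: "1 \<le> k" and F: "F \<subseteq> E"
  shows "k * (2 * card V - 3) \<le> k * sparse_rank V F + card (E - F)"
proof -
  obtain H where finH: "finite H" and HV: "\<And>X. X \<in> H \<Longrightarrow> X \<subseteq> V \<and> 2 \<le> card X"
    and r: "sparse_rank V F = (\<Sum>X\<in>H. 2 * card X - 3)"
    and cov: "\<And>e. e \<in> F \<Longrightarrow> \<exists>X\<in>H. e \<subseteq> X"
    using sparse_rank_cover[OF simple_graph_mono[OF G F]] by metis
  have finE: "finite E" by (rule simple_graph_finite_edges[OF G])
  have finV: "finite V" using G by (simp add: simple_graph_def)
  define H2 where "H2 = {X \<in> H. card X = 2}"
  define H3 where "H3 = {X \<in> H. 3 \<le> card X}"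
  have HU: "H = H2 \<union> H3" "H2 \<inter> H3 = {}" using HV by (fastforce simp: H2_def H3_def)+
  have fin: "finite H2" "finite H3" using finH by (auto simp: H2_def H3_def)
  have "sparse_rank V F = (\<Sum>X\<in>H2. 2 * card X - 3) + (\<Sum>X\<in>H3. 2 * card X - 3)"
    unfolding r HU(1) by (rule sum.union_disjoint[OF fin HU(2)])
  also have "(\<Sum>X\<in>H2. 2 * card X - 3) = card H2" by (simp add: H2_def)
  finally have r': "sparse_rank V F = card H2 + (\<Sum>X\<in>H3. 2 * card X - 3)" .
  have "{e \<in> E. \<forall>X\<in>H3. \<not> e \<subseteq> X} \<subseteq> (E - F) \<union> H2"
  proof
    fix e assume e: "e \<in> {e \<in> E. \<forall>X\<in>H3. \<not> e \<subseteq> X}"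
    show "e \<in> (E - F) \<union> H2"
    proof (cases "e \<in> F")
      case True
      then obtain X where X: "X \<in> H" "e \<subseteq> X" using cov by blast
      then have "X \<notin> H3" using e by blast
      then have "X \<in> H2" using X(1) HU(1) by blast
      then have "card X = 2" by (simp add: H2_def)
      moreover have "card e = 2" using e G by (simp add: simple_graph_def)
      moreover have "finite X" using HV[OF X(1)] finV by (auto intro: finite_subset)
      ultimately have "e = X" using X(2) by (metis card_subset_eq)
      then show ?thesis using X(1) \<open>card X = 2\<close> by (simp add: H2_def)
    qed (use e in blast)
  qed
  then have "card {e \<in> E. \<forall>X\<in>H3. \<not> e \<subseteq> X} \<le> card ((E - F) \<union> H2)"
    by (intro card_mono) (use finE fin in auto)
  also have "\<dots> \<le> card (E - F) + card H2" by (rule card_Un_le)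
  finally have "card {e \<in> E. \<forall>X\<in>H3. \<not> e \<subseteq> X} \<le> card (E - F) + k * card H2"
    using mult_le_mono1[OF k, of "card H2"] by linarith
  moreover have "k * (2 * card V - 3)
      \<le> k * (\<Sum>X\<in>H3. 2 * card X - 3) + card {e \<in> E. \<forall>X\<in>H3. \<not> e \<subseteq> X}"
    by (rule cover_count[OF G V2 conn fin(2)]) (use HV in \<open>auto simp: H3_def\<close>)
  ultimately show ?thesis unfolding r' by (simp add: algebra_simps)
qed

section \<open>Avoiding zeros of polynomials\<close>

text \<open>Being a polynomial in each coordinate separately is all that the avoidance argument below
  needs of a polynomial function, and it spares a formal treatment of multivariate polynomials.\<close>

definition separately_poly :: "'i set \<Rightarrow> (('i \<Rightarrow> real) \<Rightarrow> real) \<Rightarrow> bool" where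
  "separately_poly I f \<longleftrightarrow> (\<forall>x y. (\<forall>i\<in>I. x i = y i) \<longrightarrow> f x = f y) \<and>
     (\<forall>x i. \<exists>q :: real poly. \<forall>t. f (x(i := t)) = poly q t)"

lemma separately_poly_const: "separately_poly I (\<lambda>x. c)"
  unfolding separately_poly_def by (auto intro: exI[of _ "[:c:]"])

lemma separately_poly_coord:
  assumes "i \<in> I"
  shows "separately_poly I (\<lambda>x. x i)"
proof -
  have "\<exists>q. \<forall>t. (x(j := t)) i = poly q t" for x :: "'a \<Rightarrow> real" and j
    by (cases "i = j") (auto intro: exI[of _ "[:0, 1:]"] exI[of _ "[:x i:]"])
  then show ?thesis using assms unfolding separately_poly_def by blast
qed

lemma separately_poly_add:
  assumes "separately_poly I f" "separately_poly I g"
  shows "separately_poly I (\<lambda>x. f x + g x)"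
proof -
  have "\<exists>q. \<forall>t. f (x(i := t)) + g (x(i := t)) = poly q t" for x i
  proof -
    obtain q1 q2 where "\<forall>t. f (x(i := t)) = poly q1 t" "\<forall>t. g (x(i := t)) = poly q2 t"
      using assms unfolding separately_poly_def by meson
    then show ?thesis by (intro exI[of _ "q1 + q2"]) simp
  qed
  moreover have "f x + g x = f y + g y" if "\<forall>i\<in>I. x i = y i" for x y
    using assms that unfolding separately_poly_def by metis
  ultimately show ?thesis unfolding separately_poly_def by blast
qed

lemma separately_poly_mult:
  assumes "separately_poly I f" "separately_poly I g"
  shows "separately_poly I (\<lambda>x. f x * g x)"
proof -
  have "\<exists>q. \<forall>t. f (x(i := t)) * g (x(i := t)) = poly q t" for x i
  proof -
    obtain q1 q2 where "\<forall>t. f (x(i := t)) = poly q1 t" "\<forall>t. g (x(i := t)) = poly q2 t"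
      using assms unfolding separately_poly_def by meson
    then show ?thesis by (intro exI[of _ "q1 * q2"]) simp
  qed
  moreover have "f x * g x = f y * g y" if "\<forall>i\<in>I. x i = y i" for x y
    using assms that unfolding separately_poly_def by metis
  ultimately show ?thesis unfolding separately_poly_def by blast
qed

lemma separately_poly_diff:
  assumes "separately_poly I f" "separately_poly I g"
  shows "separately_poly I (\<lambda>x. f x - g x)"
  using separately_poly_add[OF assms(1) separately_poly_mult[OF separately_poly_const[of I "-1"] assms(2)]]
  by simp

lemma separately_poly_sum:
  "(\<And>a. a \<in> A \<Longrightarrow> separately_poly I (f a)) \<Longrightarrow> separately_poly I (\<lambda>x. \<Sum>a\<in>A. f a x)"
  by (induction A rule: infinite_finite_induct)
    (auto intro: separately_poly_add separately_poly_const)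

lemma separately_poly_prod:
  "(\<And>a. a \<in> A \<Longrightarrow> separately_poly I (f a)) \<Longrightarrow> separately_poly I (\<lambda>x. \<Prod>a\<in>A. f a x)"
  by (induction A rule: infinite_finite_induct)
    (auto intro: separately_poly_mult separately_poly_const)

lemma separately_poly_power: "separately_poly I f \<Longrightarrow> separately_poly I (\<lambda>x. f x ^ n)"
  by (induction n) (auto intro: separately_poly_mult separately_poly_const)

text \<open>Countably many nonzero polynomials in one real variable have only countably many roots
  altogether, so some real number avoids them all. Induction on the coordinates reduces to this
  case.\<close>

lemma separately_poly_common_nonzero:
  fixes \<F> :: "(('i \<Rightarrow> real) \<Rightarrow> real) set"
  assumes "finite I" "countable \<F>" "\<And>f. f \<in> \<F> \<Longrightarrow> separately_poly I f \<and> (\<exists>x. f x \<noteq> 0)"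
  shows "\<exists>x. \<forall>f\<in>\<F>. f x \<noteq> 0"
  using assms
proof (induction I arbitrary: \<F> rule: finite_induct)
  case empty
  then have "\<forall>f\<in>\<F>. f (\<lambda>_. 0) \<noteq> 0" unfolding separately_poly_def by (metis empty_iff)
  then show ?case by blast
next
  case (insert i I)
  then obtain z where z: "\<And>f. f \<in> \<F> \<Longrightarrow> f (z f) \<noteq> 0" by metis
  have fsp: "separately_poly (insert i I) f" if "f \<in> \<F>" for f using insert.prems(2) that by blast
  \<comment> \<open>Coordinate \<open>i\<close> is frozen at a value that may depend on
    \<open>f\<close>. The induction hypothesis fixes the other coordinates, and only then is a
    common value for \<open>i\<close> chosen.\<close>
  define g where "g f = (\<lambda>y. f (y(i := z f i)))" for f
  have "separately_poly I (g f) \<and> (\<exists>x. g f x \<noteq> 0)" if f: "f \<in> \<F>" for f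
  proof
    have "\<exists>q. \<forall>t. g f (x(j := t)) = poly q t" for x j
    proof (cases "j = i")
      case True
      then show ?thesis by (auto simp: g_def intro: exI[of _ "[:f (x(i := z f i)):]"])
    next
      case False
      then have "(x(j := t))(i := z f i) = (x(i := z f i))(j := t)" for t by auto
      then show ?thesis
        using fsp[OF f] unfolding g_def separately_poly_def by metis
    qed
    moreover have "g f x = g f y" if "\<forall>j\<in>I. x j = y j" for x y
    proof -
      have "\<forall>j\<in>insert i I. (x(i := z f i)) j = (y(i := z f i)) j" using that by auto
      then show ?thesis using fsp[OF f] unfolding g_def separately_poly_def by blast
    qed
    ultimately show "separately_poly I (g f)" unfolding separately_poly_def by blast
    show "\<exists>x. g f x \<noteq> 0" using z[OF f] by (intro exI[of _ "z f"]) (simp add: g_def)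
  qed
  then have "\<exists>y. \<forall>h\<in>g ` \<F>. h y \<noteq> 0"
    by (intro insert.IH) (use insert.prems(1) in auto)
  then obtain y where y: "\<And>f. f \<in> \<F> \<Longrightarrow> f (y(i := z f i)) \<noteq> 0" by (auto simp: g_def)
  have "countable (\<Union>f\<in>\<F>. {t. f (y(i := t)) = 0})"
  proof (rule countable_UN[OF insert.prems(1)])
    fix f assume f: "f \<in> \<F>"
    obtain q :: "real poly" where q: "\<forall>t. f (y(i := t)) = poly q t"
      using fsp[OF f] unfolding separately_poly_def by meson
    then have "q \<noteq> 0" using y[OF f] by auto
    from poly_roots_finite[OF this] show "countable {t. f (y(i := t)) = 0}"
      using q by (simp add: countable_finite)
  qed
  then have "(\<Union>f\<in>\<F>. {t. f (y(i := t)) = 0}) \<noteq> UNIV" using uncountable_UNIV_real by metis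
  then obtain t where "\<And>f. f \<in> \<F> \<Longrightarrow> f (y(i := t)) \<noteq> 0" by blast
  then show ?case by blast
qed

section \<open>Rational polynomials and generic points\<close>

lemma separately_poly_eval_rat_mpoly:
  assumes "\<forall>m\<in>Poly_Mapping.keys P. Poly_Mapping.keys m \<subseteq> I"
  shows "separately_poly I (eval_rat_mpoly P)"
proof -
  have "separately_poly I (\<lambda>x. \<Sum>m\<in>Poly_Mapping.keys P. of_rat (Poly_Mapping.lookup P m) *
        (\<Prod>i\<in>Poly_Mapping.keys m. x i ^ Poly_Mapping.lookup m i))"
    using assms by (intro separately_poly_sum separately_poly_mult separately_poly_const
        separately_poly_prod separately_poly_power separately_poly_coord) blast
  then show ?thesis unfolding eval_rat_mpoly_def .
qed

text \<open>At \<open>x i = p i ^ s\<close> with distinct primes \<open>p i\<close>, the monomials take the values \<open>M m ^ s\<close> for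
  pairwise distinct numbers \<open>M m\<close>; vanishing for all \<open>s\<close> would annihilate every polynomial in
  \<open>M m\<close>, including one that singles out a given monomial.\<close>

lemma eval_rat_mpoly_nonzero:
  fixes P :: "('i \<Rightarrow>\<^sub>0 nat) \<Rightarrow>\<^sub>0 rat"
  assumes "finite I" "P \<noteq> 0" "\<forall>m\<in>Poly_Mapping.keys P. Poly_Mapping.keys m \<subseteq> I"
  shows "\<exists>x. eval_rat_mpoly P x \<noteq> 0"
proof (rule ccontr)
  assume "\<not> ?thesis"
  then have zero: "eval_rat_mpoly P x = 0" for x by blast
  obtain B :: "nat set" where B: "finite B" "card B = card I" "B \<subseteq> {p. prime p}"
    using infinite_arbitrarily_large[OF primes_infinite] by metis
  then obtain p where p: "bij_betw p I B" using assms(1) finite_same_card_bij by metis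
  have prime: "prime (p i)" if "i \<in> I" for i using bij_betwE[OF p] B that by blast
  have inj: "inj_on p I" using p by (simp add: bij_betw_def)
  define M where "M m = (\<Prod>i\<in>Poly_Mapping.keys m. p i ^ Poly_Mapping.lookup m i)" for m
  have mult: "multiplicity (p j) (M m) = Poly_Mapping.lookup m j"
    if m: "m \<in> Poly_Mapping.keys P" and j: "j \<in> I" for m j
  proof -
    have sub: "Poly_Mapping.keys m \<subseteq> I" using assms(3) m by blast
    then have inj': "inj_on p (Poly_Mapping.keys m)" using inj inj_on_subset by blast
    define f where "f q = Poly_Mapping.lookup m (inv_into I p q)" for q
    have f: "f (p i) = Poly_Mapping.lookup m i" if "i \<in> I" for i
      using inv_into_f_f[OF inj that] by (simp add: f_def)
    have "M m = (\<Prod>q\<in>p ` Poly_Mapping.keys m. q ^ f q)"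
      unfolding M_def prod.reindex[OF inj'] using f sub by (intro prod.cong) auto
    moreover have "prime q" if "q \<in> p ` Poly_Mapping.keys m" for q using that prime sub by blast
    ultimately have
      "multiplicity (p j) (M m) = (if p j \<in> p ` Poly_Mapping.keys m then f (p j) else 0)"
      using multiplicity_prod_prime_powers[OF _ _ prime[OF j], of "p ` Poly_Mapping.keys m" f] by simp
    also have "\<dots> = Poly_Mapping.lookup m j"
      using inj sub j f[OF j] by (auto simp: inj_on_image_mem_iff in_keys_iff)
    finally show ?thesis .
  qed
  have injM: "inj_on M (Poly_Mapping.keys P)"
  proof (rule inj_onI)
    fix m m' assume mm: "m \<in> Poly_Mapping.keys P" "m' \<in> Poly_Mapping.keys P" "M m = M m'"
    show "m = m'"
    proof (rule poly_mapping_eqI)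
      fix i
      show "Poly_Mapping.lookup m i = Poly_Mapping.lookup m' i"
      proof (cases "i \<in> I")
        case True
        then show ?thesis using mult mm by metis
      next
        case False
        then have "i \<notin> Poly_Mapping.keys m" "i \<notin> Poly_Mapping.keys m'" using assms(3) mm by blast+
        then show ?thesis by (simp add: in_keys_iff)
      qed
    qed
  qed
  let ?c = "\<lambda>m. of_rat (Poly_Mapping.lookup P m) :: real"
  have power: "(\<Sum>m\<in>Poly_Mapping.keys P. ?c m * real (M m) ^ s) = 0" for s
  proof -
    have "(\<Prod>i\<in>Poly_Mapping.keys m. (real (p i) ^ s) ^ Poly_Mapping.lookup m i) = real (M m) ^ s" for m
      by (simp add: M_def prod_power_distrib power_mult[symmetric] mult.commute)
    then show ?thesis using zero[of "\<lambda>i. real (p i) ^ s"] by (simp add: eval_rat_mpoly_def)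
  qed
  have all: "(\<Sum>m\<in>Poly_Mapping.keys P. ?c m * poly q (real (M m))) = 0" for q :: "real poly"
  proof -
    have "(\<Sum>m\<in>Poly_Mapping.keys P. ?c m * poly q (real (M m)))
      = (\<Sum>m\<in>Poly_Mapping.keys P. \<Sum>s\<le>degree q. coeff q s * (?c m * real (M m) ^ s))"
      by (simp add: poly_altdef sum_distrib_left algebra_simps)
    also have "\<dots> = (\<Sum>s\<le>degree q. \<Sum>m\<in>Poly_Mapping.keys P. coeff q s * (?c m * real (M m) ^ s))"
      by (rule sum.swap)
    also have "\<dots> = 0" by (simp add: sum_distrib_left[symmetric] power)
    finally show ?thesis .
  qed
  obtain m0 where m0: "m0 \<in> Poly_Mapping.keys P" using assms(2) by (metis all_not_in_conv keys_eq_empty)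
  define q where "q = (\<Prod>m\<in>Poly_Mapping.keys P - {m0}. [:- real (M m), 1:])"
  have q: "poly q (real (M m)) = 0 \<longleftrightarrow> m \<noteq> m0" if "m \<in> Poly_Mapping.keys P" for m
    using that m0 inj_onD[OF injM] by (auto simp: q_def poly_prod)
  have "(\<Sum>m\<in>Poly_Mapping.keys P. ?c m * poly q (real (M m))) = ?c m0 * poly q (real (M m0))"
  proof -
    have "(\<Sum>m\<in>Poly_Mapping.keys P. ?c m * poly q (real (M m)))
      = (\<Sum>m\<in>{m0}. ?c m * poly q (real (M m)))"
      by (rule sum.mono_neutral_right) (use m0 q in auto)
    then show ?thesis by simp
  qed
  then show False using all[of q] q[OF m0] m0 by (simp add: in_keys_iff)
qed

text \<open>A finitely supported map is determined by its graph over its support, a finite subset of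
  a countable set.\<close>

lemma countable_poly_mapping:
  fixes A :: "'k set"
  assumes "countable A"
  shows "countable {f :: 'k \<Rightarrow>\<^sub>0 'v :: {zero, countable}. Poly_Mapping.keys f \<subseteq> A}"
proof -
  let ?g = "\<lambda>f :: 'k \<Rightarrow>\<^sub>0 'v. (\<lambda>x. (x, Poly_Mapping.lookup f x)) ` Poly_Mapping.keys f"
  have "countable {S. S \<subseteq> A \<times> (UNIV :: 'v set) \<and> finite S}"
    using countable_Collect_finite_subset[of "A \<times> (UNIV :: 'v set)"] assms
    by (simp add: conj_commute)
  then have "countable (?g ` {f. Poly_Mapping.keys f \<subseteq> A})"
    by (rule countable_subset[rotated]) auto
  moreover have "inj ?g"
  proof (rule injI)
    fix f h :: "'k \<Rightarrow>\<^sub>0 'v" assume eq: "?g f = ?g h"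
    have "Poly_Mapping.keys f = fst ` ?g f" "Poly_Mapping.keys h = fst ` ?g h"
      by (simp_all add: image_image)
    then have k: "Poly_Mapping.keys f = Poly_Mapping.keys h" using eq by simp
    show "f = h"
    proof (rule poly_mapping_eqI)
      fix x
      show "Poly_Mapping.lookup f x = Poly_Mapping.lookup h x"
      proof (cases "x \<in> Poly_Mapping.keys f")
        case True
        then have "(x, Poly_Mapping.lookup f x) \<in> ?g h" using eq by blast
        then show ?thesis by auto
      next
        case False
        then have "x \<notin> Poly_Mapping.keys h" using k by simp
        with False show ?thesis unfolding in_keys_iff by simp
      qed
    qed
  qed
  ultimately show ?thesis using countable_image_inj_on inj_on_subset by blast
qed

text \<open>Algebraic independence over the rationals is the nonvanishing of countably many nonzero
  polynomials, so one more polynomial condition \<open>g\<close> can be imposed along with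
  them.\<close>

lemma alg_independent_avoiding:
  assumes "finite I" "separately_poly I g" "g x0 \<noteq> 0"
  shows "\<exists>x. alg_independent_rat I x \<and> g x \<noteq> 0"
proof -
  let ?M = "{m :: 'a \<Rightarrow>\<^sub>0 nat. Poly_Mapping.keys m \<subseteq> I}"
  let ?P = "{P :: ('a \<Rightarrow>\<^sub>0 nat) \<Rightarrow>\<^sub>0 rat. P \<noteq> 0 \<and> Poly_Mapping.keys P \<subseteq> ?M}"
  have "countable {P :: ('a \<Rightarrow>\<^sub>0 nat) \<Rightarrow>\<^sub>0 rat. Poly_Mapping.keys P \<subseteq> ?M}"
    by (intro countable_poly_mapping countable_finite assms(1))
  then have "countable ?P" by (rule countable_subset[rotated]) auto
  then have "countable (insert g (eval_rat_mpoly ` ?P))" by simp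
  then have "\<exists>x. \<forall>f\<in>insert g (eval_rat_mpoly ` ?P). f x \<noteq> 0"
  proof (rule separately_poly_common_nonzero[OF assms(1)])
    fix f assume "f \<in> insert g (eval_rat_mpoly ` ?P)"
    then consider "f = g" | P where "P \<in> ?P" "f = eval_rat_mpoly P" by blast
    then show "separately_poly I f \<and> (\<exists>x. f x \<noteq> 0)"
    proof cases
      case 1
      then show ?thesis using assms(2,3) by blast
    next
      case 2
      then have "P \<noteq> 0" "\<forall>m\<in>Poly_Mapping.keys P. Poly_Mapping.keys m \<subseteq> I" by auto
      with 2 show ?thesis
        using separately_poly_eval_rat_mpoly eval_rat_mpoly_nonzero[OF assms(1)] by metis
    qed
  qed
  then obtain x where x: "\<forall>f\<in>insert g (eval_rat_mpoly ` ?P). f x \<noteq> 0" by blast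
  then have "alg_independent_rat I x" unfolding alg_independent_rat_def by auto
  with x show ?thesis by blast
qed

section \<open>Rigidity rows and their Gram determinant\<close>

text \<open>The row of \<open>e\<close> in the rigidity matrix: \<open>p u - p v\<close> at
  \<open>u\<close> and its negative at \<open>v\<close>. Summing over all of \<open>e\<close> avoids
  ordering the two ends, since the term with \<open>u = w\<close> vanishes.\<close>

definition rigidity_row :: "('a \<Rightarrow> real ^ 2) \<Rightarrow> 'a set \<Rightarrow> 'a \<Rightarrow> real ^ 2" where
  "rigidity_row p e w = (if w \<in> e then \<Sum>u\<in>e. p w - p u else 0)"

text \<open>Absence of a nonzero self-stress: \<omega> assigns a stress to each edge, and the
  premise is equilibrium at every vertex.\<close>

definition independent_rows :: "'a set \<Rightarrow> ('a \<Rightarrow> real ^ 2) \<Rightarrow> 'a set set \<Rightarrow> bool" where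
  "independent_rows V p I \<longleftrightarrow>
     (\<forall>\<omega>. (\<forall>w\<in>V. (\<Sum>e\<in>I. \<omega> e *\<^sub>R rigidity_row p e w) = 0) \<longrightarrow> (\<forall>e\<in>I. \<omega> e = 0))"

lemma independent_rowsD:
  "independent_rows V p I \<Longrightarrow> (\<And>w. w \<in> V \<Longrightarrow> (\<Sum>e\<in>I. \<omega> e *\<^sub>R rigidity_row p e w) = 0) \<Longrightarrow>
    e \<in> I \<Longrightarrow> \<omega> e = 0"
  unfolding independent_rows_def by blast

lemma rigidity_row_pair:
  assumes "u \<noteq> v"
  shows "rigidity_row p {u, v} w = (if w = u then p u - p v else if w = v then p v - p u else 0)"
  using assms by (auto simp: rigidity_row_def)

lemma rigidity_row_cong:
  "(\<And>u. u \<in> e \<Longrightarrow> p u = q u) \<Longrightarrow> rigidity_row p e w = rigidity_row q e w"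
  by (auto simp: rigidity_row_def intro!: sum.cong)

text \<open>The pairing of a row with velocities \<open>d\<close> is the derivative of half the
  squared edge length.\<close>

lemma sum_rigidity_row_inner:
  assumes "finite V" "u \<in> V" "v \<in> V" "u \<noteq> v"
  shows "(\<Sum>w\<in>V. rigidity_row p {u, v} w \<bullet> d w) = (p u - p v) \<bullet> (d u - d v)"
proof -
  have "(\<Sum>w\<in>V. rigidity_row p {u, v} w \<bullet> d w) = (\<Sum>w\<in>{u, v}. rigidity_row p {u, v} w \<bullet> d w)"
    by (rule sum.mono_neutral_right) (use assms in \<open>auto simp: rigidity_row_def\<close>)
  also have "\<dots> = (p u - p v) \<bullet> (d u - d v)"
    using assms(4) by (simp add: rigidity_row_pair inner_diff_left inner_diff_right)
  finally show ?thesis .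
qed

text \<open>A Gram determinant detects independence by a single polynomial in the coordinates, with
  no choice of a minor of the rigidity matrix.\<close>

definition rigidity_gram :: "'a set \<Rightarrow> ('a \<Rightarrow> real ^ 2) \<Rightarrow> 'a set list \<Rightarrow> real" where
  "rigidity_gram V p es = Determinant.det (Matrix.mat (length es) (length es)
     (\<lambda>(i, j). \<Sum>w\<in>V. rigidity_row p (es ! i) w \<bullet> rigidity_row p (es ! j) w))"

lemma sum_nth: "distinct es \<Longrightarrow> (\<Sum>e\<in>set es. f e) = (\<Sum>i<length es. f (es ! i))"
  using sum.reindex_bij_betw[OF bij_betw_nth[of es "{..<length es}" "set es"], of f] by simp

text \<open>A kernel vector of the Gram matrix gives a combination of the rows that is orthogonal to
  every row, hence to itself, hence zero.\<close>

lemma rigidity_gram_iff: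
  assumes "distinct es" "finite V"
  shows "rigidity_gram V p es \<noteq> 0 \<longleftrightarrow> independent_rows V p (set es)"
proof -
  let ?n = "length es"
  let ?r = "\<lambda>i w. rigidity_row p (es ! i) w"
  let ?A = "Matrix.mat ?n ?n (\<lambda>(i, j). \<Sum>w\<in>V. ?r i w \<bullet> ?r j w)"
  have A: "?A \<in> carrier_mat ?n ?n" by simp
  have mv: "(\<Sum>j<?n. (\<Sum>w\<in>V. ?r i w \<bullet> ?r j w) * x j) = (\<Sum>w\<in>V. ?r i w \<bullet> (\<Sum>j<?n. x j *\<^sub>R ?r j w))"
    for i x
  proof -
    have "(\<Sum>j<?n. (\<Sum>w\<in>V. ?r i w \<bullet> ?r j w) * x j) = (\<Sum>j<?n. \<Sum>w\<in>V. ?r i w \<bullet> (x j *\<^sub>R ?r j w))"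
      by (simp add: sum_distrib_left mult.commute)
    also have "\<dots> = (\<Sum>w\<in>V. \<Sum>j<?n. ?r i w \<bullet> (x j *\<^sub>R ?r j w))" by (rule sum.swap)
    finally show ?thesis by (simp only: inner_sum_right)
  qed
  have Av: "vec_index (?A *\<^sub>v v) i = (\<Sum>j<?n. (\<Sum>w\<in>V. ?r i w \<bullet> ?r j w) * vec_index v j)"
    if "v \<in> carrier_vec ?n" "i < ?n" for v i
    using that by (simp add: scalar_prod_def atLeast0LessThan)
  have dep: "rigidity_gram V p es = 0 \<longleftrightarrow> (\<exists>v. v \<in> carrier_vec ?n \<and> v \<noteq> 0\<^sub>v ?n \<and> ?A *\<^sub>v v = 0\<^sub>v ?n)"
    unfolding rigidity_gram_def by (rule det_0_iff_vec_prod_zero_field[OF A])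
  show ?thesis
  proof
    assume g: "rigidity_gram V p es \<noteq> 0"
    show "independent_rows V p (set es)"
      unfolding independent_rows_def
    proof (intro allI impI ballI)
      fix \<omega> e assume z: "\<forall>w\<in>V. (\<Sum>e\<in>set es. \<omega> e *\<^sub>R rigidity_row p e w) = 0" and e: "e \<in> set es"
      define v where "v = Matrix.vec ?n (\<lambda>i. \<omega> (es ! i))"
      have v: "v \<in> carrier_vec ?n" by (simp add: v_def)
      have "?A *\<^sub>v v = 0\<^sub>v ?n"
      proof (rule eq_vecI)
        fix i assume "i < dim_vec (0\<^sub>v ?n)"
        then have i: "i < ?n" by simp
        have "vec_index (?A *\<^sub>v v) i = (\<Sum>j<?n. (\<Sum>w\<in>V. ?r i w \<bullet> ?r j w) * \<omega> (es ! j))"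
          unfolding Av[OF v i] by (rule sum.cong) (simp_all add: v_def)
        also have "\<dots> = (\<Sum>w\<in>V. ?r i w \<bullet> (\<Sum>j<?n. \<omega> (es ! j) *\<^sub>R ?r j w))" by (rule mv)
        also have "\<dots> = 0" using z by (simp add: sum_nth[OF assms(1)])
        finally show "vec_index (?A *\<^sub>v v) i = vec_index (0\<^sub>v ?n) i" using i by simp
      qed simp
      then have "v = 0\<^sub>v ?n" using dep g v by blast
      then show "\<omega> e = 0" using e unfolding v_def
        by (metis in_set_conv_nth index_vec index_zero_vec(1))
    qed
  next
    assume ind: "independent_rows V p (set es)"
    show "rigidity_gram V p es \<noteq> 0"
    proof
      assume "rigidity_gram V p es = 0"
      then obtain v where v: "v \<in> carrier_vec ?n" "v \<noteq> 0\<^sub>v ?n" "?A *\<^sub>v v = 0\<^sub>v ?n"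
        using dep by blast
      define R where "R w = (\<Sum>j<?n. vec_index v j *\<^sub>R ?r j w)" for w
      have R0: "(\<Sum>w\<in>V. ?r i w \<bullet> R w) = 0" if "i < ?n" for i
        using Av[OF v(1) that] mv[of i "\<lambda>j. vec_index v j"] v(3) that by (simp add: R_def)
      have "(\<Sum>w\<in>V. R w \<bullet> R w) = (\<Sum>w\<in>V. \<Sum>i<?n. vec_index v i * (?r i w \<bullet> R w))"
        by (simp add: R_def inner_sum_left)
      also have "\<dots> = (\<Sum>i<?n. \<Sum>w\<in>V. vec_index v i * (?r i w \<bullet> R w))" by (rule sum.swap)
      also have "\<dots> = 0" using R0 by (simp add: sum_distrib_left[symmetric])
      finally have RV: "R w = 0" if "w \<in> V" for w
        using that assms(2) by (simp add: sum_nonneg_eq_0_iff)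
      define \<omega> where "\<omega> e = vec_index v (inv_into {..<?n} ((!) es) e)" for e
      have inj: "inj_on ((!) es) {..<?n}" using assms(1) by (auto simp: inj_on_nth)
      have \<omega>: "\<omega> (es ! i) = vec_index v i" if "i < ?n" for i
        using inv_into_f_f[OF inj] that by (simp add: \<omega>_def)
      have "(\<Sum>e\<in>set es. \<omega> e *\<^sub>R rigidity_row p e w) = R w" for w
        unfolding sum_nth[OF assms(1)] R_def by (rule sum.cong) (simp_all add: \<omega>)
      then have "\<omega> (es ! i) = 0" if "i < ?n" for i
        using independent_rowsD[OF ind, of \<omega> "es ! i"] RV that by simp
      then have "v = 0\<^sub>v ?n" using v(1) \<omega> by (intro eq_vecI) auto
      with v(2) show False by blast
    qed
  qed
qed

lemma permutes_atLeastLessThan_less: "\<pi> permutes {0..<n} \<Longrightarrow> i < n \<Longrightarrow> \<pi> i < n"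
  for n :: nat
  using permutes_in_image[of \<pi> "{0..<n}" i] by simp

text \<open>From the expanded form both polynomiality in each coordinate and continuity in the
  placement can be read off.\<close>

lemma rigidity_gram_leibniz:
  "rigidity_gram V p es = (\<Sum>\<pi>\<in>{\<pi>. \<pi> permutes {0..<length es}}. signof \<pi> *
     (\<Prod>i = 0..<length es. \<Sum>w\<in>V. rigidity_row p (es ! i) w \<bullet> rigidity_row p (es ! (\<pi> i)) w))"
  unfolding rigidity_gram_def det_def'[OF mat_carrier]
  by (intro sum.cong prod.cong refl arg_cong2[of _ _ _ _ "(*)"])
    (auto simp: permutes_atLeastLessThan_less)

text \<open>Translates between the coordinate functions to which \<open>separately_poly\<close> and
  \<open>alg_independent_rat\<close> refer and placements in the plane.\<close>

definition placement :: "('a \<times> 2 \<Rightarrow> real) \<Rightarrow> 'a \<Rightarrow> real ^ 2" where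
  "placement x v = (\<chi> i. x (v, i))"

lemma placement_surj: "\<exists>x. placement x = p"
  by (rule exI[of _ "\<lambda>(v, i). p v $ i"]) (simp add: placement_def fun_eq_iff)

lemma separately_poly_rigidity_gram:
  assumes "finite V" "\<And>e. e \<in> set es \<Longrightarrow> e \<subseteq> V"
  shows "separately_poly (V \<times> UNIV) (\<lambda>x. rigidity_gram V (placement x) es)"
proof -
  let ?n = "length es"
  have row: "separately_poly (V \<times> UNIV) (\<lambda>x. rigidity_row (placement x) e w $ i)"
    if "e \<subseteq> V" "w \<in> V" for e w i
  proof -
    have "separately_poly (V \<times> UNIV) (\<lambda>x. if w \<in> e then \<Sum>u\<in>e. x (w, i) - x (u, i) else 0)"
      using that by (cases "w \<in> e")
        (auto intro!: separately_poly_sum separately_poly_diff separately_poly_coord separately_poly_const)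
    moreover have "rigidity_row (placement x) e w $ i
        = (if w \<in> e then \<Sum>u\<in>e. x (w, i) - x (u, i) else 0)" for x
      by (simp add: rigidity_row_def placement_def)
    ultimately show ?thesis by simp
  qed
  have entry: "separately_poly (V \<times> UNIV)
      (\<lambda>x. \<Sum>w\<in>V. rigidity_row (placement x) (es ! i) w \<bullet> rigidity_row (placement x) (es ! j) w)"
    if "i < ?n" "j < ?n" for i j
    unfolding inner_vec_def inner_real_def
    by (intro separately_poly_sum separately_poly_mult row) (use assms(2) that in auto)
  show ?thesis unfolding rigidity_gram_leibniz
    by (intro separately_poly_sum separately_poly_mult separately_poly_const separately_poly_prod entry)
      (auto simp: permutes_atLeastLessThan_less)
qed

lemma tendsto_rigidity_gram:
  assumes "\<And>e. e \<in> set es \<Longrightarrow> e \<subseteq> V" "\<And>v. v \<in> V \<Longrightarrow> ((\<lambda>n. s n v) \<longlongrightarrow> p v) F"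
  shows "((\<lambda>n. rigidity_gram V (s n) es) \<longlongrightarrow> rigidity_gram V p es) F"
proof -
  let ?n = "length es"
  have row: "((\<lambda>n. rigidity_row (s n) e w) \<longlongrightarrow> rigidity_row p e w) F" if "e \<subseteq> V" for e w
    using that assms(2) unfolding rigidity_row_def
    by (cases "w \<in> e") (auto intro!: tendsto_sum tendsto_diff)
  show ?thesis unfolding rigidity_gram_leibniz
    by (intro tendsto_sum tendsto_mult tendsto_const tendsto_prod tendsto_inner row)
      (auto simp: assms(1) permutes_atLeastLessThan_less)
qed

section \<open>Henneberg moves\<close>

definition cross2 :: "real ^ 2 \<Rightarrow> real ^ 2 \<Rightarrow> real" where
  "cross2 a b = a $ 1 * b $ 2 - a $ 2 * b $ 1"

definition general_position :: "'a set \<Rightarrow> ('a \<Rightarrow> real ^ 2) \<Rightarrow> bool" where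
  "general_position V p \<longleftrightarrow> inj_on p V \<and>
     (\<forall>x\<in>V. \<forall>y\<in>V. \<forall>z\<in>V. x \<noteq> y \<and> y \<noteq> z \<and> x \<noteq> z \<longrightarrow> cross2 (p y - p x) (p z - p x) \<noteq> 0)"

text \<open>Independence, distinctness and non-collinearity are finitely many polynomial
  inequations, each satisfiable by itself and therefore all satisfiable at once.\<close>

lemma independent_rows_general_position:
  assumes I: "simple_graph V I" and p0: "independent_rows V p0 I"
  shows "\<exists>p. independent_rows V p I \<and> general_position V p"
proof -
  have finV: "finite V" using I by (simp add: simple_graph_def)
  obtain es where es: "distinct es" "set es = I"
    using finite_distinct_list[OF simple_graph_finite_edges[OF I]] by blast
  have eV: "\<And>e. e \<in> set es \<Longrightarrow> e \<subseteq> V" using I es by (auto simp: simple_graph_def)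
  define f where "f = (\<lambda>x. rigidity_gram V (placement x) es)"
  \<comment> \<open>Different first coordinates are more than different points, but this is one
    polynomial inequation per pair.\<close>
  define g :: "'a \<times> 'a \<Rightarrow> ('a \<times> 2 \<Rightarrow> real) \<Rightarrow> real" where "g = (\<lambda>(u, v) x. x (u, 1) - x (v, 1))"
  define h :: "'a \<times> 'a \<times> 'a \<Rightarrow> ('a \<times> 2 \<Rightarrow> real) \<Rightarrow> real" where "h = (\<lambda>(u, v, w) x. (x (v, 1) - x (u, 1)) * (x (w, 2) - x (u, 2))
    - (x (v, 2) - x (u, 2)) * (x (w, 1) - x (u, 1)))"
  define P where "P = {(u, v) \<in> V \<times> V. u \<noteq> v}"
  define T where "T = {(u, v, w) \<in> V \<times> V \<times> V. u \<noteq> v \<and> v \<noteq> w \<and> u \<noteq> w}"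
  have finPT: "finite P" "finite T"
    unfolding P_def T_def by (rule finite_subset[of _ "V \<times> V"], use finV in auto)
      (rule finite_subset[of _ "V \<times> V \<times> V"], use finV in auto)
  have "\<exists>x. \<forall>\<phi>\<in>insert f (g ` P \<union> h ` T). \<phi> x \<noteq> 0"
  proof (rule separately_poly_common_nonzero[of "V \<times> UNIV"])
    show "finite (V \<times> (UNIV :: 2 set))" using finV by simp
    show "countable (insert f (g ` P \<union> h ` T))" using finPT by (intro countable_finite) simp
    fix \<phi> assume "\<phi> \<in> insert f (g ` P \<union> h ` T)"
    then consider "\<phi> = f" | u v where "u \<in> V" "v \<in> V" "u \<noteq> v" "\<phi> = g (u, v)"
      | u v w where "u \<in> V" "v \<in> V" "w \<in> V" "u \<noteq> v" "v \<noteq> w" "u \<noteq> w" "\<phi> = h (u, v, w)"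
      unfolding P_def T_def by blast
    then show "separately_poly (V \<times> UNIV) \<phi> \<and> (\<exists>x. \<phi> x \<noteq> 0)"
    proof cases
      case 1
      obtain x where "placement x = p0" using placement_surj by blast
      then have "f x \<noteq> 0"
        using rigidity_gram_iff[OF es(1) finV, of p0] p0 es(2) by (simp add: f_def)
      moreover have "separately_poly (V \<times> UNIV) f"
        unfolding f_def by (rule separately_poly_rigidity_gram[OF finV eV])
      ultimately show ?thesis using 1 by blast
    next
      case 2
      have "separately_poly (V \<times> UNIV) \<phi>"
        unfolding 2(4) g_def prod.case
        by (intro separately_poly_diff separately_poly_coord) (use 2 in auto)
      moreover have "\<phi> (\<lambda>(a, i). if a = u then 1 else 0) \<noteq> 0"
        unfolding 2(4) g_def using 2(3) by simp
      ultimately show ?thesis by blast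
    next
      case 3
      have "separately_poly (V \<times> UNIV) \<phi>"
        unfolding 3(7) h_def prod.case
        by (intro separately_poly_diff separately_poly_mult separately_poly_coord) (use 3 in auto)
      \<comment> \<open>The triangle with \<open>u\<close> at the origin and \<open>v\<close>,
        \<open>w\<close> at the two unit vectors.\<close>
      moreover have "\<phi> (\<lambda>(a, i). if a = v \<and> i = 1 \<or> a = w \<and> i = 2 then 1 else 0) \<noteq> 0"
        unfolding 3(7) h_def using 3(4-6) by simp
      ultimately show ?thesis by blast
    qed
  qed
  then obtain x where f: "f x \<noteq> 0" and g: "\<forall>a\<in>P. g a x \<noteq> 0" and h: "\<forall>a\<in>T. h a x \<noteq> 0"
    by blast
  have "independent_rows V (placement x) I"
    using f rigidity_gram_iff[OF es(1) finV] es(2) by (simp add: f_def)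
  moreover have "inj_on (placement x) V"
  proof (rule inj_onI, rule ccontr)
    fix u v assume uv: "u \<in> V" "v \<in> V" "placement x u = placement x v" "u \<noteq> v"
    then have "placement x u $ 1 = placement x v $ 1" by simp
    then have "g (u, v) x = 0" by (simp add: placement_def g_def)
    then show False using g uv by (auto simp: P_def)
  qed
  moreover have "cross2 (placement x v - placement x u) (placement x w - placement x u) \<noteq> 0"
    if "u \<in> V" "v \<in> V" "w \<in> V" "u \<noteq> v" "v \<noteq> w" "u \<noteq> w" for u v w
  proof -
    have "h (u, v, w) x \<noteq> 0" using h that by (auto simp: T_def)
    then show ?thesis by (simp add: cross2_def placement_def h_def)
  qed
  ultimately show ?thesis unfolding general_position_def by blast
qed

section \<open>Effect of the two moves on stresses\<close>

lemma sum_split_vertex: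
  fixes f :: "'a set \<Rightarrow> 'b :: comm_monoid_add"
  assumes "simple_graph V I"
  shows "(\<Sum>e\<in>I. f e) = (\<Sum>e\<in>{e \<in> I. v \<notin> e}. f e) + (\<Sum>u\<in>{u. {u, v} \<in> I}. f {u, v})"
proof -
  have fin: "finite I" by (rule simple_graph_finite_edges[OF assms])
  have "{e \<in> I. v \<in> e} = (\<lambda>u. {u, v}) ` {u. {u, v} \<in> I}"
  proof
    show "{e \<in> I. v \<in> e} \<subseteq> (\<lambda>u. {u, v}) ` {u. {u, v} \<in> I}"
    proof
      fix e assume "e \<in> {e \<in> I. v \<in> e}"
      then have e: "e \<in> I" "v \<in> e" by auto
      obtain a b where "e = {a, b}" using simple_graph_edgeE[OF assms e(1)] by metis
      then show "e \<in> (\<lambda>u. {u, v}) ` {u. {u, v} \<in> I}" using e by (auto simp: insert_commute)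
    qed
  qed auto
  moreover have "inj_on (\<lambda>u. {u, v}) {u. {u, v} \<in> I}" by (auto simp: inj_on_def doubleton_eq_iff)
  ultimately have "(\<Sum>e\<in>{e \<in> I. v \<in> e}. f e) = (\<Sum>u\<in>{u. {u, v} \<in> I}. f {u, v})"
    by (simp add: sum.reindex)
  moreover have "(\<Sum>e\<in>I. f e) = (\<Sum>e\<in>{e \<in> I. v \<notin> e}. f e) + (\<Sum>e\<in>{e \<in> I. v \<in> e}. f e)"
    by (subst sum.union_disjoint[symmetric]) (use fin in \<open>auto intro: sum.cong\<close>)
  ultimately show ?thesis by simp
qed

lemma neighbours_subset:
  assumes "simple_graph V I"
  shows "{u. {u, v} \<in> I} \<subseteq> V - {v}"
  using assms by (auto simp: simple_graph_def)

lemma card_neighbours: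
  assumes "simple_graph V I"
  shows "card {u. {u, v} \<in> I} = degree_in I v"
proof -
  have "(\<Sum>e\<in>I. if v \<in> e then 1 else 0 :: nat) = (\<Sum>e\<in>{e \<in> I. v \<in> e}. 1)"
    using simple_graph_finite_edges[OF assms] by (simp add: sum.If_cases Int_def)
  moreover have "(\<Sum>e\<in>{e \<in> I. v \<notin> e}. if v \<in> e then 1 else 0 :: nat) = 0"
    by (rule sum.neutral) simp
  ultimately show ?thesis
    using sum_split_vertex[OF assms, of "\<lambda>e. if v \<in> e then 1 else 0 :: nat" v]
    by (simp add: degree_in_def)
qed

text \<open>Equilibrium at \<open>v\<close> involves only the edges at \<open>v\<close>, whose
  directions are independent by \<open>dir\<close>, so the stress vanishes on them. What remains is
  a stress of the smaller framework.\<close>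

lemma independent_rows_add_vertex:
  assumes I: "simple_graph V I" and v: "v \<in> V"
    and N: "N = {u. {u, v} \<in> I}"
    and ind: "independent_rows (V - {v}) p {e \<in> I. v \<notin> e}"
    and dir: "\<And>c. (\<Sum>u\<in>N. c u *\<^sub>R (a - p u)) = 0 \<Longrightarrow> \<forall>u\<in>N. c u = 0"
  shows "independent_rows V (p(v := a)) I"
  unfolding independent_rows_def
proof (intro allI impI)
  fix \<omega> assume z: "\<forall>w\<in>V. (\<Sum>e\<in>I. \<omega> e *\<^sub>R rigidity_row (p(v := a)) e w) = 0"
  let ?q = "p(v := a)" and ?I = "{e \<in> I. v \<notin> e}"
  have NV: "N \<subseteq> V - {v}" using neighbours_subset[OF I] N by blast
  have "(\<Sum>e\<in>?I. \<omega> e *\<^sub>R rigidity_row ?q e v) = 0"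
    by (rule sum.neutral) (simp add: rigidity_row_def)
  moreover have "(\<Sum>u\<in>N. \<omega> {u, v} *\<^sub>R rigidity_row ?q {u, v} v) = (\<Sum>u\<in>N. \<omega> {u, v} *\<^sub>R (a - p u))"
  proof (rule sum.cong[OF refl])
    fix u assume "u \<in> N"
    then have "u \<noteq> v" using NV by blast
    then show "\<omega> {u, v} *\<^sub>R rigidity_row ?q {u, v} v = \<omega> {u, v} *\<^sub>R (a - p u)"
      by (simp add: rigidity_row_pair)
  qed
  ultimately have "(\<Sum>u\<in>N. \<omega> {u, v} *\<^sub>R (a - p u)) = 0"
    using z v sum_split_vertex[OF I, of "\<lambda>e. \<omega> e *\<^sub>R rigidity_row ?q e v" v] N by simp
  from dir[OF this] have N0: "\<And>u. u \<in> N \<Longrightarrow> \<omega> {u, v} = 0" by blast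
  have "(\<Sum>e\<in>?I. \<omega> e *\<^sub>R rigidity_row p e w) = 0" if w: "w \<in> V - {v}" for w
  proof -
    have "(\<Sum>u\<in>N. \<omega> {u, v} *\<^sub>R rigidity_row ?q {u, v} w) = 0" using N0 by simp
    then have "(\<Sum>e\<in>?I. \<omega> e *\<^sub>R rigidity_row ?q e w) = 0"
      using z w sum_split_vertex[OF I, of "\<lambda>e. \<omega> e *\<^sub>R rigidity_row ?q e w" v] N by simp
    moreover have "rigidity_row ?q e w = rigidity_row p e w" if "e \<in> ?I" for e
      by (rule rigidity_row_cong) (use that in auto)
    ultimately show ?thesis by simp
  qed
  then have I0: "\<omega> e = 0" if "e \<in> ?I" for e using independent_rowsD[OF ind _ that] by blast
  show "\<forall>e\<in>I. \<omega> e = 0"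
  proof
    fix e assume e: "e \<in> I"
    show "\<omega> e = 0"
    proof (cases "v \<in> e")
      case True
      obtain b c where "e = {b, c}" using simple_graph_edgeE[OF I e] by metis
      then obtain u where "e = {u, v}" using True by (auto simp: insert_commute)
      then show ?thesis using N0 e N by blast
    qed (use I0 e in blast)
  qed
qed

lemma free_direction:
  assumes N: "finite N" "card N \<le> 2" and inj: "inj_on p N"
  shows "\<exists>a :: real ^ 2. \<forall>c. (\<Sum>u\<in>N. c u *\<^sub>R (a - p u)) = 0 \<longrightarrow> (\<forall>u\<in>N. c u = 0)"
proof -
  consider "N = {}" | x where "N = {x}" | x y where "N = {x, y}" "x \<noteq> y"
    using N by (metis card_0_eq card_1_singletonE card_2_iff le_Suc_eq numeral_2_eq_2 One_nat_def le_zero_eq)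
  then show ?thesis
  proof cases
    case 1
    then show ?thesis by simp
  next
    case 2
    have "axis 1 1 \<noteq> (0 :: real ^ 2)" by (simp add: axis_eq_0_iff)
    then show ?thesis using 2 by (intro exI[of _ "p x + axis 1 1"]) simp
  next
    case 3
    define d where "d = p y - p x"
    \<comment> \<open>The quarter turn of \<open>d\<close>, so that \<open>p x + r\<close> lies off
      the line through the two neighbours.\<close>
    define r :: "real ^ 2" where "r = vector [- (d $ 2), d $ 1]"
    have d: "d \<bullet> d > 0" using inj 3 by (auto simp: d_def inj_on_def)
    have rd: "r \<bullet> d = 0" "r \<bullet> r = d \<bullet> d" by (simp_all add: r_def inner_vec_def sum_2)
    show ?thesis
    proof (intro exI[of _ "p x + r"] allI impI)
      fix c assume "(\<Sum>u\<in>N. c u *\<^sub>R (p x + r - p u)) = 0"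
      then have eq: "c x *\<^sub>R r + c y *\<^sub>R (r - d) = 0" using 3 by (simp add: d_def algebra_simps)
      then have "(c x *\<^sub>R r + c y *\<^sub>R (r - d)) \<bullet> d = 0" by simp
      then have cy: "c y = 0" using rd d by (simp add: inner_add_left inner_diff_left)
      then have "(c x *\<^sub>R r) \<bullet> r = 0" using eq by simp
      then have "c x = 0" using rd d by simp
      with cy show "\<forall>u\<in>N. c u = 0" using 3 by simp
    qed
  qed
qed

text \<open>With \<open>v\<close> at the midpoint of the removed edge, only \<open>z\<close> pulls
  \<open>v\<close> off the line through \<open>p x\<close> and \<open>p y\<close>. Equilibrium at
  \<open>v\<close> thus kills the stress on \<open>{z, v}\<close> and makes those on
  \<open>{x, v}\<close> and \<open>{y, v}\<close> equal, and the whole stress becomes one of the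
  framework before the split.\<close>

lemma independent_rows_split_edge:
  assumes I: "simple_graph V I" and v: "v \<in> V"
    and N: "{u. {u, v} \<in> I} = {x, y, z}" "x \<noteq> y" "y \<noteq> z" "x \<noteq> z"
    and xy: "{x, y} \<notin> I"
    and ind: "independent_rows (V - {v}) p (insert {x, y} {e \<in> I. v \<notin> e})"
    and gp: "cross2 (p y - p x) (p z - p x) \<noteq> 0"
  shows "independent_rows V (p(v := (1/2) *\<^sub>R (p x + p y))) I"
  unfolding independent_rows_def
proof (intro allI impI)
  let ?a = "(1/2) *\<^sub>R (p x + p y)" and ?I = "{e \<in> I. v \<notin> e}"
  let ?q = "p(v := ?a)"
  fix \<omega> assume zero: "\<forall>w\<in>V. (\<Sum>e\<in>I. \<omega> e *\<^sub>R rigidity_row ?q e w) = 0"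
  define \<alpha> \<beta> \<gamma> where "\<alpha> = \<omega> {x, v}" and "\<beta> = \<omega> {y, v}" and "\<gamma> = \<omega> {z, v}"
  have NV: "{x, y, z} \<subseteq> V - {v}" using neighbours_subset[OF I, of v] N(1) by simp
  then have ne: "x \<noteq> v" "y \<noteq> v" "z \<noteq> v" by auto
  have sum3: "(\<Sum>e\<in>?I. \<omega> e *\<^sub>R rigidity_row ?q e w) + (\<alpha> *\<^sub>R rigidity_row ?q {x, v} w
     + \<beta> *\<^sub>R rigidity_row ?q {y, v} w + \<gamma> *\<^sub>R rigidity_row ?q {z, v} w) = 0" if "w \<in> V" for w
    using zero that sum_split_vertex[OF I, of "\<lambda>e. \<omega> e *\<^sub>R rigidity_row ?q e w" v] N
    by (simp add: \<alpha>_def \<beta>_def \<gamma>_def add.assoc)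
  have "(\<Sum>e\<in>?I. \<omega> e *\<^sub>R rigidity_row ?q e v) = 0"
    by (rule sum.neutral) (simp add: rigidity_row_def)
  then have "\<alpha> *\<^sub>R (?a - p x) + \<beta> *\<^sub>R (?a - p y) + \<gamma> *\<^sub>R (?a - p z) = 0"
    using sum3[OF v] ne by (simp add: rigidity_row_pair)
  then have star: "(\<alpha> *\<^sub>R (?a - p x) + \<beta> *\<^sub>R (?a - p y) + \<gamma> *\<^sub>R (?a - p z)) $ i = 0" for i
    by (metis zero_index)
  define d e where "d = p y - p x" and "e = p z - p x"
  have comp: "(\<alpha> - \<beta> + \<gamma>) * d $ i = 2 * \<gamma> * e $ i" for i
    using star[of i] by (simp add: d_def e_def field_simps)
  have "2 * (\<gamma> * cross2 d e) = d $ 1 * (2 * \<gamma> * e $ 2) - d $ 2 * (2 * \<gamma> * e $ 1)"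
    by (simp add: cross2_def algebra_simps)
  also have "\<dots> = 0" unfolding comp[symmetric] by simp
  finally have "\<gamma> * cross2 (p y - p x) (p z - p x) = 0" by (simp add: d_def e_def)
  then have g0: "\<gamma> = 0" using gp by simp
  have "(\<alpha> - \<beta>) * d $ i = 0" for i using comp[of i] g0 by simp
  moreover have "d $ 1 \<noteq> 0 \<or> d $ 2 \<noteq> 0"
    using gp by (auto simp: cross2_def d_def)
  ultimately have ab: "\<alpha> = \<beta>" by (metis mult_eq_0_iff right_minus_eq)
  \<comment> \<open>The edge from \<open>v\<close> to \<open>x\<close> is half as long as that from
    \<open>y\<close> to \<open>x\<close>, so half the stress on \<open>{x, y}\<close> exerts the
    same force.\<close>
  define \<psi> where "\<psi> = fun_upd \<omega> {x, y} (\<alpha> / 2)"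
  have fin: "finite ?I" using simple_graph_finite_edges[OF I] by simp
  have xyI: "{x, y} \<notin> ?I" using xy by simp
  have psi: "(\<Sum>e\<in>insert {x, y} ?I. \<psi> e *\<^sub>R rigidity_row p e w) = 0" if w: "w \<in> V - {v}" for w
  proof -
    have "(\<Sum>e\<in>?I. \<psi> e *\<^sub>R rigidity_row p e w) = (\<Sum>e\<in>?I. \<omega> e *\<^sub>R rigidity_row ?q e w)"
    proof (rule sum.cong[OF refl])
      fix e assume e: "e \<in> ?I"
      have "rigidity_row p e w = rigidity_row ?q e w"
        by (rule rigidity_row_cong) (use e in auto)
      then show "\<psi> e *\<^sub>R rigidity_row p e w = \<omega> e *\<^sub>R rigidity_row ?q e w"
        using e xyI by (auto simp: \<psi>_def)
    qed
    moreover have "(\<alpha> / 2) *\<^sub>R rigidity_row p {x, y} w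
        = \<alpha> *\<^sub>R rigidity_row ?q {x, v} w + \<alpha> *\<^sub>R rigidity_row ?q {y, v} w"
    proof -
      have half: "(\<alpha> / 2) *\<^sub>R (s - t) = \<alpha> *\<^sub>R (s - (1/2) *\<^sub>R (s + t))" for s t :: "real ^ 2"
      proof (rule Finite_Cartesian_Product.vec_eq_iff[THEN iffD2], rule allI)
        fix i
        show "((\<alpha> / 2) *\<^sub>R (s - t)) $ i = (\<alpha> *\<^sub>R (s - (1/2) *\<^sub>R (s + t))) $ i"
          by (simp add: field_simps)
      qed
      consider "w = x" | "w = y" | "w \<noteq> x" "w \<noteq> y" by blast
      then show ?thesis
      proof cases
        case 1
        then show ?thesis using ne N(2) half[of "p x" "p y"] by (simp add: rigidity_row_pair)
      next
        case 2
        then show ?thesis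
          using ne N(2) half[of "p y" "p x"] by (simp add: rigidity_row_pair add.commute)
      next
        case 3
        then show ?thesis using w ne N(2) by (simp add: rigidity_row_pair)
      qed
    qed
    ultimately show ?thesis
      using sum3[of w] w fin xyI g0 ab by (simp add: \<psi>_def add.commute)
  qed
  have psi0: "\<psi> e = 0" if "e \<in> insert {x, y} ?I" for e
    by (rule independent_rowsD[OF ind psi that])
  have a0: "\<alpha> = 0" using psi0[of "{x, y}"] by (simp add: \<psi>_def)
  show "\<forall>e\<in>I. \<omega> e = 0"
  proof
    fix e assume e: "e \<in> I"
    show "\<omega> e = 0"
    proof (cases "v \<in> e")
      case True
      obtain b c where "e = {b, c}" using simple_graph_edgeE[OF I e] by metis
      then obtain u where u: "e = {u, v}" using True by (auto simp: insert_commute)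
      then have "u \<in> {x, y, z}" using e N(1) by blast
      then show ?thesis using u a0 ab g0 by (auto simp: \<alpha>_def \<beta>_def \<gamma>_def)
    next
      case False
      then have "e \<in> ?I" using e by simp
      then show ?thesis using psi0[of e] xyI by (auto simp: \<psi>_def split: if_splits)
    qed
  qed
qed

section \<open>Existence of the inverse moves\<close>

text \<open>Two of the sets sharing two vertices can be uncrossed, and their union contains all
  three points. Otherwise each two share exactly one vertex: with S the sum of the three sizes, the
  union has S - 3 vertices and at least 2 S - 9 = 2 (S - 3) - 3 edges, so it is tight.\<close>

lemma tight_on_three:
  assumes I: "sparse_on V I"
    and T1: "tight_on V I T1" "x \<in> T1" "y \<in> T1"
    and T2: "tight_on V I T2" "y \<in> T2" "z \<in> T2"
    and T3: "tight_on V I T3" "x \<in> T3" "z \<in> T3"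
    and xyz: "x \<noteq> y" "y \<noteq> z" "x \<noteq> z"
  shows "\<exists>T. tight_on V I T \<and> {x, y, z} \<subseteq> T"
proof (cases "2 \<le> card (T1 \<inter> T2) \<or> 2 \<le> card (T2 \<inter> T3) \<or> 2 \<le> card (T1 \<inter> T3)")
  case True
  then show ?thesis
    using tight_on_Un[OF I T1(1) T2(1)] tight_on_Un[OF I T2(1) T3(1)] tight_on_Un[OF I T1(1) T3(1)]
      T1 T2 T3 by (metis UnCI empty_subsetI insert_subset)
next
  case False
  have sub: "T1 \<subseteq> V" "T2 \<subseteq> V" "T3 \<subseteq> V" using T1 T2 T3 by (auto simp: tight_on_def)
  then have fin: "finite T1" "finite T2" "finite T3"
    using sparse_on_finite_verts[OF I] by (auto intro: finite_subset)
  have single: "A \<inter> B = {u}" if "\<not> 2 \<le> card (A \<inter> B)" "u \<in> A" "u \<in> B" "finite A" for A B :: "'a set" and u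
  proof -
    have "card (A \<inter> B) \<noteq> 0" using that by auto
    then have "card (A \<inter> B) = 1" using that(1) by linarith
    then show ?thesis using that by (metis IntI card_1_singletonE singletonD)
  qed
  have i12: "T1 \<inter> T2 = {y}" and i23: "T2 \<inter> T3 = {z}" and i13: "T1 \<inter> T3 = {x}"
    using single False T1 T2 T3 fin by auto
  let ?U = "T1 \<union> T2 \<union> T3"
  have "card (T1 \<union> T2) + 1 = card T1 + card T2"
    using card_Un_Int[OF fin(1,2)] i12 by simp
  moreover have "card ?U + card ((T1 \<union> T2) \<inter> T3) = card (T1 \<union> T2) + card T3"
    using card_Un_Int[of "T1 \<union> T2" T3] fin by simp
  moreover have "(T1 \<union> T2) \<inter> T3 = {x, z}" using i13 i23 by blast
  ultimately have cU: "card ?U + 3 = card T1 + card T2 + card T3" using xyz by simp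
  let ?e = "edges_within I"
  have finI: "finite (?e A)" for A by (rule finite_edges_within[OF sparse_on_finite[OF I]])
  have dis: "?e A \<inter> ?e B = {}" if "A \<inter> B = {u}" for A B :: "'a set" and u
  proof (rule ccontr)
    assume "?e A \<inter> ?e B \<noteq> {}"
    then obtain e where e: "e \<in> I" "e \<subseteq> A \<inter> B" by (auto simp: edges_within_def)
    then have "card e \<le> card {u}" unfolding that by (intro card_mono) auto
    moreover have "card e = 2" using e sparse_on_simple[OF I] by (simp add: simple_graph_def)
    ultimately show False by simp
  qed
  have "card (?e T1 \<union> ?e T2 \<union> ?e T3) = card (?e T1) + card (?e T2) + card (?e T3)"
    using dis[OF i12] dis[OF i13] dis[OF i23] by (simp add: card_Un_disjoint finI Int_Un_distrib2)
  moreover have "card (?e T1 \<union> ?e T2 \<union> ?e T3) \<le> card (?e ?U)"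
    by (rule card_mono[OF finI]) (auto simp: edges_within_def)
  ultimately have ge: "card (?e T1) + card (?e T2) + card (?e T3) \<le> card (?e ?U)" by simp
  have "2 \<le> card T1" using T1 by (simp add: tight_on_def)
  moreover have "card T1 \<le> card ?U" by (rule card_mono) (use fin in auto)
  ultimately have U2: "2 \<le> card ?U" by linarith
  have "card (?e ?U) + 3 \<le> 2 * card ?U"
    by (rule sparse_onD[OF I _ U2]) (use sub in blast)
  then have "tight_on V I ?U"
    using ge cU T1(1) T2(1) T3(1) U2 sub unfolding tight_on_def by auto
  then show ?thesis using T1 T2 by blast
qed

lemma sparse_on_delete_vertex:
  assumes I: "sparse_on V I"
  shows "sparse_on (V - {v}) {e \<in> I. v \<notin> e}"
proof -
  have "simple_graph (V - {v}) {e \<in> I. v \<notin> e}"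
    using sparse_on_simple[OF I] by (auto simp: simple_graph_def)
  moreover have "edges_within {e \<in> I. v \<notin> e} U = edges_within I U" if "U \<subseteq> V - {v}" for U
    using that by (auto simp: edges_within_def)
  ultimately show ?thesis using sparse_onD[OF I] unfolding sparse_on_def by (metis Diff_subset order_trans)
qed

text \<open>If all three pairs of neighbours were blocked, some tight \<open>T\<close> would contain
  all neighbours. Adding \<open>v\<close> to \<open>T\<close> brings three edges but only one
  vertex, giving \<open>2 * card T\<close> edges where sparsity allows one fewer.\<close>

lemma henneberg_edge:
  assumes I: "sparse_on V I" and v: "v \<in> V" and N: "card {u. {u, v} \<in> I} = 3"
  shows "\<exists>x y z. {u. {u, v} \<in> I} = {x, y, z} \<and> x \<noteq> y \<and> y \<noteq> z \<and> x \<noteq> z \<and> {x, y} \<notin> I \<and>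
    sparse_on (V - {v}) (insert {x, y} {e \<in> I. v \<notin> e})"
proof -
  let ?I = "{e \<in> I. v \<notin> e}" and ?V = "V - {v}"
  obtain x y z where xyz: "{u. {u, v} \<in> I} = {x, y, z}" "x \<noteq> y" "y \<noteq> z" "x \<noteq> z"
    using N by (metis card_3_iff)
  have xV: "x \<in> ?V" "y \<in> ?V" "z \<in> ?V"
    using neighbours_subset[OF sparse_on_simple[OF I], of v] xyz(1) by blast+
  have I': "sparse_on ?V ?I" by (rule sparse_on_delete_vertex[OF I])
  let ?blocked = "\<lambda>a b. {a, b} \<in> ?I \<or> \<not> sparse_on ?V (insert {a, b} ?I)"
  have "\<not> (?blocked x y \<and> ?blocked y z \<and> ?blocked x z)"
  proof
    assume bl: "?blocked x y \<and> ?blocked y z \<and> ?blocked x z"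
    have "\<exists>T. tight_on ?V ?I T \<and> {a, b} \<subseteq> T" if "?blocked a b" "a \<in> ?V" "b \<in> ?V" "a \<noteq> b" for a b
      by (rule blocked_pair_tight[OF I' _ _ that(1)]) (use that in auto)
    then obtain T1 T2 T3 where T: "tight_on ?V ?I T1" "{x, y} \<subseteq> T1" "tight_on ?V ?I T2" "{y, z} \<subseteq> T2"
      "tight_on ?V ?I T3" "{x, z} \<subseteq> T3" using bl xV xyz(2-4) by meson
    obtain T where T: "tight_on ?V ?I T" "{x, y, z} \<subseteq> T"
      using tight_on_three[OF I' T(1) _ _ T(3) _ _ T(5) _ _ xyz(2-4)] T by auto
    have TV: "T \<subseteq> ?V" "2 \<le> card T" using T by (auto simp: tight_on_def)
    then have finT: "finite T" using sparse_on_finite_verts[OF I'] finite_subset by blast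
    have cT: "card (insert v T) = card T + 1" using TV finT by (subst card_insert_disjoint) auto
    have "edges_within ?I T \<union> {{x, v}, {y, v}, {z, v}} \<subseteq> edges_within I (insert v T)"
      using xyz(1) T(2) by (auto simp: edges_within_def)
    then have "card (edges_within ?I T \<union> {{x, v}, {y, v}, {z, v}}) \<le> card (edges_within I (insert v T))"
      by (rule card_mono[OF finite_edges_within[OF sparse_on_finite[OF I]]])
    moreover have "card (edges_within ?I T \<union> {{x, v}, {y, v}, {z, v}})
        = card (edges_within ?I T) + card {{x, v}, {y, v}, {z, v}}"
      by (rule card_Un_disjoint)
        (auto simp: edges_within_def sparse_on_finite[OF I] intro: finite_subset)
    moreover have "card {{x, v}, {y, v}, {z, v}} = 3"
      using xyz(2-4) xV by (simp add: doubleton_eq_iff)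
    moreover have "card (edges_within I (insert v T)) + 3 \<le> 2 * card (insert v T)"
      by (rule sparse_onD[OF I]) (use TV v cT in auto)
    moreover have "card (edges_within ?I T) + 3 = 2 * card T" using T by (simp add: tight_on_def)
    ultimately show False using cT by linarith
  qed
  then consider "\<not> ?blocked x y" | "\<not> ?blocked y z" | "\<not> ?blocked x z" by satx
  then obtain a b c where ab: "\<not> ?blocked a b" and abc: "{x, y, z} = {a, b, c}" "a \<noteq> b" "b \<noteq> c" "a \<noteq> c"
  proof cases
    case 1
    then show ?thesis by (rule that[of x y z]) (use xyz in auto)
  next
    case 2
    then show ?thesis by (rule that[of y z x]) (use xyz in auto)
  next
    case 3
    then show ?thesis by (rule that[of x z y]) (use xyz in auto)
  qed
  have "{a, b, c} \<subseteq> ?V" unfolding abc(1)[symmetric] using xV by simp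
  then have "{a, b} \<notin> I" using ab by auto
  moreover have "sparse_on ?V (insert {a, b} ?I)" using ab by simp
  moreover note abc xyz(1)
  ultimately show ?thesis using xyz(1) by (intro exI[of _ a] exI[of _ b] exI[of _ c]) simp
qed

text \<open>Henneberg induction: a sparse graph has a vertex of degree at most three, whose removal can be
  undone by adding a vertex or by splitting an edge.\<close>

lemma sparse_on_independent_rows:
  assumes "sparse_on V I"
  shows "\<exists>p. independent_rows V p I"
  using assms
proof (induction "card V" arbitrary: V I rule: less_induct)
  case less
  note I = less.prems
  have simple: "simple_graph V I" by (rule sparse_on_simple[OF I])
  have finV: "finite V" by (rule sparse_on_finite_verts[OF I])
  show ?case
  proof (cases "2 \<le> card V")
    case False
    have "I = {}"
    proof (rule ccontr)
      assume "I \<noteq> {}"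
      then obtain e where "e \<subseteq> V" "card e = 2" using simple by (auto simp: simple_graph_def)
      then show False using False card_mono[OF finV] by metis
    qed
    then show ?thesis by (simp add: independent_rows_def)
  next
    case True
    \<comment> \<open>The degree sum is at most \<open>4 * card V - 6\<close>, so the average degree
      is below 4.\<close>
    have "\<exists>v\<in>V. degree_in I v \<le> 3"
    proof (rule ccontr)
      assume "\<not> ?thesis"
      then have "4 \<le> degree_in I v" if "v \<in> V" for v using that by force
      then have "(\<Sum>v\<in>V. 4) \<le> (\<Sum>v\<in>V. degree_in I v)" by (rule sum_mono)
      then have "4 * card V \<le> 2 * card I" using sum_degree_in[OF simple] by simp
      then show False using sparse_on_card_le[OF I True] by linarith
    qed
    then obtain v where v: "v \<in> V" "degree_in I v \<le> 3" by blast
    let ?N = "{u. {u, v} \<in> I}" and ?V = "V - {v}" and ?I = "{e \<in> I. v \<notin> e}"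
    have small: "card ?V < card V" using v(1) finV by (rule card_Diff1_less[rotated])
    have NV: "?N \<subseteq> ?V" by (rule neighbours_subset[OF simple])
    then have finN: "finite ?N" using finV finite_subset by blast
    have "card ?N = degree_in I v" by (rule card_neighbours[OF simple])
    then have "card ?N \<le> 3" using v(2) by simp
    then consider "card ?N \<le> 2" | "card ?N = 3" by linarith
    then show ?thesis
    proof cases
      case 1
      have I': "sparse_on ?V ?I" by (rule sparse_on_delete_vertex[OF I])
      \<comment> \<open>The induction hypothesis yields an arbitrary placement. General position
        makes the neighbours distinct here and non-collinear in the case of degree 3.\<close>
      then obtain p where p: "independent_rows ?V p ?I" "general_position ?V p"
        using less.hyps[OF small I'] independent_rows_general_position[OF sparse_on_simple[OF I']] by blast
      then have "inj_on p ?N" using NV inj_on_subset unfolding general_position_def by blast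
      from free_direction[OF finN 1 this]
      obtain a where a: "\<forall>c. (\<Sum>u\<in>?N. c u *\<^sub>R (a - p u)) = 0 \<longrightarrow> (\<forall>u\<in>?N. c u = 0)" ..
      have "independent_rows V (p(v := a)) I"
        by (rule independent_rows_add_vertex[OF simple v(1) refl p(1)]) (use a in blast)
      then show ?thesis by blast
    next
      case 2
      obtain x y z where xyz: "?N = {x, y, z}" "x \<noteq> y" "y \<noteq> z" "x \<noteq> z" "{x, y} \<notin> I"
        and I': "sparse_on ?V (insert {x, y} ?I)"
        using henneberg_edge[OF I v(1) 2] by metis
      obtain p where p: "independent_rows ?V p (insert {x, y} ?I)" "general_position ?V p"
        using less.hyps[OF small I'] independent_rows_general_position[OF sparse_on_simple[OF I']] by blast
      have "x \<in> ?V" "y \<in> ?V" "z \<in> ?V" using NV xyz(1) by blast+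
      then have "cross2 (p y - p x) (p z - p x) \<noteq> 0"
        using p(2) xyz(2-4) unfolding general_position_def by blast
      from independent_rows_split_edge[OF simple v(1) xyz p(1) this] show ?thesis by blast
    qed
  qed
qed

section \<open>Rigidity of Laman graphs\<close>

text \<open>Gaussian elimination: an equation \<open>s\<close> with a nonzero coefficient at a pivot
  \<open>k\<close> is solved for the unknown \<open>k\<close>, which removes one equation and one
  unknown.\<close>

lemma underdetermined_system:
  fixes M :: "'i \<Rightarrow> 's \<Rightarrow> 'f :: field"
  assumes "finite S" "finite A" "card S < card A"
  shows "\<exists>\<omega>. (\<exists>i\<in>A. \<omega> i \<noteq> 0) \<and> (\<forall>s\<in>S. (\<Sum>i\<in>A. \<omega> i * M i s) = 0)"
  using assms
proof (induction S arbitrary: A M rule: finite_induct)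
  case empty
  then obtain i where "i \<in> A" by fastforce
  then show ?case by (intro exI[of _ "\<lambda>_. 1"]) auto
next
  case (insert s S)
  show ?case
  proof (cases "\<forall>i\<in>A. M i s = 0")
    case True
    have "card S < card A" using insert by simp
    from insert.IH[OF insert.prems(1) this, of M] True show ?thesis by auto
  next
    case False
    then obtain k where k: "k \<in> A" "M k s \<noteq> 0" by blast
    let ?A = "A - {k}"
    have "card S < card ?A" using insert k(1) by simp
    from insert.IH[OF _ this, of "\<lambda>i t. M i t - M i s / M k s * M k t"] insert.prems(1)
    obtain \<omega> where \<omega>: "\<exists>i\<in>?A. \<omega> i \<noteq> 0"
      "\<forall>t\<in>S. (\<Sum>i\<in>?A. \<omega> i * (M i t - M i s / M k s * M k t)) = 0" by auto
    define c where "c = (\<Sum>i\<in>?A. \<omega> i * M i s) / M k s"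
    define \<psi> where "\<psi> = fun_upd \<omega> k (- c)"
    have split: "(\<Sum>i\<in>A. \<psi> i * M i t) = (\<Sum>i\<in>?A. \<omega> i * M i t) - c * M k t" for t
    proof -
      have "(\<Sum>i\<in>A. \<psi> i * M i t) = \<psi> k * M k t + (\<Sum>i\<in>?A. \<psi> i * M i t)"
        by (rule sum.remove[OF insert.prems(1) k(1)])
      also have "(\<Sum>i\<in>?A. \<psi> i * M i t) = (\<Sum>i\<in>?A. \<omega> i * M i t)"
        by (rule sum.cong) (auto simp: \<psi>_def)
      finally show ?thesis by (simp add: \<psi>_def)
    qed
    have "(\<Sum>i\<in>A. \<psi> i * M i t) = 0" if "t \<in> S" for t
    proof -
      have "c * M k t = (\<Sum>i\<in>?A. \<omega> i * (M i s / M k s * M k t))"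
        by (simp add: c_def sum_distrib_right sum_divide_distrib mult.assoc)
      then have "(\<Sum>i\<in>?A. \<omega> i * M i t) - c * M k t
          = (\<Sum>i\<in>?A. \<omega> i * (M i t - M i s / M k s * M k t))"
        by (simp add: right_diff_distrib sum_subtractf)
      then show ?thesis using \<omega>(2) that split by simp
    qed
    moreover have "(\<Sum>i\<in>A. \<psi> i * M i s) = 0" using k(2) by (simp add: split c_def)
    moreover have "\<exists>i\<in>A. \<psi> i \<noteq> 0" using \<omega>(1) by (auto simp: \<psi>_def)
    ultimately show ?thesis by (intro exI[of _ \<psi>]) auto
  qed
qed

text \<open>The \<open>2 * card V\<close> equilibrium equations satisfy three relations (two translations and a
  rotation), so \<open>2 * card V - 2\<close> edges always carry a nonzero stress.\<close>

lemma independent_rows_infinitesimally_rigid: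
  assumes L: "simple_graph V L" and ind: "independent_rows V s L"
    and card: "card L + 3 = 2 * card V" and V2: "2 \<le> card V"
    and d: "\<And>u v. {u, v} \<in> L \<Longrightarrow> (s u - s v) \<bullet> (d u - d v) = 0"
    and uv: "u \<in> V" "v \<in> V"
  shows "(s u - s v) \<bullet> (d u - d v) = 0"
proof (rule ccontr)
  assume nz: "(s u - s v) \<bullet> (d u - d v) \<noteq> 0"
  have finV: "finite V" using L by (simp add: simple_graph_def)
  have finL: "finite L" by (rule simple_graph_finite_edges[OF L])
  have uv': "u \<noteq> v" "{u, v} \<notin> L" using nz d by auto
  \<comment> \<open>A pair violating the claim is added as an extra edge, which brings the number of
    rows to \<open>2 * card V - 2\<close>.\<close>
  let ?A = "insert {u, v} L"
  have GA: "simple_graph V ?A" using L uv uv' by (auto simp: simple_graph_def)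
  have cA: "card ?A + 2 = 2 * card V" using card uv'(2) finL by simp
  have "L \<noteq> {}"
  proof
    assume "L = {}"
    then have "3 = 2 * card V" using card by simp
    then show False by presburger
  qed
  then obtain w0 w1 where w: "{w0, w1} \<in> L" "w0 \<noteq> w1" "w0 \<in> V" "w1 \<in> V"
    using simple_graph_edgeE[OF L] by (metis all_not_in_conv)
  define \<delta> where "\<delta> = s w1 - s w0"
  have "\<delta> \<noteq> 0"
  proof
    assume "\<delta> = 0"
    then have r0: "rigidity_row s {w0, w1} x = 0" for x using w(2) by (simp add: rigidity_row_pair \<delta>_def)
    have "(if {w0, w1} = {w0, w1} then 1 else 0 :: real) = 0"
      by (rule independent_rowsD[OF ind _ w(1), of "\<lambda>e. if e = {w0, w1} then 1 else 0"])
        (rule sum.neutral, simp add: r0)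
    then show False by simp
  qed
  then have "\<delta> $ 1 \<noteq> 0 \<or> \<delta> $ 2 \<noteq> 0"
    by (metis Finite_Cartesian_Product.vec_eq_iff exhaust_2 zero_index)
  then obtain i j :: 2 where ij: "i = 1 \<and> j = 2 \<or> i = 2 \<and> j = 1" and \<delta>: "\<delta> $ i \<noteq> 0" by blast
  \<comment> \<open>Dropped are both equations at \<open>w0\<close> and one at \<open>w1\<close>,
    three in all. The one kept at \<open>w1\<close> is for an axis \<open>i\<close> along which
    \<delta> is nonzero, so that the rotation relation recovers the other one.\<close>
  let ?S = "V \<times> (UNIV :: 2 set) - {(w0, 1), (w0, 2), (w1, j)}"
  have "card ?S + 3 = 2 * card V"
  proof -
    have "card {(w0, 1 :: 2), (w0, 2), (w1, j)} = 3" using w(2) by simp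
    moreover have "{(w0, 1 :: 2), (w0, 2), (w1, j)} \<subseteq> V \<times> UNIV" using w by auto
    ultimately have "card ?S = card (V \<times> (UNIV :: 2 set)) - 3" by (simp add: card_Diff_subset)
    then show ?thesis using V2 by (simp add: card_cartesian_product)
  qed
  then have "card ?S < card ?A" using cA by linarith
  from underdetermined_system[OF _ _ this, of "\<lambda>e (w, i). rigidity_row s e w $ i"] finV finL
  obtain \<omega> where \<omega>: "\<exists>e\<in>?A. \<omega> e \<noteq> 0"
    "\<forall>x\<in>?S. (\<Sum>e\<in>?A. \<omega> e * (case x of (w, i) \<Rightarrow> rigidity_row s e w $ i)) = 0" by auto
  define R where "R x = (\<Sum>e\<in>?A. \<omega> e *\<^sub>R rigidity_row s e x)" for x
  have R0: "R x $ i = 0" if "(x, i) \<in> ?S" for x i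
    using bspec[OF \<omega>(2) that] by (simp add: R_def)
  have pair: "(\<Sum>x\<in>V. R x \<bullet> h x) = (\<Sum>e\<in>?A. \<omega> e * (\<Sum>x\<in>V. rigidity_row s e x \<bullet> h x))" for h
  proof -
    have "(\<Sum>x\<in>V. R x \<bullet> h x) = (\<Sum>x\<in>V. \<Sum>e\<in>?A. \<omega> e * (rigidity_row s e x \<bullet> h x))"
      by (simp only: R_def inner_sum_left inner_scaleR_left)
    also have "\<dots> = (\<Sum>e\<in>?A. \<Sum>x\<in>V. \<omega> e * (rigidity_row s e x \<bullet> h x))" by (rule sum.swap)
    finally show ?thesis by (simp only: sum_distrib_left)
  qed
  have triv: "(\<Sum>x\<in>V. R x \<bullet> h x) = 0"
    if h: "\<And>a b. a \<in> V \<Longrightarrow> b \<in> V \<Longrightarrow> (s a - s b) \<bullet> (h a - h b) = 0" for h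
    unfolding pair
  proof (rule sum.neutral, rule ballI)
    fix e assume "e \<in> ?A"
    then obtain a b where "e = {a, b}" "a \<noteq> b" "a \<in> V" "b \<in> V" using simple_graph_edgeE[OF GA] by metis
    then show "\<omega> e * (\<Sum>x\<in>V. rigidity_row s e x \<bullet> h x) = 0"
      using sum_rigidity_row_inner[OF finV, of a b s h] h by simp
  qed
  have two: "(\<Sum>x\<in>V. R x \<bullet> h x) = R w0 \<bullet> h w0 + R w1 \<bullet> h w1" for h
  proof -
    have "R x = 0" if "x \<in> V - {w0, w1}" for x
      unfolding Finite_Cartesian_Product.vec_eq_iff using R0[of x] that by auto
    then have "(\<Sum>x\<in>V. R x \<bullet> h x) = (\<Sum>x\<in>{w0, w1}. R x \<bullet> h x)"
      by (intro sum.mono_neutral_right) (use finV w in auto)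
    then show ?thesis using w(2) by simp
  qed
  have "(R w0 + R w1) \<bullet> c = 0" for c
    using triv[of "\<lambda>_. c"] two[of "\<lambda>_. c"] by (simp add: inner_add_left)
  then have "R w0 + R w1 = 0" by (metis inner_eq_zero_iff)
  then have R01: "R w0 = - R w1" by (simp add: eq_neg_iff_add_eq_0)
  \<comment> \<open>The quarter turn: \<open>J (s x)\<close> is the velocity of an infinitesimal
    rotation, and constants played the part of translations before.\<close>
  define J :: "real ^ 2 \<Rightarrow> real ^ 2" where "J x = vector [- (x $ 2), x $ 1]" for x
  have "(s a - s b) \<bullet> (J (s a) - J (s b)) = 0" for a b
    by (simp add: J_def inner_vec_def sum_2 algebra_simps)
  then have "R w0 \<bullet> J (s w0) + R w1 \<bullet> J (s w1) = 0" using triv[of "\<lambda>x. J (s x)"] two[of "\<lambda>x. J (s x)"] by simp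
  then have "R w1 \<bullet> J \<delta> = 0"
    unfolding R01 by (simp add: \<delta>_def J_def inner_vec_def sum_2 algebra_simps)
  then have "R w1 $ 2 * \<delta> $ 1 = R w1 $ 1 * \<delta> $ 2" by (simp add: J_def inner_vec_def sum_2)
  moreover have "R w1 $ i = 0" by (rule R0) (use ij w in auto)
  ultimately have "R w1 $ 1 = 0 \<and> R w1 $ 2 = 0" using ij \<delta> by auto
  then have "R w1 = 0" by (metis Finite_Cartesian_Product.vec_eq_iff exhaust_2 zero_index)
  moreover have "R x = 0" if "x \<in> V" "x \<noteq> w0" "x \<noteq> w1" for x
    unfolding Finite_Cartesian_Product.vec_eq_iff using R0[of x] that by auto
  ultimately have Rz: "R x = 0" if "x \<in> V" for x using R01 that by (cases "x = w0 \<or> x = w1") auto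
  \<comment> \<open>Pairing the stress with \<open>d\<close> annihilates all edges of
    \<open>L\<close>, so the extra edge carries no stress and a nonzero stress on \<open>L\<close>
    alone remains.\<close>
  have "0 = (\<Sum>x\<in>V. R x \<bullet> d x)" by (simp add: Rz)
  also have "\<dots> = (\<Sum>e\<in>{{u, v}}. \<omega> e * (\<Sum>x\<in>V. rigidity_row s e x \<bullet> d x))"
    unfolding pair
  proof (rule sum.mono_neutral_right)
    show "\<forall>e\<in>?A - {{u, v}}. \<omega> e * (\<Sum>x\<in>V. rigidity_row s e x \<bullet> d x) = 0"
    proof
      fix e assume "e \<in> ?A - {{u, v}}"
      then have e: "e \<in> L" by blast
      obtain a b where ab: "e = {a, b}" "a \<noteq> b" "a \<in> V" "b \<in> V"
        using simple_graph_edgeE[OF L e] by metis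
      then show "\<omega> e * (\<Sum>x\<in>V. rigidity_row s e x \<bullet> d x) = 0"
        using sum_rigidity_row_inner[OF finV, of a b s d] d[of a b] e by simp
    qed
  qed (use finL in auto)
  also have "\<dots> = \<omega> {u, v} * ((s u - s v) \<bullet> (d u - d v))"
    using sum_rigidity_row_inner[OF finV uv uv'(1)] by simp
  finally have \<omega>0: "\<omega> {u, v} = 0" using nz by simp
  have "(\<Sum>e\<in>L. \<omega> e *\<^sub>R rigidity_row s e x) = 0" if "x \<in> V" for x
    using Rz[OF that] uv'(2) finL \<omega>0 by (simp add: R_def)
  then have "\<forall>e\<in>L. \<omega> e = 0" using ind unfolding independent_rows_def by blast
  with \<omega>0 \<omega>(1) show False by simp
qed

text \<open>If \<open>q\<close> is equivalent to \<open>p\<close>, then \<open>p - q\<close> is an infinitesimal motion of the midpoint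
  \<open>s = (p + q) / 2\<close>, because \<open>(s u - s v) \<bullet> ((p - q) u - (p - q) v)\<close> is half of
  \<open>norm (p u - p v)\<^sup>2 - norm (q u - q v)\<^sup>2\<close>.  This replaces the inverse function theorem.\<close>

lemma midpoint_motion:
  fixes p q :: "'a \<Rightarrow> real ^ 2"
  shows "((1/2) *\<^sub>R (p u + q u) - (1/2) *\<^sub>R (p v + q v)) \<bullet> ((p u - q u) - (p v - q v)) = 0
    \<longleftrightarrow> norm (p u - p v) = norm (q u - q v)"
proof -
  define a b where "a = p u - p v" and "b = q u - q v"
  have "(1/2) *\<^sub>R (p u + q u) - (1/2) *\<^sub>R (p v + q v) = (1/2) *\<^sub>R (a + b)"
    by (simp add: a_def b_def scaleR_add_right scaleR_diff_right)
  moreover have "(p u - q u) - (p v - q v) = a - b" by (simp add: a_def b_def)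
  moreover have "(a + b) \<bullet> (a - b) = a \<bullet> a - b \<bullet> b"
    by (simp add: inner_add_left inner_diff_right inner_commute[of b a])
  moreover have "a \<bullet> a = b \<bullet> b \<longleftrightarrow> norm a = norm b" by (simp add: norm_eq)
  ultimately show ?thesis unfolding a_def[symmetric] b_def[symmetric] by simp
qed

text \<open>Equivalent but incongruent placements \<open>q n\<close> tending to \<open>p\<close>
  have midpoints tending to \<open>p\<close>. There the rows are eventually independent because the
  Gram determinant is continuous, and infinitesimal rigidity at a midpoint makes \<open>q n\<close>
  congruent to \<open>p\<close>.\<close>

lemma independent_rows_rigid_framework:
  assumes L: "simple_graph V L" and ind: "independent_rows V p L" and LF: "L \<subseteq> F"
    and card: "card L + 3 = 2 * card V" and V2: "2 \<le> card V"
  shows "rigid_framework V F p"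
proof (rule ccontr)
  assume neg: "\<not> rigid_framework V F p"
  have finV: "finite V" using L by (simp add: simple_graph_def)
  obtain es where es: "distinct es" "set es = L"
    using finite_distinct_list[OF simple_graph_finite_edges[OF L]] by blast
  have "\<exists>q. equivalent_frameworks F p q \<and> (\<forall>u\<in>V. norm (p u - q u) < inverse (real (Suc n)))
      \<and> \<not> congruent_frameworks V p q" for n
    using neg unfolding rigid_framework_def by (metis inverse_positive_iff_positive of_nat_0_less_iff zero_less_Suc)
  then obtain q where q: "\<And>n. equivalent_frameworks F p (q n)"
    "\<And>n u. u \<in> V \<Longrightarrow> norm (p u - q n u) < inverse (real (Suc n))"
    "\<And>n. \<not> congruent_frameworks V p (q n)" by metis
  define s where "s n u = (1/2) *\<^sub>R (p u + q n u)" for n u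
  have "(\<lambda>n. s n u) \<longlonglongrightarrow> p u" if u: "u \<in> V" for u
  proof -
    have "(\<lambda>n. p u - q n u) \<longlonglongrightarrow> 0"
      by (rule Lim_null_comparison[OF _ LIMSEQ_inverse_real_of_nat])
        (intro always_eventually allI less_imp_le q(2)[OF u])
    then have "(\<lambda>n. p u - (1/2) *\<^sub>R (p u - q n u)) \<longlonglongrightarrow> p u - (1/2) *\<^sub>R 0"
      by (intro tendsto_intros)
    moreover have "p u - (1/2) *\<^sub>R (p u - q n u) = s n u" for n
      unfolding s_def by (simp add: Finite_Cartesian_Product.vec_eq_iff field_simps)
    ultimately show ?thesis by simp
  qed
  then have "(\<lambda>n. rigidity_gram V (s n) es) \<longlonglongrightarrow> rigidity_gram V p es"
    by (intro tendsto_rigidity_gram) (use L es(2) in \<open>auto simp: simple_graph_def\<close>)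
  moreover have "rigidity_gram V p es \<noteq> 0" using rigidity_gram_iff[OF es(1) finV] ind es(2) by simp
  ultimately have "eventually (\<lambda>n. rigidity_gram V (s n) es \<noteq> 0) sequentially"
    by (rule tendsto_imp_eventually_ne)
  then obtain n where "rigidity_gram V (s n) es \<noteq> 0" by (auto simp: eventually_sequentially)
  then have "independent_rows V (s n) L" using rigidity_gram_iff[OF es(1) finV] es(2) by simp
  then have rig: "(s n u - s n v) \<bullet> ((p u - q n u) - (p v - q n v)) = 0" if "u \<in> V" "v \<in> V" for u v
  proof (rule independent_rows_infinitesimally_rigid[OF L _ card V2 _ that])
    fix a b assume "{a, b} \<in> L"
    then have "norm (p a - p b) = norm (q n a - q n b)"
      using q(1) LF unfolding equivalent_frameworks_def by blast
    then show "(s n a - s n b) \<bullet> ((p a - q n a) - (p b - q n b)) = 0"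
      unfolding s_def by (rule midpoint_motion[THEN iffD2])
  qed
  have "congruent_frameworks V p (q n)"
    unfolding congruent_frameworks_def
    using rig unfolding s_def midpoint_motion by blast
  then show False using q(3) by blast
qed

lemma laman_rigid_graph:
  assumes L: "sparse_on V L" and "card L + 3 = 2 * card V" "2 \<le> card V" "L \<subseteq> F"
  shows "rigid_graph V F"
proof -
  have finV: "finite V" by (rule sparse_on_finite_verts[OF L])
  obtain es where es: "distinct es" "set es = L"
    using finite_distinct_list[OF sparse_on_finite[OF L]] by blast
  have eV: "e \<subseteq> V" if "e \<in> set es" for e
    using that es(2) sparse_on_simple[OF L] by (auto simp: simple_graph_def)
  obtain p0 where "independent_rows V p0 L" using sparse_on_independent_rows[OF L] by blast
  moreover obtain x0 where "placement x0 = p0" using placement_surj by blast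
  ultimately have "rigidity_gram V (placement x0) es \<noteq> 0"
    using rigidity_gram_iff[OF es(1) finV] es(2) by simp
  then obtain x where x: "alg_independent_rat (V \<times> UNIV) x" "rigidity_gram V (placement x) es \<noteq> 0"
    using alg_independent_avoiding[OF _ separately_poly_rigidity_gram[OF finV eV]] finV
    by (metis finite_SigmaI finite)
  have "(\<lambda>(v, i). placement x v $ i) = x" by (auto simp: placement_def)
  then have "generic_framework V (placement x)" using x(1) by (simp add: generic_framework_def)
  moreover have "independent_rows V (placement x) L"
    using x(2) rigidity_gram_iff[OF es(1) finV] es(2) by simp
  then have "rigid_framework V F (placement x)"
    by (rule independent_rows_rigid_framework[OF sparse_on_simple[OF L] _ assms(4,2,3)])
  ultimately show ?thesis unfolding rigid_graph_def by blast
qed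

lemma mixed_connected_rigid_packing:
  assumes G: "simple_graph V E" and V2: "2 \<le> card V" and conn: "mixed_connected k V E" and k: "1 \<le> k"
  shows "\<exists>F :: nat \<Rightarrow> 'a set set. disjoint_family_on F {..<k} \<and>
    (\<forall>i<k. spanning_subgraph (F i) V E \<and> rigid_graph V (F i))"
proof -
  obtain J :: "nat \<Rightarrow> 'a set set" where J: "disjoint_family_on J {..<k}"
    "\<forall>i<k. J i \<subseteq> E \<and> sparse_on V (J i) \<and> card (J i) + 3 = 2 * card V"
    using sparse_packing[OF G V2 mixed_connected_rank[OF G V2 conn k]] by metis
  have "spanning_subgraph (J i) V E \<and> rigid_graph V (J i)" if "i < k" for i
    using J(2) that laman_rigid_graph[OF _ _ V2 subset_refl] sparse_on_simple
    unfolding spanning_subgraph_def by blast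
  with J(1) show ?thesis by blast
qed

section \<open>The second eigenvalue\<close>

definition quad_form :: "'a set \<Rightarrow> ('a \<Rightarrow> 'a \<Rightarrow> real) \<Rightarrow> ('a \<Rightarrow> real) \<Rightarrow> real" where
  "quad_form V M x = (\<Sum>u\<in>V. \<Sum>v\<in>V. M u v * x u * x v)"

text \<open>Maximum of the Rayleigh quotient on the hyperplane orthogonal to \<open>f\<close>:
  compactness gives it on unit vectors, and scaling extends the inequality to every
  \<open>h\<close>.\<close>

lemma constrained_maximizer:
  fixes M :: "'a \<Rightarrow> 'a \<Rightarrow> real"
  assumes finV: "finite V" and x: "(\<Sum>v\<in>V. f v * x v) = 0" "\<exists>v\<in>V. x v \<noteq> 0"
  shows "\<exists>g. (\<Sum>v\<in>V. f v * g v) = 0 \<and> (\<Sum>v\<in>V. (g v)\<^sup>2) = 1 \<and>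
    (\<forall>h. (\<Sum>v\<in>V. f v * h v) = 0 \<longrightarrow> quad_form V M h \<le> quad_form V M g * (\<Sum>v\<in>V. (h v)\<^sup>2))"
proof -
  \<comment> \<open>The functions live on the whole type, so their values outside \<open>V\<close>
    are pinned to 0. This puts the unit sphere into a compact product of intervals.\<close>
  define B :: "'a \<Rightarrow> real set" where "B v = (if v \<in> V then {-1..1} else {0})" for v
  define K where "K = {y. (\<Sum>v\<in>V. f v * y v) = 0} \<inter> {y. (\<Sum>v\<in>V. (y v)\<^sup>2) = 1}"
  have cont: "continuous_on UNIV (\<lambda>y :: 'a \<Rightarrow> real. y v)" for v
    by (rule continuous_on_product_coordinates)
  have "compactin (product_topology (\<lambda>_ :: 'a. euclidean :: real topology) UNIV) (PiE UNIV B)"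
    unfolding compactin_PiE by (auto simp: B_def)
  then have cB: "compact (PiE UNIV B)"
    by (simp add: euclidean_product_topology)
  have c1: "continuous_on UNIV (\<lambda>y :: 'a \<Rightarrow> real. \<Sum>v\<in>V. f v * y v)"
    by (rule continuous_on_sum, rule continuous_on_mult, rule continuous_on_const, rule cont)
  have c2: "continuous_on UNIV (\<lambda>y :: 'a \<Rightarrow> real. \<Sum>v\<in>V. (y v)\<^sup>2)"
    by (rule continuous_on_sum, rule continuous_on_power, rule cont)
  have c3: "continuous_on UNIV (\<lambda>y :: 'a \<Rightarrow> real. \<Sum>u\<in>V. \<Sum>v\<in>V. M u v * y u * y v)"
    by (rule continuous_on_sum, rule continuous_on_sum, rule continuous_on_mult,
        rule continuous_on_mult, rule continuous_on_const, rule cont, rule cont)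
  have "closed {y. (\<Sum>v\<in>V. f v * y v) = 0}"
    by (rule closed_Collect_eq[OF c1 continuous_on_const])
  moreover have "closed {y :: 'a \<Rightarrow> real. (\<Sum>v\<in>V. (y v)\<^sup>2) = 1}"
    by (rule closed_Collect_eq[OF c2 continuous_on_const])
  ultimately have "closed K" unfolding K_def by (rule closed_Int)
  then have cK: "compact (PiE UNIV B \<inter> K)" by (rule compact_Int_closed[OF cB])
  define nrm where "nrm h v = (if v \<in> V then h v / sqrt (\<Sum>v\<in>V. (h v)\<^sup>2) else 0)" for h and v :: 'a
  have nz: "0 < (\<Sum>v\<in>V. (h v)\<^sup>2)" if ne: "\<exists>v\<in>V. h v \<noteq> 0" for h :: "'a \<Rightarrow> real"
  proof -
    obtain v where v: "v \<in> V" "h v \<noteq> 0" using ne by blast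
    show ?thesis by (rule sum_pos2[OF finV v(1)]) (use v(2) in auto)
  qed
  have nrm: "nrm h \<in> PiE UNIV B \<inter> K" if h: "(\<Sum>v\<in>V. f v * h v) = 0" "\<exists>v\<in>V. h v \<noteq> 0" for h
  proof -
    let ?s = "\<Sum>v\<in>V. (h v)\<^sup>2"
    have "(\<Sum>v\<in>V. f v * nrm h v) = (\<Sum>v\<in>V. f v * h v) / sqrt ?s"
      unfolding sum_divide_distrib by (rule sum.cong) (simp_all add: nrm_def)
    moreover have "(\<Sum>v\<in>V. (nrm h v)\<^sup>2) = ?s / ?s"
      unfolding sum_divide_distrib by (rule sum.cong) (use nz[OF h(2)] in \<open>simp_all add: nrm_def power_divide\<close>)
    ultimately have K: "nrm h \<in> K" using h nz[OF h(2)] by (simp add: K_def)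
    have "nrm h v \<in> B v" for v
    proof (cases "v \<in> V")
      case True
      have "(nrm h v)\<^sup>2 \<le> (\<Sum>v\<in>V. (nrm h v)\<^sup>2)" by (rule member_le_sum[OF True _ finV]) simp
      then have "(nrm h v)\<^sup>2 \<le> 1" using K by (simp add: K_def)
      then have "\<bar>nrm h v\<bar> \<le> 1" by (simp add: abs_square_le_1)
      then show ?thesis using True by (auto simp: B_def)
    qed (simp add: B_def nrm_def)
    with K show ?thesis by auto
  qed
  have cQ: "continuous_on (PiE UNIV B \<inter> K) (quad_form V M)"
    unfolding quad_form_def
    by (rule continuous_on_subset[OF c3]) simp
  have "PiE UNIV B \<inter> K \<noteq> {}" using nrm[OF x] by blast
  from continuous_attains_sup[OF cK this cQ]
  obtain g where g: "g \<in> PiE UNIV B \<inter> K" "\<forall>y\<in>PiE UNIV B \<inter> K. quad_form V M y \<le> quad_form V M g"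
    by blast
  have "quad_form V M h \<le> quad_form V M g * (\<Sum>v\<in>V. (h v)\<^sup>2)" if h: "(\<Sum>v\<in>V. f v * h v) = 0" for h
  proof (cases "\<exists>v\<in>V. h v \<noteq> 0")
    case True
    let ?s = "\<Sum>v\<in>V. (h v)\<^sup>2"
    have s: "0 < ?s" by (rule nz[OF True])
    have "quad_form V M (nrm h) = (\<Sum>u\<in>V. \<Sum>v\<in>V. M u v * h u * h v / ?s)"
      unfolding quad_form_def using s by (intro sum.cong refl) (simp add: nrm_def field_simps)
    also have "\<dots> = quad_form V M h / ?s" by (simp add: quad_form_def sum_divide_distrib)
    finally have "quad_form V M h / ?s \<le> quad_form V M g" using g(2) nrm[OF h True] by metis
    then show ?thesis using s by (simp add: pos_divide_le_eq)
  qed (simp add: quad_form_def)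
  then show ?thesis using g(1) by (intro exI[of _ g]) (auto simp: K_def)
qed

text \<open>First variation along the residual \<open>h\<close> of the eigenvalue equation. The
  residual is an admissible direction: since \<open>f\<close> is an eigenfunction of a symmetric
  matrix, its hyperplane is invariant. Maximality bounds a linear term in \<open>t\<close>, with
  factor the squared norm of \<open>h\<close>, by a quadratic one.\<close>

lemma constrained_maximizer_eigenfunction:
  fixes M :: "'a \<Rightarrow> 'a \<Rightarrow> real"
  assumes finV: "finite V" and sym: "\<And>u v. M u v = M v u"
    and f: "\<And>u. u \<in> V \<Longrightarrow> (\<Sum>v\<in>V. M u v * f v) = \<theta> * f u"
    and g: "(\<Sum>v\<in>V. f v * g v) = 0" "(\<Sum>v\<in>V. (g v)\<^sup>2) = 1"
    and max: "\<And>h. (\<Sum>v\<in>V. f v * h v) = 0 \<Longrightarrow> quad_form V M h \<le> quad_form V M g * (\<Sum>v\<in>V. (h v)\<^sup>2)"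
    and u: "u \<in> V"
  shows "(\<Sum>v\<in>V. M u v * g v) = quad_form V M g * g u"
proof -
  define \<mu> where "\<mu> = quad_form V M g"
  define h where "h u = (\<Sum>v\<in>V. M u v * g v) - \<mu> * g u" for u
  define N where "N = (\<Sum>v\<in>V. (h v)\<^sup>2)"
  have fMg: "(\<Sum>u\<in>V. f u * (\<Sum>v\<in>V. M u v * g v)) = 0"
  proof -
    have "(\<Sum>u\<in>V. f u * (\<Sum>v\<in>V. M u v * g v)) = (\<Sum>u\<in>V. \<Sum>v\<in>V. M v u * f u * g v)"
      by (simp add: sum_distrib_left mult.assoc mult.left_commute sym)
    also have "\<dots> = (\<Sum>v\<in>V. \<Sum>u\<in>V. M v u * f u * g v)" by (rule sum.swap)
    also have "\<dots> = (\<Sum>v\<in>V. \<theta> * (f v * g v))"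
      by (rule sum.cong) (simp_all add: f sum_distrib_right[symmetric])
    also have "\<dots> = 0" by (simp add: sum_distrib_left[symmetric] g(1))
    finally show ?thesis .
  qed
  have fh: "(\<Sum>v\<in>V. f v * h v) = 0"
  proof -
    have "(\<Sum>v\<in>V. f v * h v) = (\<Sum>u\<in>V. f u * (\<Sum>v\<in>V. M u v * g v)) - \<mu> * (\<Sum>v\<in>V. f v * g v)"
      by (simp add: h_def right_diff_distrib sum_subtractf sum_distrib_left mult.left_commute)
    then show ?thesis using fMg g(1) by simp
  qed
  define G where "G = (\<Sum>v\<in>V. g v * h v)"
  define C where "C = (\<Sum>u\<in>V. h u * (\<Sum>v\<in>V. M u v * g v))"
  have CN: "C - \<mu> * G = N"
    by (simp add: C_def G_def N_def h_def power2_eq_square sum_subtractf[symmetric] sum_distrib_left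
        algebra_simps)
  have ineq: "2 * t * N \<le> t\<^sup>2 * (\<mu> * N - quad_form V M h)" for t
  proof -
    let ?y = "\<lambda>v. g v + t * h v"
    have "(\<Sum>v\<in>V. f v * ?y v) = 0"
      using g(1) fh by (simp add: distrib_left sum.distrib mult.left_commute[of _ t] sum_distrib_left[symmetric])
    from max[OF this] have le: "quad_form V M ?y \<le> \<mu> * (\<Sum>v\<in>V. (?y v)\<^sup>2)" by (simp add: \<mu>_def)
    have "(\<Sum>v\<in>V. (?y v)\<^sup>2) = (\<Sum>v\<in>V. (g v)\<^sup>2) + 2 * t * G + t\<^sup>2 * N"
      by (simp add: G_def N_def power2_sum sum.distrib sum_distrib_left power_mult_distrib algebra_simps)
    moreover have "quad_form V M ?y = \<mu> + 2 * t * C + t\<^sup>2 * quad_form V M h"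
    proof -
      have "quad_form V M ?y = (\<Sum>u\<in>V. \<Sum>v\<in>V. M u v * g u * g v)
        + t * (\<Sum>u\<in>V. \<Sum>v\<in>V. M u v * h u * g v) + t * (\<Sum>u\<in>V. \<Sum>v\<in>V. M u v * g u * h v)
        + t\<^sup>2 * (\<Sum>u\<in>V. \<Sum>v\<in>V. M u v * h u * h v)"
        by (simp add: quad_form_def sum.distrib sum_distrib_left power2_eq_square algebra_simps)
      moreover have "(\<Sum>u\<in>V. \<Sum>v\<in>V. M u v * h u * g v) = C"
        by (simp add: C_def sum_distrib_left mult.assoc mult.left_commute)
      moreover have "(\<Sum>u\<in>V. \<Sum>v\<in>V. M u v * g u * h v) = (\<Sum>u\<in>V. \<Sum>v\<in>V. M u v * h u * g v)"
        by (subst sum.swap) (simp add: sym mult.assoc mult.left_commute mult.commute)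
      ultimately show ?thesis by (simp add: \<mu>_def quad_form_def)
    qed
    ultimately have "\<mu> + 2 * t * C + t\<^sup>2 * quad_form V M h \<le> \<mu> * (1 + 2 * t * G + t\<^sup>2 * N)"
      using le g(2) by simp
    then show ?thesis using CN by (simp add: algebra_simps)
  qed
  have "N = 0"
  proof (rule ccontr)
    assume "N \<noteq> 0"
    moreover have "0 \<le> N" by (simp add: N_def sum_nonneg)
    ultimately have N: "0 < N" by simp
    define D where "D = \<bar>\<mu> * N - quad_form V M h\<bar> + 1"
    \<comment> \<open>Small enough for the quadratic term, at most \<open>t * N\<close>, to stay
      below the linear one \<open>2 * t * N\<close>.\<close>
    define t where "t = N / D"
    have D: "0 < D" "\<mu> * N - quad_form V M h \<le> D" by (auto simp: D_def)
    have t: "0 < t" using N D by (simp add: t_def)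
    have "2 * t * N \<le> t\<^sup>2 * D" using ineq[of t] D(2) mult_left_mono[OF D(2), of "t\<^sup>2"] by simp
    also have "t\<^sup>2 * D = t * N" using D by (simp add: t_def power2_eq_square)
    finally show False using t N by simp
  qed
  then have "h u = 0" using u finV by (simp add: N_def sum_nonneg_eq_0_iff)
  then show ?thesis by (simp add: h_def \<mu>_def)
qed

section \<open>Multiplicity of eigenvalues\<close>

lemma order_ge_2:
  fixes p :: "real poly"
  assumes "p \<noteq> 0" "poly p a = 0" "poly (pderiv p) a = 0"
  shows "2 \<le> order a p"
proof -
  obtain r where r: "p = [:-a, 1:] * r" using assms(2) by (auto simp: poly_eq_0_iff_dvd)
  have "pderiv p = r + [:-a, 1:] * pderiv r" unfolding r pderiv_mult by (simp add: pderiv_pCons)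
  then have "poly r a = 0" using assms(3) by simp
  then have "[:-a, 1:] dvd r" by (simp add: poly_eq_0_iff_dvd)
  then have "[:-a, 1:] ^ 2 dvd p" unfolding r power2_eq_square by (rule mult_dvd_mono[OF dvd_refl])
  then show ?thesis using assms(1) order_divides by blast
qed

text \<open>Column \<open>i\<close> contributes nothing to a product with \<open>h\<close> when
  \<open>h i = 0\<close>, so \<open>h\<close> without that entry is an eigenvector of the principal
  minor. The characteristic polynomials of these minors sum to the derivative of the original
  one.\<close>

lemma mat_delete_eigenvalue:
  fixes A :: "real mat"
  assumes A: "A \<in> carrier_mat n n" and i: "i < n"
    and h: "\<And>r. r < n \<Longrightarrow> (\<Sum>j<n. A $$ (r, j) * h j) = \<mu> * h r" "h i = 0" "\<exists>j<n. h j \<noteq> 0"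
  shows "poly (char_poly (mat_delete A i i)) \<mu> = 0"
proof -
  obtain m where n: "n = Suc m" using i by (cases n) auto
  define D where "D = mat_delete A i i"
  have Dm: "D \<in> carrier_mat m m" using mat_delete_carrier[OF A] n by (simp add: D_def)
  define v where "v = Matrix.vec m (\<lambda>j. h (insert_index i j))"
  have v: "v \<in> carrier_vec m" by (simp add: v_def)
  have img: "insert_index i ` {..<m} = {..<n} - {i}"
    using insert_index_image[of i m] i n by (simp add: lessThan_atLeast0)
  have inj: "inj_on (insert_index i) {..<m}" by (auto simp: inj_on_def insert_index_def split: if_splits)
  have "v \<noteq> 0\<^sub>v m"
  proof
    assume v0: "v = 0\<^sub>v m"
    obtain j where j: "j < n" "h j \<noteq> 0" using h(3) by blast
    then have "j \<in> insert_index i ` {..<m}" using img h(2) by auto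
    then obtain j' where "j' < m" "j = insert_index i j'" by auto
    then have "vec_index v j' = h j" by (simp add: v_def)
    then show False using v0 j \<open>j' < m\<close> by simp
  qed
  moreover have "D *\<^sub>v v = \<mu> \<cdot>\<^sub>v v"
  proof (rule eq_vecI)
    fix r assume "r < dim_vec (\<mu> \<cdot>\<^sub>v v)"
    then have r: "r < m" using v by simp
    have ir: "insert_index i r < n" using img r n by (metis DiffD1 imageI lessThan_iff)
    have "vec_index (D *\<^sub>v v) r = (\<Sum>j<m. A $$ (insert_index i r, insert_index i j) * h (insert_index i j))"
    proof -
      have "D $$ (r, j) = A $$ (insert_index i r, insert_index i j)" if "j < m" for j
        using mat_delete_index[of A m i i r j] A i n r that by (simp add: D_def)
      then show ?thesis
        using r Dm by (simp add: scalar_prod_def lessThan_atLeast0 v_def)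
    qed
    also have "\<dots> = (\<Sum>j\<in>{..<n} - {i}. A $$ (insert_index i r, j) * h j)"
      unfolding img[symmetric] by (simp add: sum.reindex[OF inj])
    also have "\<dots> = (\<Sum>j<n. A $$ (insert_index i r, j) * h j)"
      by (rule sum.mono_neutral_left) (use h(2) in auto)
    also have "\<dots> = \<mu> * h (insert_index i r)" by (rule h(1)[OF ir])
    finally show "vec_index (D *\<^sub>v v) r = vec_index (\<mu> \<cdot>\<^sub>v v) r" using r by (simp add: v_def)
  qed (use Dm v in simp)
  ultimately have "eigenvalue D \<mu>" using Dm v unfolding eigenvalue_def eigenvector_def by auto
  then show ?thesis using eigenvalue_root_char_poly[OF Dm] by (simp add: D_def)
qed

lemma rev_sorted_list_of_multiset_nth_1:
  fixes P :: "real multiset"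
  assumes "2 \<le> size {#x \<in># P. t \<le> x#}"
  shows "t \<le> rev (sorted_list_of_multiset P) ! 1"
proof (rule ccontr)
  assume neg: "\<not> ?thesis"
  define xs where "xs = sorted_list_of_multiset P"
  have ms: "mset xs = P" by (simp add: xs_def)
  have srt: "sorted xs" by (simp add: xs_def)
  have "size {#x \<in># P. t \<le> x#} = length (filter ((\<le>) t) xs)"
    unfolding ms[symmetric] by (simp flip: mset_filter)
  also have "\<dots> = card {i. i < length xs \<and> t \<le> xs ! i}" by (rule length_filter_conv_card)
  finally have c: "2 \<le> card {i. i < length xs \<and> t \<le> xs ! i}" using assms by simp
  have "card {i. i < length xs \<and> t \<le> xs ! i} \<le> card {..<length xs}" by (rule card_mono) auto
  then have len: "2 \<le> length xs" using c by simp
  have "rev xs ! 1 = xs ! (length xs - 2)" using len by (simp add: rev_nth numeral_2_eq_2)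
  then have lt: "xs ! (length xs - 2) < t" using neg by (simp add: xs_def)
  have "{i. i < length xs \<and> t \<le> xs ! i} \<subseteq> {length xs - 1}"
  proof
    fix i assume i: "i \<in> {i. i < length xs \<and> t \<le> xs ! i}"
    have "\<not> i \<le> length xs - 2"
    proof
      assume "i \<le> length xs - 2"
      then have "xs ! i \<le> xs ! (length xs - 2)" using srt len by (intro sorted_nth_mono) auto
      then show False using i lt by simp
    qed
    then show "i \<in> {length xs - 1}" using i by auto
  qed
  then have "card {i. i < length xs \<and> t \<le> xs ! i} \<le> card {length xs - 1}" by (intro card_mono) auto
  then show False using c by simp
qed

text \<open>Different eigenvalues are two roots. For equal ones a double root is needed: at every
  index some nonzero combination of \<open>f\<close> and \<open>g\<close> vanishes, so the
  eigenvalue is a root for each principal minor and hence of the derivative.\<close>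

lemma two_eigenfunctions_sorted_roots:
  fixes M :: "'a \<Rightarrow> 'a \<Rightarrow> real"
  assumes vs: "distinct vs" "set vs = V"
    and f: "\<And>u. u \<in> V \<Longrightarrow> (\<Sum>v\<in>V. M u v * f v) = \<theta> * f u" "\<exists>v\<in>V. f v \<noteq> 0"
    and g: "\<And>u. u \<in> V \<Longrightarrow> (\<Sum>v\<in>V. M u v * g v) = \<mu> * g u" "\<exists>v\<in>V. g v \<noteq> 0"
    and orth: "(\<Sum>v\<in>V. f v * g v) = 0" and t: "t \<le> \<theta>" "t \<le> \<mu>"
  shows "t \<le> rev (sorted_list_of_multiset (proots (char_poly
    (Matrix.mat (length vs) (length vs) (\<lambda>(i, j). M (vs ! i) (vs ! j)))))) ! 1"
proof (rule rev_sorted_list_of_multiset_nth_1)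
  let ?n = "length vs" and ?A = "Matrix.mat (length vs) (length vs) (\<lambda>(i, j). M (vs ! i) (vs ! j))"
  let ?p = "char_poly ?A"
  have A: "?A \<in> carrier_mat ?n ?n" by simp
  have p0: "?p \<noteq> 0" using degree_monic_char_poly[OF A] by auto
  have mat: "(\<Sum>j<?n. ?A $$ (r, j) * h (vs ! j)) = c * h (vs ! r)"
    if "\<And>u. u \<in> V \<Longrightarrow> (\<Sum>v\<in>V. M u v * h v) = c * h u" "r < ?n" for h c r
  proof -
    have "(\<Sum>j<?n. ?A $$ (r, j) * h (vs ! j)) = (\<Sum>j<?n. M (vs ! r) (vs ! j) * h (vs ! j))"
      using that(2) by (intro sum.cong) auto
    also have "\<dots> = (\<Sum>v\<in>V. M (vs ! r) v * h v)" using sum_nth[OF vs(1), of "\<lambda>v. M (vs ! r) v * h v"] vs(2) by simp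
    also have "\<dots> = c * h (vs ! r)" by (rule that(1)) (use that(2) vs(2) in auto)
    finally show ?thesis .
  qed
  have root: "poly ?p c = 0"
    if h: "\<And>u. u \<in> V \<Longrightarrow> (\<Sum>v\<in>V. M u v * h v) = c * h u" "\<exists>v\<in>V. h v \<noteq> 0" for h c
  proof -
    define w where "w = Matrix.vec ?n (\<lambda>i. h (vs ! i))"
    have w: "w \<in> carrier_vec ?n" by (simp add: w_def)
    have "w \<noteq> 0\<^sub>v ?n"
    proof
      assume "w = 0\<^sub>v ?n"
      then have "h (vs ! i) = 0" if "i < ?n" for i
        using that unfolding w_def by (metis index_vec index_zero_vec(1))
      then show False using h(2) vs(2) by (metis in_set_conv_nth)
    qed
    moreover have "?A *\<^sub>v w = c \<cdot>\<^sub>v w"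
    proof (rule eq_vecI)
      fix r assume "r < dim_vec (c \<cdot>\<^sub>v w)"
      then have r: "r < ?n" using w by simp
      have "vec_index (?A *\<^sub>v w) r = (\<Sum>j<?n. ?A $$ (r, j) * h (vs ! j))"
        using r by (simp add: scalar_prod_def lessThan_atLeast0 w_def)
      then show "vec_index (?A *\<^sub>v w) r = vec_index (c \<cdot>\<^sub>v w) r"
        using mat[OF h(1) r] r by (simp add: w_def)
    qed (simp add: w_def)
    ultimately have "eigenvalue ?A c" using w unfolding eigenvalue_def eigenvector_def by auto
    then show ?thesis using eigenvalue_root_char_poly[OF A] by simp
  qed
  let ?F = "{#x \<in># proots ?p. t \<le> x#}"
  show "2 \<le> size ?F"
  proof (cases "\<theta> = \<mu>")
    case False
    have "{#\<theta>, \<mu>#} \<subseteq># ?F"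
    proof (rule mset_subset_eqI)
      fix x
      have "1 \<le> order \<theta> ?p" "1 \<le> order \<mu> ?p"
        using root[OF f] root[OF g] p0 order_root by (metis One_nat_def Suc_leI neq0_conv)+
      then show "count {#\<theta>, \<mu>#} x \<le> count ?F x" using False p0 t by auto
    qed
    then show ?thesis using size_mset_mono by fastforce
  next
    case True
    have "poly (char_poly (mat_delete ?A i i)) \<mu> = 0" if i: "i < ?n" for i
    proof -
      let ?u = "vs ! i"
      have uV: "?u \<in> V" using i vs(2) by auto
      have ind: "\<exists>a b. a * f ?u + b * g ?u = 0 \<and> (\<exists>v\<in>V. a * f v + b * g v \<noteq> 0)"
      proof (cases "f ?u = 0")
        case True
        then show ?thesis using f(2) by (intro exI[of _ 1] exI[of _ 0]) simp
      next
        case fu: False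
        show ?thesis
        \<comment> \<open>This combination vanishes at \<open>?u\<close>. If it vanished everywhere,
          \<open>g\<close> would be a multiple of \<open>f\<close>, against orthogonality.\<close>
        proof (rule exI[of _ "- g ?u"], rule exI[of _ "f ?u"], rule conjI)
          show "\<exists>v\<in>V. - g ?u * f v + f ?u * g v \<noteq> 0"
          proof (rule ccontr)
            assume "\<not> ?thesis"
            then have eq: "f ?u * g v = g ?u * f v" if "v \<in> V" for v using that by fastforce
            have "f ?u * (\<Sum>v\<in>V. g v * g v) = g ?u * (\<Sum>v\<in>V. f v * g v)"
              unfolding sum_distrib_left using eq by (intro sum.cong refl) (simp add: mult.assoc[symmetric])
            then have "(\<Sum>v\<in>V. g v * g v) = 0" using fu orth by simp
            then have "\<forall>v\<in>V. g v = 0" using vs(2) by (subst (asm) sum_nonneg_eq_0_iff) auto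
            then show False using g(2) by blast
          qed
        qed simp
      qed
      then obtain a b where ab: "a * f ?u + b * g ?u = 0" "\<exists>v\<in>V. a * f v + b * g v \<noteq> 0" by blast
      define h where "h v = a * f v + b * g v" for v
      have "(\<Sum>v\<in>V. M u v * h v) = \<mu> * h u" if "u \<in> V" for u
      proof -
        have "(\<Sum>v\<in>V. M u v * h v) = a * (\<Sum>v\<in>V. M u v * f v) + b * (\<Sum>v\<in>V. M u v * g v)"
          by (simp add: h_def sum.distrib sum_distrib_left algebra_simps)
        then show ?thesis using f(1)[OF that] g(1)[OF that] True by (simp add: h_def algebra_simps)
      qed
      note h = this
      show ?thesis
      proof (rule mat_delete_eigenvalue[OF A i, of "\<lambda>j. h (vs ! j)"])
        show "(\<Sum>j<?n. ?A $$ (r, j) * h (vs ! j)) = \<mu> * h (vs ! r)" if "r < ?n" for r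
          by (rule mat[OF h that])
        show "h (vs ! i) = 0" using ab(1) by (simp add: h_def)
        show "\<exists>j<?n. h (vs ! j) \<noteq> 0" using ab(2) vs(2) by (metis h_def in_set_conv_nth)
      qed
    qed
    then have "poly (pderiv ?p) \<mu> = 0"
      unfolding pderiv_char_poly[OF A] poly_sum by (intro sum.neutral) simp
    moreover have "poly ?p \<mu> = 0" by (rule root[OF g])
    ultimately have "2 \<le> order \<mu> ?p" using order_ge_2[OF p0] by blast
    then have "2 \<le> count ?F \<mu>" using p0 t by simp
    then show ?thesis using count_le_size[of ?F \<mu>] by linarith
  qed
qed

text \<open>The Courant-Fischer bound: the maximum of the Rayleigh quotient orthogonal to
  \<open>f\<close> is an eigenvalue no smaller than the quotient of the test function
  \<open>x\<close>, and \<theta> is another one, with multiplicity.\<close>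

lemma graph_eigenvalue_2_ge:
  assumes G: "simple_graph V E"
    and f: "\<And>u. u \<in> V \<Longrightarrow> (\<Sum>v\<in>V. (if {u, v} \<in> E then 1 else 0) * f v) = \<theta> * f u" "\<exists>v\<in>V. f v \<noteq> 0"
    and x: "(\<Sum>v\<in>V. f v * x v) = 0" "\<exists>v\<in>V. x v \<noteq> 0"
    and t: "t \<le> \<theta>" "t * (\<Sum>v\<in>V. (x v)\<^sup>2) \<le> quad_form V (\<lambda>u v. if {u, v} \<in> E then 1 else 0) x"
  shows "t \<le> graph_eigenvalue V E 2"
proof -
  let ?M = "\<lambda>u v. if {u, v} \<in> E then 1 else 0 :: real"
  have finV: "finite V" using G by (simp add: simple_graph_def)
  have vs: "distinct (vertex_enum V)" "set (vertex_enum V) = V"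
    using someI_ex[OF finite_distinct_list[OF finV, unfolded conj_commute[of "set _ = V"]]]
    unfolding vertex_enum_def by auto
  obtain g where g: "(\<Sum>v\<in>V. f v * g v) = 0" "(\<Sum>v\<in>V. (g v)\<^sup>2) = 1"
    and max': "\<forall>h. (\<Sum>v\<in>V. f v * h v) = 0 \<longrightarrow> quad_form V ?M h \<le> quad_form V ?M g * (\<Sum>v\<in>V. (h v)\<^sup>2)"
    using constrained_maximizer[OF finV x, of ?M] by blast
  note max = max'[rule_format]
  have eg: "(\<Sum>v\<in>V. ?M u v * g v) = quad_form V ?M g * g u" if "u \<in> V" for u
    by (rule constrained_maximizer_eigenfunction[OF finV _ f(1) g max that]) (simp add: insert_commute)
  have g0: "\<exists>v\<in>V. g v \<noteq> 0"
  proof (rule ccontr)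
    assume "\<not> ?thesis"
    then have "(\<Sum>v\<in>V. (g v)\<^sup>2) = 0" by simp
    then show False using g(2) by simp
  qed
  have S: "0 < (\<Sum>v\<in>V. (x v)\<^sup>2)"
  proof -
    obtain v where v: "v \<in> V" "x v \<noteq> 0" using x(2) by blast
    show ?thesis by (rule sum_pos2[OF finV v(1)]) (use v(2) in auto)
  qed
  have "t \<le> quad_form V ?M g"
    by (rule mult_right_le_imp_le[OF order_trans[OF t(2) max[OF x(1)]] S])
  then show ?thesis
    using two_eigenfunctions_sorted_roots[OF vs f eg g0 g(1) t(1)]
    by (simp add: graph_eigenvalue_def graph_eigenvalues_def adjacency_matrix_def)
qed

section \<open>From the spectral gap to connectivity\<close>

definition adj :: "'a set set \<Rightarrow> 'a \<Rightarrow> 'a \<Rightarrow> real" where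
  "adj E u v = (if {u, v} \<in> E then 1 else 0)"

text \<open>Ordered pairs are counted: in a simple graph, disjoint \<open>S\<close> and
  \<open>T\<close> give the number of edges between them, whereas \<open>edge_weight E S S\<close>
  counts the edges inside \<open>S\<close> twice.\<close>

definition edge_weight :: "'a set set \<Rightarrow> 'a set \<Rightarrow> 'a set \<Rightarrow> real" where
  "edge_weight E S T = (\<Sum>u\<in>S. \<Sum>v\<in>T. adj E u v)"

lemma adj_nonneg: "0 \<le> adj E u v"
  by (simp add: adj_def)

lemma adj_commute: "adj E u v = adj E v u"
  by (simp add: adj_def insert_commute)

lemma edge_weight_nonneg: "0 \<le> edge_weight E S T"
  by (simp add: edge_weight_def sum_nonneg adj_nonneg)

lemma edge_weight_commute: "edge_weight E S T = edge_weight E T S"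
  unfolding edge_weight_def by (subst sum.swap) (simp add: adj_commute)

lemma edge_weight_Un_left:
  "finite A \<Longrightarrow> finite B \<Longrightarrow> A \<inter> B = {} \<Longrightarrow> edge_weight E (A \<union> B) T = edge_weight E A T + edge_weight E B T"
  unfolding edge_weight_def by (rule sum.union_disjoint)

lemma edge_weight_Un_right:
  "finite A \<Longrightarrow> finite B \<Longrightarrow> A \<inter> B = {} \<Longrightarrow> edge_weight E T (A \<union> B) = edge_weight E T A + edge_weight E T B"
  by (simp add: edge_weight_commute[of E T] edge_weight_Un_left)

lemma edge_weight_sum_left: "edge_weight E S T = (\<Sum>u\<in>S. edge_weight E {u} T)"
  by (simp add: edge_weight_def)

lemma edge_weight_le_edges_between:
  assumes fin: "finite E" "finite P" "finite W" and disj: "P \<inter> W = {}"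
  shows "edge_weight E P W \<le> real (card (edges_between E P W))"
proof -
  let ?S = "{(u, v) \<in> P \<times> W. {u, v} \<in> E}"
  have "edge_weight E P W = (\<Sum>(u, v)\<in>P \<times> W. if {u, v} \<in> E then 1 else 0)"
    by (simp add: edge_weight_def adj_def sum.cartesian_product)
  also have "\<dots> = (\<Sum>x\<in>P \<times> W. if (case x of (u, v) \<Rightarrow> {u, v} \<in> E) then 1 else 0)"
    by (rule sum.cong) auto
  also have "\<dots> = real (card ?S)"
  proof -
    have "P \<times> W \<inter> {x. case x of (u, v) \<Rightarrow> {u, v} \<in> E} = ?S" by auto
    then show ?thesis using fin by (simp add: sum.If_cases)
  qed
  also have "card ?S = card ((\<lambda>(u, v). {u, v}) ` ?S)"
    by (rule card_image[symmetric]) (use disj in \<open>auto simp: inj_on_def doubleton_eq_iff\<close>)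
  also have "real \<dots> \<le> real (card (edges_between E P W))"
    by (intro of_nat_mono card_mono) (use fin in \<open>auto simp: edges_between_def\<close>)
  finally show ?thesis .
qed

section \<open>Biregular graphs and the spectral cut bound\<close>

locale biregular =
  fixes X Y :: "'a set" and a b :: nat and E :: "'a set set"
  assumes G: "biregular_graph X Y a b E"
begin

definition V where "V = X \<union> Y"
definition dg :: "'a \<Rightarrow> real" where "dg v = (if v \<in> X then real a else real b)"
definition vol :: "'a set \<Rightarrow> real" where "vol S = (\<Sum>v\<in>S. dg v)"

lemma simple: "simple_graph V E"
  using G by (simp add: biregular_graph_def V_def)

lemma finV: "finite V" and finE: "finite E"
  using simple simple_graph_finite_edges by (auto simp: simple_graph_def)

lemma XY: "X \<inter> Y = {}" "X \<noteq> {}" "Y \<noteq> {}" and ab: "0 < a" "0 < b"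
  using G by (auto simp: biregular_graph_def)

lemma adj_bipartite:
  assumes "adj E u v \<noteq> 0"
  shows "u \<in> X \<and> v \<in> Y \<or> u \<in> Y \<and> v \<in> X"
proof -
  have "{u, v} \<in> E" using assms by (auto simp: adj_def split: if_splits)
  then have "\<exists>x\<in>X. \<exists>y\<in>Y. {u, v} = {x, y}" using G unfolding biregular_graph_def by blast
  then obtain x y where "x \<in> X" "y \<in> Y" "{u, v} = {x, y}" by blast
  then show ?thesis by (auto simp: doubleton_eq_iff)
qed

lemma dg_pos: "0 < dg v"
  using ab by (simp add: dg_def)

lemma sum_adj:
  assumes "u \<in> V"
  shows "(\<Sum>v\<in>V. adj E u v) = dg u"
proof -
  have "(\<Sum>v\<in>V. adj E u v) = real (card (V \<inter> {v. {u, v} \<in> E}))"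
    by (simp add: adj_def finV sum.If_cases)
  also have "V \<inter> {v. {u, v} \<in> E} = {v. {v, u} \<in> E}"
    using neighbours_subset[OF simple, of u] by (auto simp: insert_commute)
  also have "card \<dots> = degree_in E u" by (rule card_neighbours[OF simple])
  also have "real \<dots> = dg u"
    using assms G XY by (auto simp: dg_def V_def biregular_graph_def)
  finally show ?thesis .
qed

text \<open>The ends of an edge lie in different colour classes. This constancy makes
  \<open>sqrt (dg v)\<close> an eigenfunction for \<open>sqrt (a * b)\<close> and lets the
  square-root weights be pulled out of the quadratic form.\<close>

lemma dg_product:
  assumes "adj E u v \<noteq> 0"
  shows "sqrt (dg u) * sqrt (dg v) = sqrt (real a * real b)"
  using adj_bipartite[OF assms] XY by (auto simp: dg_def real_sqrt_mult mult.commute)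

lemma vol_mono: "S \<subseteq> T \<Longrightarrow> T \<subseteq> V \<Longrightarrow> vol S \<le> vol T"
  unfolding vol_def using dg_pos finV by (intro sum_mono2) (auto intro: finite_subset less_imp_le)

lemma vol_Un: "S \<subseteq> V \<Longrightarrow> vol S + vol (V - S) = vol V"
  unfolding vol_def using sum.subset_diff[of S V dg] finV by simp

text \<open>The test function is \<open>sqrt (dg v)\<close> times the centred indicator
  \<open>y\<close> of \<open>S\<close>. Its squared norm is
  \<open>N = vol S * vol (V - S) / vol V\<close>, and its quadratic form is
  \<open>sqrt (a * b) * (N - e)\<close> because \<open>2 * y u * y v\<close> is the sum of the two
  squares minus the square of the difference, which is nonzero only on cut edges.\<close>

lemma spectral_cut:
  assumes S: "S \<subseteq> V" "S \<noteq> {}" "S \<noteq> V"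
  shows "(sqrt (real a * real b) - graph_eigenvalue V E 2) * (vol S * vol (V - S))
    \<le> sqrt (real a * real b) * edge_weight E S (V - S) * vol V"
proof -
  let ?s = "sqrt (real a * real b)"
  \<comment> \<open>The degree-weighted mean of the indicator of \<open>S\<close>; subtracting it
    makes \<open>x\<close> orthogonal to \<open>sqrt (dg v)\<close>.\<close>
  define \<sigma> where "\<sigma> = vol S / vol V"
  define y :: "'a \<Rightarrow> real" where "y v = (if v \<in> S then 1 else 0) - \<sigma>" for v
  define x where "x v = sqrt (dg v) * y v" for v
  define N where "N = (\<Sum>v\<in>V. dg v * (y v)\<^sup>2)"
  define e where "e = edge_weight E S (V - S)"
  have pos: "0 < vol T" if "T \<subseteq> V" "T \<noteq> {}" for T
    unfolding vol_def using that finV dg_pos by (intro sum_pos) (auto intro: finite_subset)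
  have vS: "0 < vol S" "0 < vol (V - S)" "0 < vol V"
    using S pos[of S] pos[of "V - S"] pos[of V] by auto
  have VS: "(\<Sum>v\<in>V. dg v * (if v \<in> S then 1 else 0)) = vol S"
  proof -
    have "V \<inter> S = S" using S by blast
    then show ?thesis
      by (simp add: vol_def if_distrib[of "(*) _"] sum.If_cases finV cong: if_cong)
  qed
  have dgy: "(\<Sum>v\<in>V. dg v * y v) = 0"
  proof -
    have "(\<Sum>v\<in>V. dg v * y v) = vol S - vol V * \<sigma>"
      unfolding y_def right_diff_distrib sum_subtractf VS by (simp add: vol_def sum_distrib_right)
    then show ?thesis using vS by (simp add: \<sigma>_def)
  qed
  have Neq: "N * vol V = vol S * vol (V - S)"
  proof -
    have "N = (\<Sum>v\<in>V. dg v * (if v \<in> S then 1 else 0)) * (1 - 2 * \<sigma>) + \<sigma>\<^sup>2 * vol V"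
      unfolding N_def vol_def sum_distrib_left sum_distrib_right sum.distrib[symmetric]
      by (rule sum.cong) (auto simp: y_def power2_eq_square algebra_simps)
    then have N: "N = vol S * (1 - 2 * \<sigma>) + \<sigma>\<^sup>2 * vol V" by (simp only: VS)
    have \<sigma>: "\<sigma> * vol V = vol S" using vS by (simp add: \<sigma>_def)
    have "N * vol V = vol S * vol V - 2 * vol S * (\<sigma> * vol V) + (\<sigma> * vol V) * (\<sigma> * vol V)"
      by (simp add: N power2_eq_square algebra_simps)
    also have "\<dots> = vol S * (vol V - vol S)" unfolding \<sigma> by (simp add: algebra_simps)
    also have "vol V - vol S = vol (V - S)" using vol_Un[OF S(1)] by simp
    finally show ?thesis .
  qed
  then have Npos: "0 < N" using vS by (metis mult_pos_pos zero_less_mult_pos2)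
  have xx: "(\<Sum>v\<in>V. (x v)\<^sup>2) = N"
    unfolding N_def x_def by (rule sum.cong) (use dg_pos in \<open>auto simp: power_mult_distrib less_imp_le\<close>)
  have row_sum: "(\<Sum>u\<in>V. \<Sum>v\<in>V. adj E u v * (y u)\<^sup>2) = N"
    unfolding N_def by (rule sum.cong) (simp_all add: sum_distrib_right[symmetric] sum_adj)
  have col_sum: "(\<Sum>u\<in>V. \<Sum>v\<in>V. adj E u v * (y v)\<^sup>2) = N"
    by (subst sum.swap) (simp add: adj_commute row_sum)
  \<comment> \<open>The factor 2 arises because ordered pairs see each cut edge from both
    ends.\<close>
  have cut: "(\<Sum>u\<in>V. \<Sum>v\<in>V. adj E u v * (y u - y v)\<^sup>2) = 2 * e"
  proof -
    have *: "(\<Sum>v\<in>V. g v * (if v \<in> T then 1 else 0)) = (\<Sum>v\<in>T. g v)" if "T \<subseteq> V" for g :: "'a \<Rightarrow> real" and T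
    proof -
      have "V \<inter> T = T" using that by blast
      then show ?thesis by (simp add: if_distrib[of "(*) _"] sum.If_cases finV cong: if_cong)
    qed
    have ew: "edge_weight E A B = (\<Sum>u\<in>V. \<Sum>v\<in>V. adj E u v * ((if u \<in> A then 1 else 0) * (if v \<in> B then 1 else 0)))"
      if "A \<subseteq> V" "B \<subseteq> V" for A B
    proof -
      have "(\<Sum>v\<in>V. adj E u v * ((if u \<in> A then 1 else 0) * (if v \<in> B then 1 else 0)))
        = (\<Sum>v\<in>B. adj E u v) * (if u \<in> A then 1 else 0)" for u
        using *[OF that(2), of "adj E u"] by simp
      then show ?thesis unfolding edge_weight_def using *[OF that(1), of "\<lambda>u. \<Sum>v\<in>B. adj E u v"] by simp
    qed
    have "(\<Sum>u\<in>V. \<Sum>v\<in>V. adj E u v * (y u - y v)\<^sup>2) = edge_weight E S (V - S) + edge_weight E (V - S) S"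
      unfolding ew[OF S(1) Diff_subset] ew[OF Diff_subset S(1)] sum.distrib[symmetric]
      by (intro sum.cong refl) (auto simp: y_def)
    then show ?thesis by (simp add: e_def edge_weight_commute[of E "V - S"])
  qed
  have Q: "quad_form V (adj E) x = ?s * (N - e)"
  proof -
    have "quad_form V (adj E) x = (\<Sum>u\<in>V. \<Sum>v\<in>V. ?s * (adj E u v * (y u * y v)))"
      unfolding quad_form_def
    proof (intro sum.cong refl)
      fix u v
      show "adj E u v * x u * x v = ?s * (adj E u v * (y u * y v))"
        using dg_product[of u v] by (cases "adj E u v = 0") (auto simp: x_def algebra_simps)
    qed
    also have "\<dots> = ?s * (\<Sum>u\<in>V. \<Sum>v\<in>V. adj E u v * (y u * y v))" by (simp add: sum_distrib_left)
    also have "(\<Sum>u\<in>V. \<Sum>v\<in>V. adj E u v * (y u * y v)) = N - e"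
    proof -
      have "2 * (\<Sum>u\<in>V. \<Sum>v\<in>V. adj E u v * (y u * y v)) = (\<Sum>u\<in>V. \<Sum>v\<in>V. adj E u v * (y u)\<^sup>2)
        + (\<Sum>u\<in>V. \<Sum>v\<in>V. adj E u v * (y v)\<^sup>2) - (\<Sum>u\<in>V. \<Sum>v\<in>V. adj E u v * (y u - y v)\<^sup>2)"
        unfolding sum.distrib[symmetric] sum_subtractf[symmetric] sum_distrib_left
        by (intro sum.cong refl) (simp add: power2_eq_square algebra_simps)
      then show ?thesis using row_sum col_sum cut by simp
    qed
    finally show ?thesis .
  qed
  have f: "(\<Sum>v\<in>V. adj E u v * sqrt (dg v)) = ?s * sqrt (dg u)" if "u \<in> V" for u
  proof -
    have "adj E u v * sqrt (dg v) = adj E u v * (?s / sqrt (dg u))" for v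
      using dg_product[of u v] dg_pos[of u] by (cases "adj E u v = 0") (auto simp: field_simps)
    then have "(\<Sum>v\<in>V. adj E u v * sqrt (dg v)) = dg u * (?s / sqrt (dg u))"
      by (simp only: sum_distrib_right[symmetric] sum_adj[OF that])
    also have "\<dots> = ?s * (dg u / sqrt (dg u))" by simp
    also have "dg u / sqrt (dg u) = sqrt (dg u)" using dg_pos[of u] by (simp add: real_div_sqrt)
    finally show ?thesis .
  qed
  have fx: "(\<Sum>v\<in>V. sqrt (dg v) * x v) = 0"
  proof -
    have "sqrt (dg v) * x v = dg v * y v" for v
      using dg_pos[of v] by (simp add: x_def mult.assoc[symmetric] less_imp_le)
    then show ?thesis using dgy by simp
  qed
  have x0: "\<exists>v\<in>V. x v \<noteq> 0"
  proof (rule ccontr)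
    assume "\<not> ?thesis"
    then have "(\<Sum>v\<in>V. (x v)\<^sup>2) = 0" by simp
    then show False using xx Npos by simp
  qed
  have f0: "\<exists>v\<in>V. sqrt (dg v) \<noteq> 0" using S dg_pos by (metis all_not_in_conv less_irrefl real_sqrt_eq_0_iff subset_empty)
  define t where "t = ?s * (1 - e / N)"
  have "0 \<le> ?s * (e / N)"
    unfolding e_def by (intro mult_nonneg_nonneg divide_nonneg_pos edge_weight_nonneg Npos) simp
  then have t1: "t \<le> ?s" by (simp add: t_def right_diff_distrib)
  have t2: "t * (\<Sum>v\<in>V. (x v)\<^sup>2) \<le> quad_form V (adj E) x"
    using Npos by (simp add: xx Q t_def field_simps)
  have "t \<le> graph_eigenvalue V E 2"
    by (rule graph_eigenvalue_2_ge[OF simple f[unfolded adj_def] f0 fx x0 t1 t2[unfolded adj_def]])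
  then have "?s - graph_eigenvalue V E 2 \<le> ?s * e / N"
    by (simp add: t_def right_diff_distrib)
  then have "(?s - graph_eigenvalue V E 2) * N \<le> ?s * e" using Npos by (simp add: pos_le_divide_eq)
  then have "(?s - graph_eigenvalue V E 2) * N * vol V \<le> ?s * e * vol V"
    using vS(3) by (intro mult_right_mono) auto
  then show ?thesis by (simp only: mult.assoc Neq e_def)
qed

section \<open>Sizes of the sides of a small cut\<close>

lemma edge_weight_vertex_le_card:
  assumes "finite T"
  shows "edge_weight E {u} T \<le> card T"
proof -
  have "(\<Sum>v\<in>T. adj E u v) \<le> (\<Sum>v\<in>T. 1)" by (intro sum_mono) (simp add: adj_def)
  then show ?thesis by (simp add: edge_weight_def)
qed

lemma degree_split:
  assumes VU: "P \<union> B \<union> W = V" "P \<inter> B = {}" "P \<inter> W = {}" "B \<inter> W = {}" and u: "u \<in> V"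
  shows "edge_weight E {u} P + edge_weight E {u} B + edge_weight E {u} W = dg u"
proof -
  have fin: "finite P" "finite B" "finite W" using finV unfolding VU(1)[symmetric] by simp_all
  have "(P \<union> B) \<inter> W = {}" using VU by blast
  then have "edge_weight E {u} V = edge_weight E {u} P + edge_weight E {u} B + edge_weight E {u} W"
    using VU fin by (simp add: VU(1)[symmetric] edge_weight_Un_right)
  moreover have "edge_weight E {u} V = dg u" using sum_adj[OF u] by (simp add: edge_weight_def)
  ultimately show ?thesis by simp
qed

lemma edge_weight_vertex_side:
  assumes "finite T"
  shows "u \<in> X \<Longrightarrow> edge_weight E {u} T \<le> card (T \<inter> Y)" and "u \<in> Y \<Longrightarrow> edge_weight E {u} T \<le> card (T \<inter> X)"
proof -
  have *: "edge_weight E {u} T \<le> card (T \<inter> Z)" if "\<And>v. adj E u v \<noteq> 0 \<Longrightarrow> v \<in> Z" for Z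
  proof -
    have "edge_weight E {u} T = edge_weight E {u} (T \<inter> Z)"
      unfolding edge_weight_def using assms that by (intro sum.cong refl sum.mono_neutral_right) auto
    then show ?thesis using edge_weight_vertex_le_card[of "T \<inter> Z" u] assms by simp
  qed
  show "edge_weight E {u} T \<le> card (T \<inter> Y)" if "u \<in> X" by (rule *) (use adj_bipartite that XY in blast)
  show "edge_weight E {u} T \<le> card (T \<inter> X)" if "u \<in> Y" by (rule *) (use adj_bipartite that XY in blast)
qed

text \<open>By bipartiteness a vertex of \<open>P \<inter> X\<close> has at most
  \<open>card (P \<inter> Y)\<close> neighbours in \<open>P\<close> and
  \<open>card (B \<inter> Y)\<close> in \<open>B\<close>; all its others lie in \<open>W\<close>.
  The same holds with the colour classes exchanged.\<close>

lemma small_side_cut: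
  assumes VU: "P \<union> B \<union> W = V" "P \<inter> B = {}" "P \<inter> W = {}" "B \<inter> W = {}"
  shows "(real a - card (P \<inter> Y) - card (B \<inter> Y)) * card (P \<inter> X)
    + (real b - card (P \<inter> X) - card (B \<inter> X)) * card (P \<inter> Y) \<le> edge_weight E P W"
proof -
  have fin: "finite P" "finite B" "finite W" using finV unfolding VU(1)[symmetric] by simp_all
  have PV: "P \<subseteq> X \<union> Y" using VU(1) by (auto simp: V_def)
  have X: "real a - card (P \<inter> Y) - card (B \<inter> Y) \<le> edge_weight E {u} W" if "u \<in> P \<inter> X" for u
  proof -
    have "u \<in> V" using that VU(1) by blast
    then show ?thesis
      using degree_split[OF VU, of u] edge_weight_vertex_side(1)[OF fin(1), of u]
        edge_weight_vertex_side(1)[OF fin(2), of u] that by (simp add: dg_def)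
  qed
  have Y: "real b - card (P \<inter> X) - card (B \<inter> X) \<le> edge_weight E {u} W" if "u \<in> P \<inter> Y" for u
  proof -
    have "u \<notin> X" "u \<in> V" using that XY VU(1) by blast+
    then show ?thesis
      using degree_split[OF VU, of u] edge_weight_vertex_side(2)[OF fin(1), of u]
        edge_weight_vertex_side(2)[OF fin(2), of u] that by (simp add: dg_def)
  qed
  have "(real a - card (P \<inter> Y) - card (B \<inter> Y)) * card (P \<inter> X) \<le> edge_weight E (P \<inter> X) W"
  proof -
    have "(\<Sum>u\<in>P \<inter> X. real a - card (P \<inter> Y) - card (B \<inter> Y)) \<le> (\<Sum>u\<in>P \<inter> X. edge_weight E {u} W)"
      by (rule sum_mono[OF X])
    then show ?thesis unfolding edge_weight_sum_left[of E "P \<inter> X"] by (simp add: mult.commute)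
  qed
  moreover have "(real b - card (P \<inter> X) - card (B \<inter> X)) * card (P \<inter> Y) \<le> edge_weight E (P \<inter> Y) W"
  proof -
    have "(\<Sum>u\<in>P \<inter> Y. real b - card (P \<inter> X) - card (B \<inter> X)) \<le> (\<Sum>u\<in>P \<inter> Y. edge_weight E {u} W)"
      by (rule sum_mono[OF Y])
    then show ?thesis unfolding edge_weight_sum_left[of E "P \<inter> Y"] by (simp add: mult.commute)
  qed
  moreover have "edge_weight E P W = edge_weight E (P \<inter> X) W + edge_weight E (P \<inter> Y) W"
  proof -
    have "P = P \<inter> X \<union> P \<inter> Y" "P \<inter> X \<inter> (P \<inter> Y) = {}" using PV XY by blast+
    then show ?thesis using edge_weight_Un_left[of "P \<inter> X" "P \<inter> Y"] fin by (metis finite_Int)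
  qed
  ultimately show ?thesis by linarith
qed

end

text \<open>Here \<alpha>, \<beta> are the sizes of the parts of one side and \<open>x\<close>,
  \<open>y\<close> those of the separator. The left side of \<open>cut\<close> equals
  \<open>(a - y) * \<alpha> + (b - x - 2 * \<alpha>) * \<beta>\<close>. If
  \<open>2 * \<alpha> \<le> b - 2\<close>, then \<open>x \<le> 2\<close> makes both terms
  nonnegative, and one of them reaches \<open>6 * k - x - y\<close>: the first if \<alpha> is
  positive, the second otherwise.\<close>

lemma small_side_arith:
  fixes \<alpha> \<beta> x y k :: nat and a b :: real
  assumes "1 \<le> \<alpha> + \<beta>" "x + y \<le> 2" "1 \<le> k" "6 * real k \<le> a" "6 * real k \<le> b"
    and cut: "(a - \<beta> - y) * \<alpha> + (b - \<alpha> - x) * \<beta> 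
      < 6 * real k - 2 * real k * (real x + real y)"
  shows "b - 2 < 2 * real \<alpha>"
proof (rule ccontr)
  assume "\<not> ?thesis"
  then have \<alpha>: "2 * real \<alpha> \<le> b - 2" by simp
  have eq: "(a - \<beta> - y) * \<alpha> + (b - \<alpha> - x) * \<beta> = (a - y) * \<alpha> + (b - x - 2 * real \<alpha>) * \<beta>"
    by (simp add: algebra_simps)
  have xk: "real x \<le> 2 * real k * real x" "real y \<le> 2 * real k * real y"
    using assms(3) by (intro mult_right_mono[of 1 "2 * real k", simplified]; simp)+
  then have k: "6 * real k - 2 * real k * (real x + real y) \<le> 6 * real k - real x - real y"
    by (simp add: algebra_simps)
  have x2: "real x \<le> 2" "real y \<le> 2" using assms(2) by auto
  show False
  proof (cases "\<alpha> = 0")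
    case True
    then have "1 \<le> real \<beta>" using assms(1) by simp
    then have "(b - x) * 1 \<le> (b - x) * \<beta>"
      using x2 assms(3,5) by (intro mult_left_mono) auto
    then show False using eq cut True k assms(5) by simp
  next
    case False
    then have "(a - y) * 1 \<le> (a - y) * \<alpha>"
      using x2 assms(3,4) by (intro mult_left_mono) auto
    moreover have "0 \<le> (b - x - 2 * real \<alpha>) * \<beta>" using \<alpha> x2 by (intro mult_nonneg_nonneg) auto
    ultimately show False using eq cut k assms(4) by simp
  qed
qed

context biregular
begin

text \<open>By integrality the strict bound of \<open>small_side_arith\<close> says
  \<open>b \<le> 2 * card (P \<inter> X) + 1\<close>, which is where the ceilings come from. The cut
  inequality is symmetric under exchanging \<open>X\<close>, \<open>a\<close> with \<open>Y\<close>,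
  \<open>b\<close>, so the other bound follows likewise.\<close>

lemma small_side_large:
  assumes VU: "P \<union> B \<union> W = V" "P \<inter> B = {}" "P \<inter> W = {}" "B \<inter> W = {}" and P: "P \<noteq> {}"
    and B: "card B \<le> 2" and k: "1 \<le> k" "6 * k \<le> a" "6 * k \<le> b"
    and cut: "edge_weight E P W + 2 * real k * card B < 6 * real k"
  shows "\<lceil>(real b - 1) / 2\<rceil> \<le> int (card (P \<inter> X))" and "\<lceil>(real a - 1) / 2\<rceil> \<le> int (card (P \<inter> Y))"
proof -
  have fin: "finite P" "finite B" using finV unfolding VU(1)[symmetric] by simp_all
  have sub: "P \<subseteq> X \<union> Y" "B \<subseteq> X \<union> Y" using VU(1) by (auto simp: V_def)
  have split: "card T = card (T \<inter> X) + card (T \<inter> Y)" if "finite T" "T \<subseteq> X \<union> Y" for T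
  proof -
    have "T = T \<inter> X \<union> T \<inter> Y" "T \<inter> X \<inter> (T \<inter> Y) = {}" using that XY by blast+
    then show ?thesis using card_Un_disjoint[of "T \<inter> X" "T \<inter> Y"] that(1) by (metis finite_Int)
  qed
  have P1: "1 \<le> card (P \<inter> X) + card (P \<inter> Y)"
    using P fin split[OF fin(1) sub(1)] by (metis One_nat_def Suc_leI card_gt_0_iff)
  have cB: "card B = card (B \<inter> X) + card (B \<inter> Y)" by (rule split[OF fin(2) sub(2)])
  have c: "(real a - card (P \<inter> Y) - card (B \<inter> Y)) * card (P \<inter> X)
      + (real b - card (P \<inter> X) - card (B \<inter> X)) * card (P \<inter> Y)
      < 6 * real k - 2 * real k * (real (card (B \<inter> X)) + real (card (B \<inter> Y)))"
    using small_side_cut[OF VU] cut unfolding cB of_nat_add by linarith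
  have "real b - 2 < 2 * real (card (P \<inter> X))"
    by (rule small_side_arith[OF P1 _ k(1) _ _ c]) (use B cB k in auto)
  then have "b \<le> 2 * card (P \<inter> X) + 1" by linarith
  then have "real b \<le> real (2 * card (P \<inter> X) + 1)" by (rule of_nat_mono)
  then have "(real b - 1) / 2 \<le> real (card (P \<inter> X))" by simp
  then show "\<lceil>(real b - 1) / 2\<rceil> \<le> int (card (P \<inter> X))" by linarith
  have c': "(real b - card (P \<inter> X) - card (B \<inter> X)) * card (P \<inter> Y)
      + (real a - card (P \<inter> Y) - card (B \<inter> Y)) * card (P \<inter> X)
      < 6 * real k - 2 * real k * (real (card (B \<inter> Y)) + real (card (B \<inter> X)))"
    using c by (simp only: add.commute)
  have "real a - 2 < 2 * real (card (P \<inter> Y))"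
    by (rule small_side_arith[OF _ _ k(1) _ _ c']) (use P1 B cB k in auto)
  then have "a \<le> 2 * card (P \<inter> Y) + 1" by linarith
  then have "real a \<le> real (2 * card (P \<inter> Y) + 1)" by (rule of_nat_mono)
  then have "(real a - 1) / 2 \<le> real (card (P \<inter> Y))" by simp
  then show "\<lceil>(real a - 1) / 2\<rceil> \<le> int (card (P \<inter> Y))" by linarith
qed

text \<open>Each separating vertex is moved to the side where it has more neighbours.\<close>

lemma absorb_separator:
  assumes VU: "P \<union> B \<union> W = V" "P \<inter> B = {}" "P \<inter> W = {}" "B \<inter> W = {}"
  shows "\<exists>S. P \<subseteq> S \<and> S \<subseteq> V \<and> W \<subseteq> V - S \<and>
    2 * edge_weight E S (V - S) \<le> 2 * edge_weight E P W + real (max a b) * card B"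
proof -
  have fin: "finite P" "finite B" "finite W" using finV unfolding VU(1)[symmetric] by simp_all
  define B1 where "B1 = {z \<in> B. edge_weight E {z} W \<le> edge_weight E {z} P}"
  define B2 where "B2 = B - B1"
  have BB: "B = B1 \<union> B2" "B1 \<inter> B2 = {}" by (auto simp: B1_def B2_def)
  have finB: "finite B1" "finite B2" using fin(2) BB by auto
  have cS: "V - (P \<union> B1) = W \<union> B2" using VU BB by blast
  have dPB: "P \<inter> B1 = {}" "W \<inter> B2 = {}" using VU BB by blast+
  have e: "edge_weight E (P \<union> B1) (W \<union> B2)
    = edge_weight E P W + edge_weight E B2 P + edge_weight E B1 W + edge_weight E B1 B2"
    using fin finB dPB
    by (simp add: edge_weight_Un_left edge_weight_Un_right edge_weight_commute[of E B2 P])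
  define m where "m = real (max a b)"
  have dgm: "dg z \<le> m" for z by (simp add: dg_def m_def)
  have BV: "z \<in> V" if "z \<in> B" for z using that VU(1) by blast
  \<comment> \<open>The smaller of the two numbers of neighbours is at most half of the degree left
    after removing the neighbours in \<open>B\<close>.\<close>
  have 1: "2 * edge_weight E {z} W \<le> m - edge_weight E {z} B" if "z \<in> B1" for z
    using that degree_split[OF VU BV, of z] dgm[of z] by (simp add: B1_def)
  have 2: "2 * edge_weight E {z} P \<le> m - edge_weight E {z} B" if "z \<in> B2" for z
    using that degree_split[OF VU BV, of z] dgm[of z] by (auto simp: B1_def B2_def)
  have "2 * edge_weight E B1 W + 2 * edge_weight E B2 P
      = (\<Sum>z\<in>B1. 2 * edge_weight E {z} W) + (\<Sum>z\<in>B2. 2 * edge_weight E {z} P)"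
    unfolding edge_weight_sum_left[of E B1] edge_weight_sum_left[of E B2] by (simp add: sum_distrib_left)
  also have "\<dots> \<le> (\<Sum>z\<in>B1. m - edge_weight E {z} B) + (\<Sum>z\<in>B2. m - edge_weight E {z} B)"
    by (intro add_mono sum_mono 1 2)
  also have "\<dots> = (\<Sum>z\<in>B. m - edge_weight E {z} B)"
    unfolding BB(1) by (rule sum.union_disjoint[symmetric, OF finB BB(2)])
  also have "\<dots> = m * card B - edge_weight E B B"
    unfolding edge_weight_sum_left[of E B B] by (simp add: sum_subtractf)
  finally have 3: "2 * edge_weight E B1 W + 2 * edge_weight E B2 P
    \<le> m * card B - edge_weight E B B" .
  have "edge_weight E B B = edge_weight E B1 B1 + edge_weight E B1 B2 + edge_weight E B2 B1 + edge_weight E B2 B2"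
    unfolding BB(1) using finB BB(2) by (simp add: edge_weight_Un_left edge_weight_Un_right)
  \<comment> \<open>Edges between the two parts of the separator also enter the cut; the term
    subtracted for neighbours inside \<open>B\<close> pays for them.\<close>
  then have "2 * edge_weight E B1 B2 \<le> edge_weight E B B"
    using edge_weight_nonneg[of E B1 B1] edge_weight_nonneg[of E B2 B2] edge_weight_commute[of E B1 B2] by linarith
  then have "2 * edge_weight E (P \<union> B1) (V - (P \<union> B1)) \<le> 2 * edge_weight E P W + m * card B"
    unfolding cS e using add_mono[OF 3] by fastforce
  moreover have "P \<union> B1 \<subseteq> V" "W \<subseteq> V - (P \<union> B1)" using VU BB by blast+
  ultimately show ?thesis unfolding m_def by blast
qed

lemma vol_ge:
  assumes "S \<subseteq> V" "\<lceil>(real b - 1) / 2\<rceil> \<le> int (card (S \<inter> X))" "\<lceil>(real a - 1) / 2\<rceil> \<le> int (card (S \<inter> Y))"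
  shows "real a * real_of_int \<lceil>(real b - 1) / 2\<rceil> + real b * real_of_int \<lceil>(real a - 1) / 2\<rceil> \<le> vol S"
proof -
  have fin: "finite S" using assms(1) finV finite_subset by blast
  have S: "S = S \<inter> X \<union> S \<inter> Y" "S \<inter> X \<inter> (S \<inter> Y) = {}" using assms(1) XY by (auto simp: V_def)
  have "vol S = vol (S \<inter> X) + vol (S \<inter> Y)"
    unfolding vol_def using sum.union_disjoint[of "S \<inter> X" "S \<inter> Y" dg] fin S by (metis finite_Int)
  also have "vol (S \<inter> X) = real a * card (S \<inter> X)" by (simp add: vol_def dg_def)
  also have "vol (S \<inter> Y) = real b * card (S \<inter> Y)"
  proof -
    have "dg v = b" if "v \<in> S \<inter> Y" for v using that XY by (auto simp: dg_def)
    then show ?thesis by (simp add: vol_def)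
  qed
  finally show ?thesis
    using mult_left_mono[of "real_of_int \<lceil>(real b - 1) / 2\<rceil>" "card (S \<inter> X)" "real a"]
      mult_left_mono[of "real_of_int \<lceil>(real a - 1) / 2\<rceil>" "card (S \<inter> Y)" "real b"] assms(2,3) by simp
qed

lemma mixed_connected:
  assumes k: "1 \<le> k" "6 * k \<le> a" "6 * k \<le> b"
    and gap: "graph_eigenvalue V E 2 \<le> sqrt (real a * real b) - (3 * real k + real (max a b))
      / sqrt (real_of_int \<lceil>(real a - 1) / 2\<rceil> * real_of_int \<lceil>(real b - 1) / 2\<rceil>)"
  shows "mixed_connected k V E"
  unfolding mixed_connected_def
proof (intro allI impI, elim conjE, rule ccontr)
  fix P B W
  assume VU: "P \<union> B \<union> W = V" "P \<inter> B = {}" "P \<inter> W = {}" "B \<inter> W = {}"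
    and ne: "P \<noteq> {}" "W \<noteq> {}" and B: "card B \<le> 2"
    and neg: "\<not> 6 * k \<le> 2 * k * card B + card (edges_between E P W)"
  define p q where "p = real_of_int \<lceil>(real a - 1) / 2\<rceil>" and "q = real_of_int \<lceil>(real b - 1) / 2\<rceil>"
  define m where "m = real (max a b)"
  define s where "s = sqrt (real a * real b)"
  have fin: "finite P" "finite B" "finite W" using finV unfolding VU(1)[symmetric] by simp_all
  have "real (2 * k * card B + card (edges_between E P W)) < real (6 * k)"
    using neg by (simp only: of_nat_less_iff not_le)
  then have cut: "edge_weight E P W + 2 * real k * card B < 6 * real k"
    using edge_weight_le_edges_between[OF finE fin(1,3) VU(3)] by simp
  have VU': "W \<union> B \<union> P = V" "W \<inter> B = {}" "W \<inter> P = {}" "B \<inter> P = {}" using VU by blast+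
  have cut': "edge_weight E W P + 2 * real k * card B < 6 * real k"
    using cut by (simp add: edge_weight_commute)
  note Pl = small_side_large[OF VU ne(1) B k cut] and Wl = small_side_large[OF VU' ne(2) B k cut']
  define D where "D = real a * q + real b * p"
  have VP: "D \<le> vol P" "D \<le> vol W"
    unfolding D_def p_def q_def using vol_ge[OF _ Pl] vol_ge[OF _ Wl] VU(1) by blast+
  obtain S where S: "P \<subseteq> S" "S \<subseteq> V" "W \<subseteq> V - S"
    and eS: "2 * edge_weight E S (V - S) \<le> 2 * edge_weight E P W + m * card B"
    using absorb_separator[OF VU] unfolding m_def by blast
  define e where "e = edge_weight E S (V - S)"
  have vS: "D \<le> vol S" "D \<le> vol (V - S)"
    using VP vol_mono[OF S(1,2)] vol_mono[OF S(3)] by auto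
  have pq: "0 < p" "0 < q" using k by (auto simp: p_def q_def)
  have D0: "0 < D" using pq ab by (simp add: D_def add_pos_pos)
  have s0: "0 < s" using ab by (simp add: s_def)
  have m: "6 * real k \<le> m" using k by (simp add: m_def)
  have "e < 3 * real k + m"
  proof -
    \<comment> \<open>Two separating vertices are the worst case: each raises the bound on
      \<open>2 * e\<close> by \<open>m\<close> and lowers it by \<open>4 * k\<close>, and
      \<open>m\<close> is the larger.\<close>
    have "(m - 4 * real k) * card B \<le> (m - 4 * real k) * 2"
      using B m by (intro mult_left_mono) auto
    then have "m * card B - 4 * real k * card B \<le> 2 * m - 8 * real k" by (simp add: algebra_simps)
    then have "2 * e < 12 * real k + 2 * m - 8 * real k" using eS cut unfolding e_def by linarith
    then show ?thesis using k(1) by simp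
  qed
  moreover have "3 * real k + m \<le> e"
  proof -
    let ?l = "graph_eigenvalue V E 2"
    have "(3 * real k + m) / sqrt (p * q) \<le> s - ?l"
      using gap unfolding p_def q_def m_def s_def by linarith
    then have gap': "3 * real k + m \<le> (s - ?l) * sqrt (p * q)"
      using pq by (simp add: pos_divide_le_eq)
    have l0: "0 \<le> s - ?l"
    proof -
      have "0 \<le> (3 * real k + m) / sqrt (p * q)" using m pq by simp
      then show ?thesis using gap unfolding p_def q_def m_def s_def by linarith
    qed
    \<comment> \<open>The arithmetic-geometric mean inequality for \<open>a * q\<close> and
      \<open>b * p\<close> turns the degree sum of a side into the denominator of the
      hypothesis.\<close>
    have amgm: "2 * (s * sqrt (p * q)) \<le> D"
    proof -
      have "0 \<le> (sqrt (real a * q) - sqrt (real b * p))\<^sup>2" by simp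
      then have "2 * (sqrt (real a * q) * sqrt (real b * p)) \<le> D"
        using pq ab by (simp add: power2_diff D_def)
      moreover have "sqrt (real a * q) * sqrt (real b * p) = s * sqrt (p * q)"
        by (simp add: s_def real_sqrt_mult ac_simps)
      ultimately show ?thesis by simp
    qed
    \<comment> \<open>Both \<open>S\<close> and its complement have volume at least
      \<open>D\<close>; multiplying each bound by the other volume and adding yields the total
      volume on the left.\<close>
    have prod: "D * vol V \<le> 2 * (vol S * vol (V - S))"
    proof -
      have "0 \<le> (vol S - D) * vol (V - S) + (vol (V - S) - D) * vol S"
        using vS D0 by (intro add_nonneg_nonneg mult_nonneg_nonneg) auto
      then show ?thesis unfolding vol_Un[OF S(2), symmetric] by (simp add: algebra_simps)
    qed
    have vV: "0 < vol V" using vol_Un[OF S(2)] vS D0 by linarith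
    have "S \<noteq> {}" "S \<noteq> V" using S ne by auto
    from spectral_cut[OF S(2) this]
    have "(s - ?l) * (vol S * vol (V - S)) \<le> s * e * vol V" by (simp add: s_def e_def)
    moreover have "(s - ?l) * (D * vol V) \<le> (s - ?l) * (2 * (vol S * vol (V - S)))"
      using prod l0 by (rule mult_left_mono)
    ultimately have "((s - ?l) * D) * vol V \<le> (2 * s * e) * vol V" by simp
    then have "(s - ?l) * D \<le> 2 * s * e" using vV by (simp only: mult_le_cancel_right_pos)
    moreover have "(s - ?l) * (2 * (s * sqrt (p * q))) \<le> (s - ?l) * D"
      using amgm l0 by (rule mult_left_mono)
    ultimately have "(s - ?l) * (2 * (s * sqrt (p * q))) \<le> 2 * s * e" by (rule order_trans[rotated])
    moreover have "(s - ?l) * (2 * (s * sqrt (p * q))) = (2 * s) * ((s - ?l) * sqrt (p * q))"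
      by (simp only: ac_simps)
    ultimately have "(2 * s) * ((s - ?l) * sqrt (p * q)) \<le> (2 * s) * e" by (simp only:)
    then have "(s - ?l) * sqrt (p * q) \<le> e" using s0 by simp
    then show ?thesis using gap' by simp
  qed
  ultimately show False by simp
qed

end

theorem theorem2p4:
  fixes X Y :: "'a set" and E :: "'a set set" and a b k :: nat
  assumes "k \<ge> 1"
    and "biregular_graph X Y a b E"
    and "a \<ge> 6 * k" and "b \<ge> 6 * k"
    and "graph_eigenvalue (X \<union> Y) E 2
           \<le> sqrt (real a * real b)
             - (3 * real k + real (max a b))
               / sqrt (real_of_int \<lceil>(real a - 1) / 2\<rceil> * real_of_int \<lceil>(real b - 1) / 2\<rceil>)"
  shows "\<exists>F :: nat \<Rightarrow> 'a set set.
           disjoint_family_on F {..<k} \<and>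
           (\<forall>i<k. spanning_subgraph (F i) (X \<union> Y) E \<and> rigid_graph (X \<union> Y) (F i))"
proof -
  interpret biregular X Y a b E by unfold_locales (rule assms(2))
  obtain x y where "x \<in> X" "y \<in> Y" using XY by blast
  then have "{x, y} \<subseteq> V" "x \<noteq> y" using XY by (auto simp: V_def)
  then have "2 \<le> card V" using card_mono[OF finV, of "{x, y}"] by simp
  moreover have "mixed_connected k V E"
    by (rule mixed_connected) (use assms in \<open>auto simp: V_def\<close>)
  ultimately show ?thesis
    using mixed_connected_rigid_packing[OF simple _ _ assms(1)] unfolding V_def by blast
qed

end
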